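(* Let $(d_n)_{n\ge1}$ be a sequence of dimensions with $d_n\to\infty$ as $n\to\infty$, and for each $n$ let $X$ be a random vector in $\mathbb{R}^{d}$, $d=d_n$, such that the four conditions (A1)--(A4) listed in the context hold for all sufficiently large $n$, with constants $\kappa>0$, $\delta>0$ independent of $d$ and $n$. Put $\epsilon=d^2/n$, and let $U_d$, $I(a)$, $c_3$, $c_4$ be as defined in the context. Then there exist an absolute constant $C>0$ (independent of the law of $X$, of $d$ and of $n$) and a number $\epsilon_0>0$ depending only on $\kappa$ and $\delta$ such that, for all $n$ for which (A1)--(A4) hold and for which $\epsilon\le\epsilon_0$, $$|I(a)-1|\le C\left[\exp(40\,c_4\,\epsilon)\,(c_3^2+c_4)\,\epsilon+\exp(-d)+\left(\frac{e}{\kappa^2}\,\epsilon\right)^{d/2}\right]\qquad\text{for all } a\in U_d .$$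
   Context: $\|\cdot\|$ is the Euclidean norm on $\mathbb{R}^d$, and for a real $k$-tensor $T$ the operator norm is $\|T\|=\sup_{\|u_1\|=\dots=\|u_k\|=1}T[u_1,\dots,u_k]$, where $T[u_1,\dots,u_k]=\sum_{i_1,\dots,i_k}T_{i_1\dots i_k}(u_1)_{i_1}\cdots(u_k)_{i_k}$. $\nabla^k f$ is the tensor of $k$-th order partial derivatives; $\nabla_t^k$ denotes derivatives with respect to $t\in\mathbb{R}^d$. $\mathrm{Arg}$ is the principal branch of the argument. The moment generating function and cumulant generating function of $X$ are $\phi(\tau)=\mathbb{E}\exp(\tau\cdot X)$ and $\varphi(\tau)=\log\phi(\tau)$. They are continued analytically to complex arguments: $\phi(\tau+is)=\mathbb{E}\exp((\tau+is)\cdot X)$ for $\tau\in V_d$, $s\in\mathbb{R}^d$, and $\varphi=\log|\phi|+i\,\mathrm{Arg}\,\phi$ at the points appearing in (A4). For $\tau\in V_d$ write $H=H(\tau)=\nabla^2\varphi(\tau)$. Conditions, for given $n$ and $d=d_n$: (A1) There is a neighborhood $V_d\subset\mathbb{R}^d$ of the origin with $\sup_{\tau\in V_d}\mathbb{E}\big(\|X\|^4\exp(\tau\cdot X)\big)<\infty$. (A2) $H(\tau)=\nabla^2\varphi(\tau)$ is positive definite for all $\tau\in V_d$, and $\sup_{\tau\in V_d}\|H^{-1}(\tau)\|<\infty$. (A3) For all $\tau\in V_d$ and all $t\in\mathbb{R}^d$ with $\|t\|\ge 2.5(d/n)^{1/2}$, $$\left|\frac{\phi(\tau+iH^{-1/2}t)}{\phi(\tau)}\right|\le\max\Big(\exp\big(-(d/n)^{1/2}\|t\|\big),\,(1+\|t\|)^{-\kappa/d^{1/2}}\Big).$$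 (A4) $|\mathrm{Arg}\,\phi(\tau+iH^{-1/2}t)|\le\pi-\delta$ and $|\phi(\tau+iH^{-1/2}t)|\ge\delta$ for all $\tau\in V_d$ and $\|t\|\le 2.5(d/n)^{1/2}$. Define $$c_3=\sup_{\tau\in V_d,\ \|t\|<2.5(d/n)^{1/2}}\big\|\nabla_t^3\,\mathrm{Im}\,\varphi(\tau+iH^{-1/2}t)\big\|,\qquad c_4=\sup_{\tau\in V_d,\ \|t\|<2.5(d/n)^{1/2}}\big\|\nabla_t^4\,\mathrm{Re}\,\varphi(\tau+iH^{-1/2}t)\big\|$$ (these may depend on $d$ and $n$). Let $U_d=\nabla\varphi(V_d)$. For $a\in U_d$ let $\tau=(\nabla\varphi)^{-1}(a)\in V_d$ (unique by positive definiteness of the Hessian), $H=H(\tau)$, and $$I(a)=\frac{n^{d/2}}{(2\pi)^{d/2}}\int_{\mathbb{R}^d}\left[\frac{\phi(\tau+iH^{-1/2}t)}{\phi(\tau)}\right]^n e^{-in\langle H^{-1/2}t,\,a\rangle}\,dt .$$ *)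

theory Defs
  imports "HOL-Probability.Probability" "Jordan_Normal_Form.Gauss_Jordan_Elimination"
begin

text \<open>
  The dimension \<open>d\<close> varies with \<open>n\<close> and the constants of the theorem must not depend on it, so
  \<open>\<real>\<^sup>d\<close> is not a type: its vectors are the extensional functions on \<open>{..<d}\<close>. These are the carrier
  of the topology \<^term>\<open>powertop_real {..<d}\<close> and of the measure spaces \<^term>\<open>Pi\<^sub>M {..<d} (\<lambda>_. borel)\<close>
  and \<^term>\<open>Pi\<^sub>M {..<d} (\<lambda>_. lborel)\<close>, the latter being Lebesgue measure on \<open>\<real>\<^sup>d\<close>.
\<close>

abbreviation Rd :: "nat \<Rightarrow> (nat \<Rightarrow> real) set" where
  "Rd d \<equiv> {..<d} \<rightarrow>\<^sub>E UNIV"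

abbreviation dot :: "nat \<Rightarrow> (nat \<Rightarrow> real) \<Rightarrow> (nat \<Rightarrow> real) \<Rightarrow> real" where
  "dot d u v \<equiv> \<Sum>i<d. u i * v i"

abbreviation vnorm :: "nat \<Rightarrow> (nat \<Rightarrow> real) \<Rightarrow> real" where
  "vnorm d v \<equiv> L2_set v {..<d}"

text \<open>
  A \<open>k\<close>-tensor on \<open>\<real>\<^sup>d\<close> is a function of index lists; only lists of length \<open>k\<close> with entries below
  \<open>d\<close> matter. The vectors \<open>u 0, \<dots>, u (k - 1)\<close> below are the arguments \<open>u\<^sub>1, \<dots>, u\<^sub>k\<close>.
\<close>

definition tensor_apply :: "nat \<Rightarrow> nat \<Rightarrow> (nat list \<Rightarrow> real) \<Rightarrow> (nat \<Rightarrow> nat \<Rightarrow> real) \<Rightarrow> real" where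
  "tensor_apply d k T u = (\<Sum>is \<in> {is. set is \<subseteq> {..<d} \<and> length is = k}. T is * (\<Prod>l<k. u l (is ! l)))"

definition op_norm :: "nat \<Rightarrow> nat \<Rightarrow> (nat list \<Rightarrow> real) \<Rightarrow> real" where
  "op_norm d k T = (SUP u \<in> {u. \<forall>l<k. u l \<in> Rd d \<and> vnorm d (u l) = 1}. tensor_apply d k T u)"

definition partial_deriv ::
    "nat \<Rightarrow> ((nat \<Rightarrow> real) \<Rightarrow> real) \<Rightarrow> (nat \<Rightarrow> real) \<Rightarrow> real" where
  "partial_deriv i f x = deriv (\<lambda>h. f (x(i := h))) (x i)"

text \<open>
  The entry of the tensor \<open>\<nabla>\<^sup>k f (x)\<close> at the index list \<open>is\<close> of length \<open>k\<close>.
\<close>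

definition nabla :: "((nat \<Rightarrow> real) \<Rightarrow> real) \<Rightarrow> (nat \<Rightarrow> real) \<Rightarrow> nat list \<Rightarrow> real" where
  "nabla f x is = foldr partial_deriv is f x"

definition pos_def_mat :: "nat \<Rightarrow> real mat \<Rightarrow> bool" where
  "pos_def_mat d A \<longleftrightarrow> A \<in> carrier_mat d d \<and> transpose_mat A = A \<and>
     (\<forall>v \<in> carrier_vec d. v \<noteq> 0\<^sub>v d \<longrightarrow> 0 < scalar_prod v (A *\<^sub>v v))"

abbreviation mat_inv :: "real mat \<Rightarrow> real mat" where
  "mat_inv A \<equiv> the (mat_inverse A)"

definition mat_inv_sqrt :: "nat \<Rightarrow> real mat \<Rightarrow> real mat" where
  "mat_inv_sqrt d A = (THE R. pos_def_mat d R \<and> R * R = mat_inv A)"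

text \<open>
  Every object attached to the random vector \<open>X\<close> depends only on its law \<open>\<mu>\<close>, a probability measure on
  \<open>\<real>\<^sup>d\<close>, and is defined from \<open>\<mu>\<close>; expectations \<open>\<bbbE> g(X)\<close> are integrals of \<open>g\<close> against \<open>\<mu>\<close>.
  Working with laws keeps the underlying probability space, hence its type, out of the constants.
\<close>

definition is_law :: "nat \<Rightarrow> (nat \<Rightarrow> real) measure \<Rightarrow> bool" where
  "is_law d \<mu> \<longleftrightarrow> prob_space \<mu> \<and> sets \<mu> = sets (Pi\<^sub>M {..<d} (\<lambda>_. borel))"

definition mgf :: "nat \<Rightarrow> (nat \<Rightarrow> real) measure \<Rightarrow> (nat \<Rightarrow> real) \<Rightarrow> real" where
  "mgf d \<mu> \<tau> = (\<integral>x. exp (dot d \<tau> x) \<partial>\<mu>)"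

definition cgf :: "nat \<Rightarrow> (nat \<Rightarrow> real) measure \<Rightarrow> (nat \<Rightarrow> real) \<Rightarrow> real" where
  "cgf d \<mu> \<tau> = ln (mgf d \<mu> \<tau>)"

text \<open>The continuations to complex arguments; \<^const>\<open>Arg\<close> is the principal branch, in \<open>(-\<pi>, \<pi>]\<close>.\<close>

definition cmgf :: "nat \<Rightarrow> (nat \<Rightarrow> real) measure \<Rightarrow> (nat \<Rightarrow> complex) \<Rightarrow> complex" where
  "cmgf d \<mu> z = (\<integral>x. exp (\<Sum>i<d. z i * of_real (x i)) \<partial>\<mu>)"

definition ccgf :: "nat \<Rightarrow> (nat \<Rightarrow> real) measure \<Rightarrow> (nat \<Rightarrow> complex) \<Rightarrow> complex" where
  "ccgf d \<mu> z = of_real (ln (cmod (cmgf d \<mu> z))) + \<i> * of_real (Arg (cmgf d \<mu> z))"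

definition grad_cgf :: "nat \<Rightarrow> (nat \<Rightarrow> real) measure \<Rightarrow> (nat \<Rightarrow> real) \<Rightarrow> nat \<Rightarrow> real" where
  "grad_cgf d \<mu> \<tau> = (\<lambda>i\<in>{..<d}. nabla (cgf d \<mu>) \<tau> [i])"

definition hess_cgf :: "nat \<Rightarrow> (nat \<Rightarrow> real) measure \<Rightarrow> (nat \<Rightarrow> real) \<Rightarrow> real mat" where
  "hess_cgf d \<mu> \<tau> = Matrix.mat d d (\<lambda>(i, j). nabla (cgf d \<mu>) \<tau> [i, j])"

text \<open>The vector \<open>H\<^sup>-\<^sup>1\<^sup>/\<^sup>2 t\<close>, where \<open>H\<close> is the Hessian of the cumulant generating function
  at \<open>\<tau>\<close>, and the complex argument \<open>\<tau> + \<i> H\<^sup>-\<^sup>1\<^sup>/\<^sup>2 t\<close>.\<close>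

definition whiten ::
    "nat \<Rightarrow> (nat \<Rightarrow> real) measure \<Rightarrow> (nat \<Rightarrow> real) \<Rightarrow> (nat \<Rightarrow> real) \<Rightarrow> nat \<Rightarrow> real" where
  "whiten d \<mu> \<tau> t = (\<lambda>i\<in>{..<d}. \<Sum>j<d. mat_inv_sqrt d (hess_cgf d \<mu> \<tau>) $$ (i, j) * t j)"

definition cpoint ::
    "nat \<Rightarrow> (nat \<Rightarrow> real) measure \<Rightarrow> (nat \<Rightarrow> real) \<Rightarrow> (nat \<Rightarrow> real) \<Rightarrow> nat \<Rightarrow> complex" where
  "cpoint d \<mu> \<tau> t = (\<lambda>i. of_real (\<tau> i) + \<i> * of_real (whiten d \<mu> \<tau> t i))"

definition radius :: "nat \<Rightarrow> nat \<Rightarrow> real" where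
  "radius n d = 5/2 * sqrt (real d / real n)"

text \<open>
  The neighborhood \<open>V\<close> of the origin is taken to be open, so that the derivatives of the cumulant
  generating function make sense at each of its points. The integral in \<open>A1\<close> takes values in
  \<open>[0, \<infinity>]\<close>, so that the condition includes the finiteness of each of the expectations.
\<close>

definition A1 :: "nat \<Rightarrow> (nat \<Rightarrow> real) measure \<Rightarrow> (nat \<Rightarrow> real) set \<Rightarrow> bool" where
  "A1 d \<mu> V \<longleftrightarrow> openin (powertop_real {..<d}) V \<and> (\<lambda>i\<in>{..<d}. 0) \<in> V \<and>
     (SUP \<tau>\<in>V. \<integral>\<^sup>+x. ennreal (vnorm d x ^ 4 * exp (dot d \<tau> x)) \<partial>\<mu>) < \<infinity>"

definition A2 :: "nat \<Rightarrow> (nat \<Rightarrow> real) measure \<Rightarrow> (nat \<Rightarrow> real) set \<Rightarrow> bool" where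
  "A2 d \<mu> V \<longleftrightarrow> (\<forall>\<tau>\<in>V. pos_def_mat d (hess_cgf d \<mu> \<tau>)) \<and>
     bdd_above ((\<lambda>\<tau>. op_norm d 2 (\<lambda>is. mat_inv (hess_cgf d \<mu> \<tau>) $$ (is ! 0, is ! 1))) ` V)"

definition A3 :: "real \<Rightarrow> nat \<Rightarrow> nat \<Rightarrow> (nat \<Rightarrow> real) measure \<Rightarrow> (nat \<Rightarrow> real) set \<Rightarrow> bool" where
  "A3 \<kappa> n d \<mu> V \<longleftrightarrow> (\<forall>\<tau>\<in>V. \<forall>t\<in>Rd d. vnorm d t \<ge> radius n d \<longrightarrow>
     cmod (cmgf d \<mu> (cpoint d \<mu> \<tau> t) / of_real (mgf d \<mu> \<tau>))
       \<le> max (exp (- (sqrt (real d / real n) * vnorm d t)))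
             ((1 + vnorm d t) powr (- \<kappa> / sqrt (real d))))"

definition A4 :: "real \<Rightarrow> nat \<Rightarrow> nat \<Rightarrow> (nat \<Rightarrow> real) measure \<Rightarrow> (nat \<Rightarrow> real) set \<Rightarrow> bool" where
  "A4 \<delta> n d \<mu> V \<longleftrightarrow> (\<forall>\<tau>\<in>V. \<forall>t\<in>Rd d. vnorm d t \<le> radius n d \<longrightarrow>
     \<bar>Arg (cmgf d \<mu> (cpoint d \<mu> \<tau> t))\<bar> \<le> pi - \<delta> \<and> cmod (cmgf d \<mu> (cpoint d \<mu> \<tau> t)) \<ge> \<delta>)"

definition conditions ::
    "real \<Rightarrow> real \<Rightarrow> nat \<Rightarrow> nat \<Rightarrow> (nat \<Rightarrow> real) measure \<Rightarrow> (nat \<Rightarrow> real) set \<Rightarrow> bool" where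
  "conditions \<kappa> \<delta> n d \<mu> V \<longleftrightarrow> A1 d \<mu> V \<and> A2 d \<mu> V \<and> A3 \<kappa> n d \<mu> V \<and> A4 \<delta> n d \<mu> V"

text \<open>
  Under \<open>A1\<close>, \<open>A2\<close> and \<open>A4\<close> both suprema are over nonempty bounded sets of reals: the bounds on
  \<open>\<bbbE> \<parallel>X\<parallel>\<^sup>4 exp(\<tau> \<bullet> X)\<close> and on \<open>H\<^sup>-\<^sup>1\<close> together bound the moment generating function on \<open>V\<close>, and its
  complex values in question are bounded away from zero.
\<close>

definition c3 :: "nat \<Rightarrow> nat \<Rightarrow> (nat \<Rightarrow> real) measure \<Rightarrow> (nat \<Rightarrow> real) set \<Rightarrow> real" where
  "c3 n d \<mu> V = (SUP (\<tau>, t) \<in> V \<times> {t \<in> Rd d. vnorm d t < radius n d}.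
     op_norm d 3 (nabla (\<lambda>t. Im (ccgf d \<mu> (cpoint d \<mu> \<tau> t))) t))"

definition c4 :: "nat \<Rightarrow> nat \<Rightarrow> (nat \<Rightarrow> real) measure \<Rightarrow> (nat \<Rightarrow> real) set \<Rightarrow> real" where
  "c4 n d \<mu> V = (SUP (\<tau>, t) \<in> V \<times> {t \<in> Rd d. vnorm d t < radius n d}.
     op_norm d 4 (nabla (\<lambda>t. Re (ccgf d \<mu> (cpoint d \<mu> \<tau> t))) t))"

definition U :: "nat \<Rightarrow> (nat \<Rightarrow> real) measure \<Rightarrow> (nat \<Rightarrow> real) set \<Rightarrow> (nat \<Rightarrow> real) set" where
  "U d \<mu> V = grad_cgf d \<mu> ` V"

definition I_integral ::
    "nat \<Rightarrow> nat \<Rightarrow> (nat \<Rightarrow> real) measure \<Rightarrow> (nat \<Rightarrow> real) set \<Rightarrow> (nat \<Rightarrow> real) \<Rightarrow> complex" where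
  "I_integral n d \<mu> V a = (let \<tau> = inv_into V (grad_cgf d \<mu>) a in
     of_real (real n powr (real d / 2) / (2 * pi) powr (real d / 2)) *
     (\<integral>t. (cmgf d \<mu> (cpoint d \<mu> \<tau> t) / of_real (mgf d \<mu> \<tau>)) ^ n *
           exp (- \<i> * of_real (real n * dot d (whiten d \<mu> \<tau> t) a)) \<partial>Pi\<^sub>M {..<d} (\<lambda>_. lborel)))"

end

theory Submission
  imports Defs "Jordan_Normal_Form.Determinant" "HOL-Complex_Analysis.Cauchy_Integral_Theorem"
begin

text \<open>
  Fix \<open>\<tau> \<in> V\<close>, let \<open>a\<close> be the gradient of the cumulant generating function at \<open>\<tau>\<close> and \<open>H\<close> its Hessian there,
  tilt the law of \<open>X\<close> by \<open>exp (\<tau> \<bullet> x)\<close> and put \<open>Y = H\<^sup>-\<^sup>1\<^sup>/\<^sup>2 (X - a)\<close>. Under the tilted law \<open>Y\<close> is centred with identity covariance, and its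
  characteristic function \<open>\<chi>\<close> absorbs both the quotient and the oscillating factor of the integrand, so that
  \<open>I(a) = (n / 2\<pi>)\<^sup>d\<^sup>/\<^sup>2 \<integral> \<chi>(t)\<^sup>n dt\<close>. The integral is split at \<open>\<rho> = 2.5 (d / n)\<^sup>1\<^sup>/\<^sup>2\<close>.

  For \<open>\<parallel>t\<parallel> < \<rho>\<close> there is a logarithm \<open>L\<close> of \<open>\<chi>\<close>, whose derivatives are complex joint cumulants. At the
  origin its real part agrees with \<open>- \<parallel>t\<parallel>\<^sup>2 / 2\<close> up to third order, its imaginary part with \<open>0\<close> up to second
  order. Hence \<open>n Re L = - n \<parallel>t\<parallel>\<^sup>2 / 2 + r\<close> with \<open>\<bar>r\<bar> \<le> n c\<^sub>4 \<parallel>t\<parallel>\<^sup>4 / 24\<close>, and the error is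
  governed by the averages of \<open>\<bar>r\<bar>\<close> and of \<open>(n Im L)\<^sup>2\<close> under the Gaussian law of variance \<open>1 / n\<close>; the
  integral of \<open>\<chi>\<^sup>n\<close> over the ball is real by the symmetry \<open>t \<mapsto> - t\<close>, which is why the imaginary part of
  \<open>L\<close> enters only through its square. The pointwise bound \<open>\<bar>Im L\<bar> \<le> c\<^sub>3 \<parallel>t\<parallel>\<^sup>3 / 2\<close> would give
  \<open>c\<^sub>3\<^sup>2 d\<^sup>3 / n\<close>, one factor \<open>d\<close> too much. That factor is saved by a Poincare inequality: \<open>Im L\<close> is
  odd, so its mean square is controlled by that of its gradient, which has length at most \<open>c\<^sub>3 \<parallel>t\<parallel>\<^sup>2 / 2\<close>.
  The inequality has to hold on a ball, outside of which \<open>L\<close> is undefined. It is obtained by joining \<open>x\<close> to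
  \<open>- x\<close> along the half circle \<open>x cos \<theta> + y sin \<theta>\<close>, where \<open>y\<close> is an independent copy of \<open>x\<close> and
  \<open>\<parallel>x\<parallel>\<^sup>2 + \<parallel>y\<parallel>\<^sup>2 < \<rho>\<^sup>2\<close>: this event is invariant under the rotations of the pair and keeps the whole path
  in the ball (lemmas \<open>half_circle_bound\<close>, \<open>poincare_pair\<close>, \<open>Im_L_sq_ball\<close> and \<open>core_bound\<close>).

  For \<open>\<parallel>t\<parallel> \<ge> \<rho>\<close> the two decay functions of the third condition are integrated in layers, the volume of a ball
  being estimated by a Gaussian integral (lemmas \<open>outer_exp_bound\<close> and \<open>outer_powr_bound\<close>). The remaining work
  identifies the tensors in \<open>c\<^sub>3\<close> and \<open>c\<^sub>4\<close> with cumulants (\<open>tensor3\<close>, \<open>tensor4\<close>) and shows that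
  the suprema defining these constants are over bounded sets (\<open>uniform_entries\<close>), without which they would
  bound nothing. The theorem follows with \<open>C = 600\<close> and \<open>\<epsilon>\<^sub>0 = \<kappa> / 10\<close>.
\<close>

section \<open>Square roots of positive definite matrices\<close>

text \<open>
  Square matrices are handled as functions of two indices, of which only the values below the dimension
  matter; the matrices of the theorem are converted at the end of this part.
\<close>

definition qform :: "nat \<Rightarrow> (nat \<Rightarrow> nat \<Rightarrow> real) \<Rightarrow> (nat \<Rightarrow> real) \<Rightarrow> (nat \<Rightarrow> real) \<Rightarrow> real" where
  "qform d A v w = (\<Sum>i<d. \<Sum>j<d. v i * A i j * w j)"

definition mat_vec :: "nat \<Rightarrow> (nat \<Rightarrow> nat \<Rightarrow> real) \<Rightarrow> (nat \<Rightarrow> real) \<Rightarrow> nat \<Rightarrow> real" where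
  "mat_vec d A v = (\<lambda>i. \<Sum>j<d. A i j * v j)"

lemma qform_mat_vec: "qform d A v w = dot d v (mat_vec d A w)"
  by (simp add: qform_def mat_vec_def sum_distrib_left mult.assoc)

lemma qform_sym:
  assumes "\<And>i j. i < d \<Longrightarrow> j < d \<Longrightarrow> A i j = A j i"
  shows "qform d A v w = qform d A w v"
proof -
  have "qform d A v w = (\<Sum>j<d. \<Sum>i<d. v i * A i j * w j)"
    unfolding qform_def by (rule sum.swap)
  also have "\<dots> = (\<Sum>j<d. \<Sum>i<d. w j * A j i * v i)"
    by (intro sum.cong refl) (auto simp: assms mult_ac)
  finally show ?thesis by (simp add: qform_def)
qed

lemma qform_add_scale:
  assumes "\<And>i j. i < d \<Longrightarrow> j < d \<Longrightarrow> A i j = A j i"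
  shows "qform d A (\<lambda>i. v i + s * w i) (\<lambda>i. v i + s * w i)
    = qform d A v v + 2 * s * qform d A v w + s\<^sup>2 * qform d A w w"
proof -
  have "qform d A (\<lambda>i. v i + s * w i) (\<lambda>i. v i + s * w i)
     = qform d A v v + s * qform d A v w + s * qform d A w v + s\<^sup>2 * qform d A w w"
    unfolding qform_def
    by (simp add: algebra_simps power2_eq_square sum.distrib sum_distrib_left)
  then show ?thesis using qform_sym[OF assms, where v=w and w=v] by simp
qed

text \<open>
  A symmetric form between \<open>0\<close> and \<open>q \<parallel>v\<parallel>\<^sup>2\<close> has operator norm at most \<open>q\<close>: expand the form at
  \<open>v - M v / q\<close>, where it is nonnegative.
\<close>

lemma psd_contraction:
  assumes sym: "\<And>i j. i < d \<Longrightarrow> j < d \<Longrightarrow> M i j = M j i"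
    and pos: "\<And>v. 0 \<le> qform d M v v"
    and le: "\<And>v. qform d M v v \<le> q * dot d v v" and q: "0 < q"
  shows "dot d (mat_vec d M v) (mat_vec d M v) \<le> q\<^sup>2 * dot d v v"
proof -
  let ?w = "mat_vec d M v"
  let ?N = "dot d ?w ?w"
  have "0 \<le> qform d M (\<lambda>i. v i + (- (1/q)) * ?w i) (\<lambda>i. v i + (- (1/q)) * ?w i)" by (rule pos)
  also have "\<dots> = qform d M v v + 2 * (- (1/q)) * qform d M v ?w + (- (1/q))\<^sup>2 * qform d M ?w ?w"
    by (rule qform_add_scale[OF sym])
  also have "qform d M v ?w = ?N" using qform_sym[OF sym, where v=v and w="?w"]
    by (simp add: qform_mat_vec)
  finally have "0 \<le> qform d M v v - 2 * ?N / q + qform d M ?w ?w / q\<^sup>2"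
    by (simp add: power2_eq_square field_simps)
  also have "\<dots> \<le> q * dot d v v - 2 * ?N / q + q * ?N / q\<^sup>2"
    using le[of v] le[of ?w] q by (intro add_mono diff_mono divide_right_mono) auto
  also have "\<dots> = q * dot d v v - ?N / q" using q by (simp add: power2_eq_square field_simps)
  finally show ?thesis using q by (simp add: power2_eq_square field_simps)
qed

fun mpower :: "nat \<Rightarrow> (nat \<Rightarrow> nat \<Rightarrow> real) \<Rightarrow> nat \<Rightarrow> nat \<Rightarrow> nat \<Rightarrow> real" where
  "mpower d M 0 = (\<lambda>i j. if i = j then 1 else 0)"
| "mpower d M (Suc k) = (\<lambda>i j. \<Sum>l<d. M i l * mpower d M k l j)"

lemma mpower_add:
  assumes "i < d"
  shows "mpower d M (a + b) i j = (\<Sum>l<d. mpower d M a i l * mpower d M b l j)"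
  using assms
proof (induction a arbitrary: i)
  case 0
  then show ?case by (simp add: if_distrib[of "\<lambda>x. x * _"] sum.delta cong: if_cong)
next
  case (Suc a)
  have "mpower d M (Suc a + b) i j = (\<Sum>l<d. M i l * (\<Sum>m<d. mpower d M a l m * mpower d M b m j))"
    using Suc by simp
  also have "\<dots> = (\<Sum>m<d. \<Sum>l<d. M i l * mpower d M a l m * mpower d M b m j)"
    unfolding sum_distrib_left by (subst sum.swap) (simp add: mult.assoc)
  finally show ?case by (simp add: sum_distrib_right)
qed

lemma mpower_sym:
  assumes sym: "\<And>i j. i < d \<Longrightarrow> j < d \<Longrightarrow> M i j = M j i" and "i < d" "j < d"
  shows "mpower d M k i j = mpower d M k j i"
  using assms(2,3)
proof (induction k arbitrary: i j)
  case (Suc k)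
  have one: "mpower d M 1 l i = M l i" if "l < d" for l
    using Suc.prems by (simp add: if_distrib[of "\<lambda>x. _ * x"] sum.delta cong: if_cong)
  have "mpower d M (Suc k) i j = (\<Sum>l<d. mpower d M k j l * M l i)"
    using Suc by (auto intro!: sum.cong simp: sym)
  also have "\<dots> = (\<Sum>l<d. mpower d M k j l * mpower d M 1 l i)"
    using one by (intro sum.cong) auto
  also have "\<dots> = mpower d M (k + 1) j i" using Suc.prems by (subst mpower_add) auto
  finally show ?case by simp
qed simp

lemma mpower_bound:
  assumes sym: "\<And>i j. i < d \<Longrightarrow> j < d \<Longrightarrow> M i j = M j i"
    and pos: "\<And>v. 0 \<le> qform d M v v"
    and le: "\<And>v. qform d M v v \<le> q * dot d v v" and q: "0 < q"
    and ij: "i < d" "j < d"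
  shows "\<bar>mpower d M k i j\<bar> \<le> q ^ k"
proof -
  have *: "dot d (\<lambda>i. mpower d M k i j) (\<lambda>i. mpower d M k i j) \<le> (q ^ k)\<^sup>2"
  proof (induction k)
    case 0
    then show ?case using ij by (simp add: if_distrib[of "\<lambda>x. x * _"] sum.delta cong: if_cong)
  next
    case (Suc k)

    have "dot d (\<lambda>i. mpower d M (Suc k) i j) (\<lambda>i. mpower d M (Suc k) i j)
        \<le> q\<^sup>2 * dot d (\<lambda>i. mpower d M k i j) (\<lambda>i. mpower d M k i j)"
      using psd_contraction[OF sym pos le q, of "\<lambda>i. mpower d M k i j"] by (simp add: mat_vec_def)
    also have "\<dots> \<le> q\<^sup>2 * (q ^ k)\<^sup>2" using Suc by (intro mult_left_mono) auto
    finally show ?case by (simp add: power_mult_distrib)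
  qed
  have "(mpower d M k i j)\<^sup>2 \<le> dot d (\<lambda>i. mpower d M k i j) (\<lambda>i. mpower d M k i j)"
    unfolding power2_eq_square
    using member_le_sum[of i "{..<d}" "\<lambda>i. mpower d M k i j * mpower d M k i j"] ij by simp
  with * have "(mpower d M k i j)\<^sup>2 \<le> (q ^ k)\<^sup>2" by linarith
  then show ?thesis using q abs_le_square_iff[of "mpower d M k i j" "q ^ k"] by simp
qed

text \<open>
  The series of \<open>(1 - M)\<^sup>a\<close>, summed entry by entry.
\<close>

definition matrix_binomial :: "nat \<Rightarrow> (nat \<Rightarrow> nat \<Rightarrow> real) \<Rightarrow> real \<Rightarrow> nat \<Rightarrow> nat \<Rightarrow> real" where
  "matrix_binomial d M a i j = (\<Sum>k. (a gchoose k) * (-1) ^ k * mpower d M k i j)"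

locale psd_contraction_matrix =
  fixes d :: nat and M :: "nat \<Rightarrow> nat \<Rightarrow> real" and q :: real
  assumes sym: "\<And>i j. i < d \<Longrightarrow> j < d \<Longrightarrow> M i j = M j i"
    and pos: "\<And>v. 0 \<le> qform d M v v"
    and le: "\<And>v. qform d M v v \<le> q * dot d v v" and q: "0 < q" "q < 1"
begin

lemma summable_bser:
  assumes "i < d" "j < d"
  shows "summable (\<lambda>k. norm ((a gchoose k) * (-1) ^ k * mpower d M k i j))"
proof (rule summable_comparison_test')
  have "ereal (norm q) < 1" using q by simp
  also have "1 \<le> conv_radius (\<lambda>k. a gchoose k)"
    by (cases "a \<in> \<nat>") (auto simp: conv_radius_gchoose)
  finally show "summable (\<lambda>k. norm ((a gchoose k) * q ^ k))"
    by (rule abs_summable_in_conv_radius)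
  show "norm (norm ((a gchoose k) * (-1) ^ k * mpower d M k i j)) \<le> norm ((a gchoose k) * q ^ k)" 
    if "k \<ge> 0" for k
    using mpower_bound[OF sym pos le q(1) assms, of k] q by (simp add: abs_mult mult_left_mono)
qed

text \<open>
  Vandermonde's identity for the binomial coefficients makes the exponents add.
\<close>

lemma matrix_binomial_mult:
  assumes ij: "i < d" "j < d"
  shows "(\<Sum>l<d. matrix_binomial d M a i l * matrix_binomial d M b l j) = matrix_binomial d M (a + b) i j"
proof -
  let ?A = "\<lambda>l k. (a gchoose k) * (-1) ^ k * mpower d M k i l"
  let ?B = "\<lambda>l k. (b gchoose k) * (-1) ^ k * mpower d M k l j"
  have s: "(\<lambda>k. \<Sum>m\<le>k. ?A l m * ?B l (k - m)) sums (matrix_binomial d M a i l * matrix_binomial d M b l j)" if "l < d" for l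
    unfolding matrix_binomial_def
    by (rule Cauchy_product_sums) (use summable_bser ij that in auto)
  have "(\<lambda>k. \<Sum>l<d. \<Sum>m\<le>k. ?A l m * ?B l (k - m)) sums (\<Sum>l<d. matrix_binomial d M a i l * matrix_binomial d M b l j)"
    by (intro sums_sum s) auto
  also have "(\<lambda>k. \<Sum>l<d. \<Sum>m\<le>k. ?A l m * ?B l (k - m)) = (\<lambda>k. ((a + b) gchoose k) * (-1) ^ k * mpower d M k i j)"
  proof
    fix k
    have "(\<Sum>l<d. \<Sum>m\<le>k. ?A l m * ?B l (k - m)) = (\<Sum>m\<le>k. \<Sum>l<d. ?A l m * ?B l (k - m))"
      by (rule sum.swap)
    also have "\<dots> = (\<Sum>m\<le>k. (a gchoose m) * (b gchoose (k - m)) * ((-1) ^ k * mpower d M k i j))"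
    proof (intro sum.cong refl)
      fix m assume "m \<in> {..k}"
      then have k: "m + (k - m) = k" by simp
      have "(\<Sum>l<d. ?A l m * ?B l (k - m)) = (\<Sum>l<d. ((a gchoose m) * (b gchoose (k - m)) * ((-1) ^ m * (-1) ^ (k - m))) * (mpower d M m i l * mpower d M (k - m) l j))"
        by (intro sum.cong refl) (simp add: mult_ac)
      also have "\<dots> = (a gchoose m) * (b gchoose (k - m)) * ((-1) ^ m * (-1) ^ (k - m)) * mpower d M k i j"
        by (simp add: sum_distrib_left[symmetric] mpower_add[OF ij(1), symmetric] k)
      finally show "(\<Sum>l<d. ?A l m * ?B l (k - m)) = (a gchoose m) * (b gchoose (k - m)) * ((-1) ^ k * mpower d M k i j)"
        by (simp add: power_add[symmetric] k)
    qed
    also have "\<dots> = ((a + b) gchoose k) * ((-1) ^ k * mpower d M k i j)"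
      by (simp only: sum_distrib_right[symmetric] atMost_atLeast0 gbinomial_Vandermonde)
    finally show "(\<Sum>l<d. \<Sum>m\<le>k. ?A l m * ?B l (k - m)) = ((a + b) gchoose k) * (-1) ^ k * mpower d M k i j"
      by simp
  qed
  finally show ?thesis unfolding matrix_binomial_def by (simp add: sums_iff)
qed

lemma matrix_binomial_1:
  assumes ij: "i < d" "j < d"
  shows "matrix_binomial d M 1 i j = (if i = j then 1 else 0) - M i j"
proof -
  have g: "(1 gchoose k :: real) = 0" if "k \<ge> 2" for k
    using that binomial_gbinomial[of 1 k, where 'a=real] by (simp add: binomial_eq_0 del: One_nat_def)
  have "matrix_binomial d M 1 i j = (\<Sum>k\<in>{0,1}. (1 gchoose k) * (-1) ^ k * mpower d M k i j)"
    unfolding matrix_binomial_def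
  proof (rule suminf_finite)
    fix k :: nat assume "k \<notin> {0,1}"
    then have "k \<ge> 2" by auto
    then show "(1 gchoose k) * (-1) ^ k * mpower d M k i j = 0" by (simp add: g)
  qed simp
  also have "\<dots> = (if i = j then 1 else 0) - M i j"
    using ij by (simp add: if_distrib[of "\<lambda>x. _ * x"] sum.delta cong: if_cong)
  finally show ?thesis .
qed

lemma matrix_binomial_sym: "i < d \<Longrightarrow> j < d \<Longrightarrow> matrix_binomial d M a i j = matrix_binomial d M a j i"
  unfolding matrix_binomial_def using mpower_sym[OF sym] by simp

end

lemma mat_vec_cong: "(\<And>i j. i < d \<Longrightarrow> j < d \<Longrightarrow> A i j = B i j) \<Longrightarrow> i < d \<Longrightarrow> mat_vec d A v i = mat_vec d B v i"
  by (simp add: mat_vec_def)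

lemma mat_vec_mat_vec: "mat_vec d A (mat_vec d B v) = mat_vec d (\<lambda>i j. \<Sum>l<d. A i l * B l j) v"
proof
  fix i
  have "mat_vec d A (mat_vec d B v) i = (\<Sum>l<d. \<Sum>j<d. A i l * B l j * v j)"
    by (simp add: mat_vec_def sum_distrib_left mult.assoc)
  also have "\<dots> = (\<Sum>j<d. \<Sum>l<d. A i l * B l j * v j)" by (rule sum.swap)
  finally show "mat_vec d A (mat_vec d B v) i = mat_vec d (\<lambda>i j. \<Sum>l<d. A i l * B l j) v i"
    by (simp add: mat_vec_def sum_distrib_right)
qed

lemma qform_le:
  "qform d B v v \<le> (\<Sum>i<d. \<Sum>j<d. \<bar>B i j\<bar>) * dot d v v"
proof -
  have vi: "\<bar>v i\<bar> \<le> sqrt (dot d v v)" if "i < d" for i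
    using member_le_sum[of i "{..<d}" "\<lambda>i. v i * v i"] that
    by (intro real_le_rsqrt) (simp add: power2_eq_square)
  have nn: "0 \<le> dot d v v" by (intro sum_nonneg) auto
  have "qform d B v v \<le> (\<Sum>i<d. \<Sum>j<d. \<bar>B i j\<bar> * dot d v v)"
    unfolding qform_def
  proof (intro sum_mono)
    fix i j assume "i \<in> {..<d}" "j \<in> {..<d}"
    then have "\<bar>v i\<bar> * \<bar>v j\<bar> \<le> sqrt (dot d v v) * sqrt (dot d v v)"
      by (intro mult_mono vi) (auto simp: nn)
    also have "\<dots> = dot d v v" using nn by simp
    finally have "\<bar>B i j\<bar> * (\<bar>v i\<bar> * \<bar>v j\<bar>) \<le> \<bar>B i j\<bar> * dot d v v"
      by (rule mult_left_mono) simp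
    moreover have "v i * B i j * v j \<le> \<bar>v i * B i j * v j\<bar>" by simp
    ultimately show "v i * B i j * v j \<le> \<bar>B i j\<bar> * dot d v v"
      by (simp add: abs_mult mult_ac)
  qed
  then show ?thesis by (simp add: sum_distrib_right)
qed

text \<open>
  With \<open>c\<close> large enough, \<open>M = 1 - B / c\<close> is a strict contraction and \<open>c\<^sup>1\<^sup>/\<^sup>2 (1 - M)\<^sup>1\<^sup>/\<^sup>2\<close> is a square root of
  \<open>B\<close>. It is positive because it is itself, up to the factor, the square of the symmetric matrix
  \<open>(1 - M)\<^sup>1\<^sup>/\<^sup>4\<close>, and definite because its own square is.
\<close>

lemma psd_sqrt_exists:
  assumes sym: "\<And>i j. i < d \<Longrightarrow> j < d \<Longrightarrow> B i j = B j i"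
    and low: "\<And>v. \<alpha> * dot d v v \<le> qform d B v v" and \<alpha>: "0 < \<alpha>"
  shows "\<exists>R. (\<forall>i<d. \<forall>j<d. R i j = R j i) \<and> (\<forall>v. (\<exists>i<d. v i \<noteq> 0) \<longrightarrow> 0 < qform d R v v) \<and>
    (\<forall>i<d. \<forall>j<d. (\<Sum>l<d. R i l * R l j) = B i j)"
proof -
  (* The summand 1 keeps the contraction constant 1 - alpha / c positive. *)
  define c where "c = \<alpha> + 1 + (\<Sum>i<d. \<Sum>j<d. \<bar>B i j\<bar>)"
  have S0: "0 \<le> (\<Sum>i<d. \<Sum>j<d. \<bar>B i j\<bar>)" by (intro sum_nonneg) auto
  then have c: "0 < c" "\<alpha> < c" using \<alpha> by (auto simp: c_def)
  define M where "M = (\<lambda>i j. (if i = j then 1 else 0) - B i j / c)"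
  have qM: "qform d M v v = dot d v v - qform d B v v / c" for v
  proof -
    have "qform d M v v = (\<Sum>i<d. (\<Sum>j<d. (if i = j then v i * v j else 0)) - (\<Sum>j<d. v i * B i j * v j / c))"
      unfolding qform_def M_def sum_subtractf[symmetric]
      by (intro sum.cong refl) (auto simp: algebra_simps)
    also have "\<dots> = dot d v v - qform d B v v / c"
      by (simp add: sum.delta sum_subtractf qform_def sum_divide_distrib)
    finally show ?thesis .
  qed
  have dnn: "0 \<le> dot d v v" for v :: "nat \<Rightarrow> real" by (intro sum_nonneg) auto
  interpret psd_contraction_matrix d M "1 - \<alpha> / c"
  proof
    show "M i j = M j i" if "i < d" "j < d" for i j using that by (simp add: M_def sym)
    show "0 \<le> qform d M v v" for v
    proof -
      have "qform d B v v \<le> c * dot d v v"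
        using qform_le[of d B v] dnn[of v] mult_nonneg_nonneg[OF less_imp_le[OF \<alpha>] dnn[of v]]
        by (simp only: c_def distrib_right)
      then show ?thesis using c by (simp add: qM field_simps)
    qed
    show "qform d M v v \<le> (1 - \<alpha> / c) * dot d v v" for v
    proof -
      have "\<alpha> * dot d v v / c \<le> qform d B v v / c"
        using low[of v] c by (intro divide_right_mono) auto
      then show ?thesis by (simp add: qM algebra_simps)
    qed
    show "0 < 1 - \<alpha> / c" "1 - \<alpha> / c < 1" using c \<alpha> by auto
  qed
  define S where "S = matrix_binomial d M (1/2)"
  define Q where "Q = matrix_binomial d M (1/4)"
  have SS: "(\<Sum>l<d. S i l * S l j) = B i j / c" if "i < d" "j < d" for i j
    using matrix_binomial_mult[OF that, of "1/2" "1/2"] matrix_binomial_1[OF that] unfolding S_def by (simp add: M_def)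
  have QQ: "(\<Sum>l<d. Q i l * Q l j) = S i j" if "i < d" "j < d" for i j
    using matrix_binomial_mult[OF that, of "1/4" "1/4"] unfolding S_def Q_def by simp
  have qQ: "qform d S v v = dot d (mat_vec d Q v) (mat_vec d Q v)" for v
  proof -
    have "qform d S v v = dot d v (mat_vec d Q (mat_vec d Q v))"
      unfolding qform_mat_vec mat_vec_mat_vec by (intro sum.cong refl arg_cong2[where f="(*)"] mat_vec_cong) (auto simp: QQ)
    also have "\<dots> = qform d Q v (mat_vec d Q v)" by (simp add: qform_mat_vec)
    also have "\<dots> = qform d Q (mat_vec d Q v) v" by (rule qform_sym) (simp add: Q_def matrix_binomial_sym)
    finally show ?thesis by (simp add: qform_mat_vec)
  qed
  have posS: "0 < qform d S v v" if "\<exists>i<d. v i \<noteq> 0" for v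
  proof (rule ccontr)
    assume "\<not> 0 < qform d S v v"
    then have "dot d (mat_vec d Q v) (mat_vec d Q v) = 0" using dnn[of "mat_vec d Q v"] qQ[of v] by linarith
    then have z: "mat_vec d Q v i = 0" if "i < d" for i using that
      by (subst (asm) sum_nonneg_eq_0_iff) auto
    have "mat_vec d S v i = 0" if "i < d" for i
    proof -
      have "mat_vec d S v i = mat_vec d Q (mat_vec d Q v) i"
        unfolding mat_vec_mat_vec using that by (intro mat_vec_cong) (auto simp: QQ)
      also have "\<dots> = 0" using z unfolding mat_vec_def[of d Q "mat_vec d Q v"] by simp
      finally show ?thesis .
    qed
    then have z2: "mat_vec d S (mat_vec d S v) i = 0" if "i < d" for i unfolding mat_vec_def[of d S "mat_vec d S v"] by simp
    have "mat_vec d (\<lambda>i j. B i j / c) v i = 0" if "i < d" for i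
      using z2[OF that] mat_vec_cong[of d "\<lambda>i j. \<Sum>l<d. S i l * S l j" "\<lambda>i j. B i j / c" i v] SS that
      by (simp add: mat_vec_mat_vec)
    then have "qform d (\<lambda>i j. B i j / c) v v = 0" by (simp add: qform_mat_vec)
    moreover have "qform d (\<lambda>i j. B i j / c) v v = qform d B v v / c"
      by (simp add: qform_def sum_divide_distrib)
    ultimately have "qform d B v v = 0" using c by simp
    then have "dot d v v \<le> 0" using low[of v] \<alpha> by (simp add: mult_le_0_iff)
    then have "dot d v v = 0" using dnn[of v] by linarith
    then show False using that by (subst (asm) sum_nonneg_eq_0_iff) auto
  qed
  show ?thesis
  proof (intro exI[of _ "\<lambda>i j. sqrt c * S i j"] conjI allI impI)
    fix i j assume ij: "i < d" "j < d"
    show "sqrt c * S i j = sqrt c * S j i" using ij by (simp add: S_def matrix_binomial_sym)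
    have "(\<Sum>l<d. sqrt c * S i l * (sqrt c * S l j)) = c * (\<Sum>l<d. S i l * S l j)"
      unfolding sum_distrib_left
    proof (rule sum.cong[OF refl])
      fix l
      have "sqrt c * S i l * (sqrt c * S l j) = (sqrt c * sqrt c) * (S i l * S l j)" by (simp only: mult_ac)
      then show "sqrt c * S i l * (sqrt c * S l j) = c * (S i l * S l j)" using c by simp
    qed
    then show "(\<Sum>l<d. sqrt c * S i l * (sqrt c * S l j)) = B i j" using SS[OF ij] c by simp
  next
    fix v assume "\<exists>i<d. v i \<noteq> (0::real)"
    then have "0 < sqrt c * qform d S v v" using posS c by simp
    also have "sqrt c * qform d S v v = qform d (\<lambda>i j. sqrt c * S i j) v v"
      by (simp add: qform_def sum_distrib_left mult_ac)
    finally show "0 < qform d (\<lambda>i j. sqrt c * S i j) v v" .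
  qed
qed

text \<open>
  If \<open>R\<^sup>2 = S\<^sup>2\<close> then \<open>D = R - S\<close> satisfies \<open>R D + D S = 0\<close>. The trace of \<open>D (R D + D S)\<close> is a sum of
  values of the two positive forms at the columns of \<open>D\<close>, so each column vanishes.
\<close>

lemma psd_sqrt_unique:
  assumes R: "\<And>i j. i < d \<Longrightarrow> j < d \<Longrightarrow> R i j = R j i" "\<And>v. (\<exists>i<d. v i \<noteq> 0) \<Longrightarrow> 0 < qform d R v v"
    and S: "\<And>i j. i < d \<Longrightarrow> j < d \<Longrightarrow> S i j = S j i" "\<And>v. (\<exists>i<d. v i \<noteq> 0) \<Longrightarrow> 0 < qform d S v v"
    and eq: "\<And>i j. i < d \<Longrightarrow> j < d \<Longrightarrow> (\<Sum>l<d. R i l * R l j) = (\<Sum>l<d. S i l * S l j)"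
    and ij: "i < d" "j < d"
  shows "R i j = S i j"
proof (rule ccontr)
  assume ne: "R i j \<noteq> S i j"
  define D where "D = (\<lambda>i j. R i j - S i j)"
  have nn: "0 \<le> qform d A v v" if "\<And>v. (\<exists>i<d. v i \<noteq> 0) \<Longrightarrow> 0 < qform d A v v" for A v
    by (cases "\<exists>i<d. v i \<noteq> 0") (use that[of v] in \<open>auto simp: qform_def\<close>)
  have z: "(\<Sum>l<d. R a l * D l b) + (\<Sum>l<d. D a l * S l b) = 0" if "a < d" "b < d" for a b
    using eq[OF that] by (simp add: D_def algebra_simps sum_subtractf)
  have "0 = (\<Sum>a<d. \<Sum>b<d. D b a * ((\<Sum>l<d. R a l * D l b) + (\<Sum>l<d. D a l * S l b)))"
    by (simp add: z)
  also have "\<dots> = (\<Sum>a<d. \<Sum>b<d. \<Sum>l<d. D b a * (R a l * D l b)) + (\<Sum>a<d. \<Sum>b<d. \<Sum>l<d. D b a * (D a l * S l b))"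
    by (simp add: distrib_left sum.distrib sum_distrib_left)
  also have "(\<Sum>a<d. \<Sum>b<d. \<Sum>l<d. D b a * (R a l * D l b)) = (\<Sum>b<d. qform d R (\<lambda>i. D i b) (\<lambda>i. D i b))"
    unfolding qform_def by (subst sum.swap, intro sum.cong refl) (auto simp: D_def R(1) S(1))
  also have "(\<Sum>a<d. \<Sum>b<d. \<Sum>l<d. D b a * (D a l * S l b)) = (\<Sum>a<d. qform d S (\<lambda>i. D i a) (\<lambda>i. D i a))"
    unfolding qform_def by (intro sum.cong refl) (auto simp: D_def R(1) S(1))
  finally have 0: "(\<Sum>b<d. qform d R (\<lambda>i. D i b) (\<lambda>i. D i b)) + (\<Sum>a<d. qform d S (\<lambda>i. D i a) (\<lambda>i. D i a)) = 0" by simp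
  have "0 < qform d R (\<lambda>i. D i j) (\<lambda>i. D i j)"
    using ne ij by (intro R(2)) (auto simp: D_def)
  also have "\<dots> \<le> (\<Sum>b<d. qform d R (\<lambda>i. D i b) (\<lambda>i. D i b))"
    using ij by (intro member_le_sum nn R(2)) auto
  finally have "0 < (\<Sum>b<d. qform d R (\<lambda>i. D i b) (\<lambda>i. D i b))" .
  moreover have "0 \<le> (\<Sum>a<d. qform d S (\<lambda>i. D i a) (\<lambda>i. D i a))" by (intro sum_nonneg nn S(2))
  ultimately show False using 0 by linarith
qed

section \<open>The inverse square root of a Hessian\<close>

lemma scalar_prod_mat_qform:
  assumes "A \<in> carrier_mat d d"
  shows "scalar_prod (vec d v) (A *\<^sub>v vec d v) = qform d (\<lambda>i j. A $$ (i, j)) v v"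
  using assms by (simp add: scalar_prod_def qform_def lessThan_atLeast0 sum_distrib_left mult.assoc)

lemma pos_def_mat_iff:
  "pos_def_mat d A \<longleftrightarrow> A \<in> carrier_mat d d \<and> (\<forall>i<d. \<forall>j<d. A $$ (i, j) = A $$ (j, i)) \<and>
     (\<forall>v. (\<exists>i<d. v i \<noteq> 0) \<longrightarrow> 0 < qform d (\<lambda>i j. A $$ (i, j)) v v)" (is "_ \<longleftrightarrow> ?r")
proof
  assume p: "pos_def_mat d A"
  then have c: "A \<in> carrier_mat d d" by (simp add: pos_def_mat_def)
  have "0 < qform d (\<lambda>i j. A $$ (i, j)) v v" if "\<exists>i<d. v i \<noteq> 0" for v
  proof -
    have "vec d v \<noteq> 0\<^sub>v d" using that by (metis index_vec index_zero_vec(1))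
    then show ?thesis using p scalar_prod_mat_qform[OF c, of v] by (auto simp: pos_def_mat_def)
  qed
  moreover have "A $$ (i, j) = A $$ (j, i)" if "i < d" "j < d" for i j
    using p that by (metis c carrier_matD index_transpose_mat(1) pos_def_mat_def)
  ultimately show ?r using c by auto
next
  assume r: ?r
  then have c: "A \<in> carrier_mat d d" by simp
  have "transpose_mat A = A" using r by (intro eq_matI) auto
  moreover have "0 < scalar_prod v (A *\<^sub>v v)" if "v \<in> carrier_vec d" "v \<noteq> 0\<^sub>v d" for v
  proof -
    have v: "v = vec d (\<lambda>i. v $ i)" using that by auto
    have "\<exists>i<d. v $ i \<noteq> 0" using that by (metis carrier_vecD eq_vecI index_zero_vec)
    then have "0 < qform d (\<lambda>i j. A $$ (i, j)) (\<lambda>i. v $ i) (\<lambda>i. v $ i)" using r by simp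
    then show ?thesis using scalar_prod_mat_qform[OF c, of "\<lambda>i. v $ i"] v by simp
  qed
  ultimately show "pos_def_mat d A" using c by (simp add: pos_def_mat_def)
qed

lemma mat_mult_index:
  assumes "A \<in> carrier_mat d d" "B \<in> carrier_mat d d" "i < d" "j < d"
  shows "(A * B) $$ (i, j) = (\<Sum>l<d. A $$ (i, l) * B $$ (l, j))"
  using assms by (simp add: scalar_prod_def lessThan_atLeast0)

lemma pos_def_mat_inv:
  assumes "pos_def_mat d A"
  shows "A * mat_inv A = 1\<^sub>m d" "mat_inv A * A = 1\<^sub>m d" "mat_inv A \<in> carrier_mat d d"
proof -
  have c: "A \<in> carrier_mat d d" using assms by (simp add: pos_def_mat_def)
  have "Determinant.det A \<noteq> 0"
  proof
    assume "Determinant.det A = 0"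
    then obtain v where v: "v \<in> carrier_vec d" "v \<noteq> 0\<^sub>v d" "A *\<^sub>v v = 0\<^sub>v d"
      using det_0_iff_vec_prod_zero[OF c] by auto
    then have "0 < scalar_prod v (A *\<^sub>v v)" using assms unfolding pos_def_mat_def by blast
    then show False using v by simp
  qed
  then have "A \<in> Units (ring_mat TYPE(real) d ())" by (rule det_non_zero_imp_unit[OF c])
  then have "mat_inverse A \<noteq> None" using mat_inverse(1)[OF c, where b="()"] by blast
  then obtain B where "mat_inverse A = Some B" by auto
  with mat_inverse(2)[OF c this]
  show "A * mat_inv A = 1\<^sub>m d" "mat_inv A * A = 1\<^sub>m d" "mat_inv A \<in> carrier_mat d d" by auto
qed

text \<open>
  The lower bound is quantitative and needs no compactness: expand the form of the inverse at
  \<open>v - A v / h\<close>, where \<open>h\<close> bounds the form of \<open>A\<close>.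
\<close>

lemma pos_def_mat_mat_inv:
  assumes A: "pos_def_mat d A"
  defines "B \<equiv> mat_inv A"
  shows "\<exists>\<alpha>>0. (\<forall>v. \<alpha> * dot d v v \<le> qform d (\<lambda>i j. B $$ (i, j)) v v)"
    and "i < d \<Longrightarrow> j < d \<Longrightarrow> B $$ (i, j) = B $$ (j, i)"
proof -
  let ?a = "\<lambda>i j. A $$ (i, j)" let ?b = "\<lambda>i j. B $$ (i, j)"
  have c: "A \<in> carrier_mat d d" using A by (simp add: pos_def_mat_def)
  have cB: "B \<in> carrier_mat d d" using pos_def_mat_inv[OF A] by (simp add: B_def)
  have AB: "A * B = 1\<^sub>m d" "B * A = 1\<^sub>m d" using pos_def_mat_inv[OF A] by (auto simp: B_def)
  have tA: "transpose_mat A = A" using A by (simp add: pos_def_mat_def)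
  have "transpose_mat B * A = 1\<^sub>m d"
    using transpose_mult[OF c cB] AB tA by simp
  then have "transpose_mat B * (A * B) = B"
    using cB c assoc_mult_mat[of "transpose_mat B" d d A d B d] by simp
  then have tB: "transpose_mat B = B" using AB cB by simp
  show sym: "B $$ (i, j) = B $$ (j, i)" if "i < d" "j < d" for i j
    using tB that cB by (metis carrier_matD index_transpose_mat(1))
  have mAB: "mat_vec d ?b (mat_vec d ?a v) i = v i" "mat_vec d ?a (mat_vec d ?b v) i = v i" if "i < d" for v i
  proof -
    have "mat_vec d ?b (mat_vec d ?a v) i = mat_vec d (\<lambda>i j. 1\<^sub>m d $$ (i, j)) v i"
      unfolding mat_vec_mat_vec using that
      by (intro mat_vec_cong) (auto simp: mat_mult_index[OF cB c, symmetric] AB)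
    also have "\<dots> = v i" using that
      by (simp add: mat_vec_def if_distrib[of "\<lambda>x. x * _"] sum.delta cong: if_cong)
    finally show "mat_vec d ?b (mat_vec d ?a v) i = v i" .
    have "mat_vec d ?a (mat_vec d ?b v) i = mat_vec d (\<lambda>i j. 1\<^sub>m d $$ (i, j)) v i"
      unfolding mat_vec_mat_vec using that
      by (intro mat_vec_cong) (auto simp: mat_mult_index[OF c cB, symmetric] AB)
    also have "\<dots> = v i" using that
      by (simp add: mat_vec_def if_distrib[of "\<lambda>x. x * _"] sum.delta cong: if_cong)
    finally show "mat_vec d ?a (mat_vec d ?b v) i = v i" .
  qed
  have nnA: "0 \<le> qform d ?a v v" for v
    by (cases "\<exists>i<d. v i \<noteq> 0") (use A in \<open>auto simp: qform_def pos_def_mat_iff intro: less_imp_le\<close>)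
  have nnB: "0 \<le> qform d ?b v v" for v
  proof -
    have "qform d ?b v v = dot d v (mat_vec d ?b v)" by (simp add: qform_mat_vec)
    also have "\<dots> = dot d (mat_vec d ?a (mat_vec d ?b v)) (mat_vec d ?b v)" using mAB by simp
    also have "\<dots> = qform d ?a (mat_vec d ?b v) (mat_vec d ?b v)" by (simp add: qform_mat_vec mult.commute)
    finally show ?thesis using nnA by simp
  qed
  define h where "h = 1 + (\<Sum>i<d. \<Sum>j<d. \<bar>?a i j\<bar>)"
  have S0: "0 \<le> (\<Sum>i<d. \<Sum>j<d. \<bar>?a i j\<bar>)" by (intro sum_nonneg) auto
  then have h: "0 < h" by (simp add: h_def)
  have dnn: "0 \<le> dot d v v" for v :: "nat \<Rightarrow> real" by (intro sum_nonneg) auto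
  have "1 / h * dot d v v \<le> qform d ?b v v" for v
  proof -
    let ?w = "mat_vec d ?a v"
    have e1: "qform d ?b v ?w = dot d v v" using mAB(1) by (simp add: qform_mat_vec)
    have e2: "qform d ?b ?w ?w = qform d ?a v v"
      using mAB(1) by (simp add: qform_mat_vec mult.commute)
    have "qform d ?a v v \<le> h * dot d v v"
      using qform_le[of d ?a v] dnn[of v] unfolding h_def by (simp only: distrib_right)
    then have *: "qform d ?a v v / h\<^sup>2 \<le> h * dot d v v / h\<^sup>2" by (rule divide_right_mono) simp
    have "0 \<le> qform d ?b (\<lambda>i. v i + (- (1/h)) * ?w i) (\<lambda>i. v i + (- (1/h)) * ?w i)" by (rule nnB)
    also have "\<dots> = qform d ?b v v + 2 * (- (1/h)) * dot d v v + (- (1/h))\<^sup>2 * qform d ?a v v"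
      unfolding e1[symmetric] e2[symmetric] by (rule qform_add_scale) (rule sym)
    also have "\<dots> = qform d ?b v v - 2 * (dot d v v / h) + qform d ?a v v / h\<^sup>2"
      by (simp add: power2_eq_square)
    also have "\<dots> \<le> qform d ?b v v - 2 * (dot d v v / h) + h * dot d v v / h\<^sup>2"
      using * by linarith
    also have "h * dot d v v / h\<^sup>2 = dot d v v / h" using h by (simp add: power2_eq_square)
    finally show ?thesis by simp
  qed
  then show "\<exists>\<alpha>>0. (\<forall>v. \<alpha> * dot d v v \<le> qform d ?b v v)" using h by (intro exI[of _ "1/h"]) auto
qed

lemma mat_inv_sqrt_props:
  assumes A: "pos_def_mat d A"
  shows "pos_def_mat d (mat_inv_sqrt d A)" "mat_inv_sqrt d A * mat_inv_sqrt d A = mat_inv A"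
proof -
  let ?B = "mat_inv A"
  obtain \<alpha> where \<alpha>: "0 < \<alpha>" "\<And>v. \<alpha> * dot d v v \<le> qform d (\<lambda>i j. ?B $$ (i, j)) v v"
    using pos_def_mat_mat_inv(1)[OF A] by auto
  have cB: "?B \<in> carrier_mat d d" using pos_def_mat_inv[OF A] by simp
  obtain R where R: "\<forall>i<d. \<forall>j<d. R i j = R j i" "\<forall>v. (\<exists>i<d. v i \<noteq> 0) \<longrightarrow> 0 < qform d R v v"
    "\<forall>i<d. \<forall>j<d. (\<Sum>l<d. R i l * R l j) = ?B $$ (i, j)"
    using psd_sqrt_exists[OF pos_def_mat_mat_inv(2)[OF A] \<alpha>(2,1)] by auto
  let ?R = "Matrix.mat d d (\<lambda>(i, j). R i j)"
  have q: "qform d (\<lambda>i j. ?R $$ (i, j)) v v = qform d R v v" for v by (simp add: qform_def)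
  have 1: "pos_def_mat d ?R" using R unfolding pos_def_mat_iff q by simp
  have 2: "?R * ?R = ?B"
  proof (rule eq_matI)
    fix i j assume "i < dim_row ?B" "j < dim_col ?B"
    then show "(?R * ?R) $$ (i, j) = ?B $$ (i, j)" using cB R(3) 
      by (subst mat_mult_index[of _ d]) auto
  qed (use cB in auto)
  have "mat_inv_sqrt d A = ?R"
    unfolding mat_inv_sqrt_def
  proof (rule the_equality)
    fix S assume S: "pos_def_mat d S \<and> S * S = ?B"
    then have cS: "S \<in> carrier_mat d d" by (simp add: pos_def_mat_def)
    show "S = ?R"
    proof (rule eq_matI)
      fix i j assume ij: "i < dim_row ?R" "j < dim_col ?R"
      have "S $$ (i, j) = R i j"
      proof (rule psd_sqrt_unique[where d=d])
        show "(\<Sum>l<d. S $$ (i, l) * S $$ (l, j)) = (\<Sum>l<d. R i l * R l j)" if "i < d" "j < d" for i j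
          using mat_mult_index[OF cS cS that] S R(3) that by simp
      qed (use S R ij in \<open>auto simp: pos_def_mat_iff\<close>)
      then show "S $$ (i, j) = ?R $$ (i, j)" using ij by simp
    qed (use cS in auto)
  qed (use 1 2 in auto)
  with 1 2 show "pos_def_mat d (mat_inv_sqrt d A)" "mat_inv_sqrt d A * mat_inv_sqrt d A = ?B" by auto
qed

text \<open>
  The three facts about \<open>R = A\<^sup>-\<^sup>1\<^sup>/\<^sup>2\<close> used later: symmetry, \<open>R A R = 1\<close>, which makes the whitened covariance the
  identity, and a bound of its entries by the diagonal of \<open>A\<^sup>-\<^sup>1\<close>, which is uniform in the base point.
\<close>

lemma mat_inv_sqrt_entries:
  fixes d i j :: nat and A :: "real mat" and R :: "nat \<Rightarrow> nat \<Rightarrow> real"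
  assumes A: "pos_def_mat d A" and ij: "i < d" "j < d"
    and R_def: "R = (\<lambda>i j. mat_inv_sqrt d A $$ (i, j))"
  shows "R i j = R j i"
    and "(\<Sum>k<d. \<Sum>l<d. R i k * R j l * A $$ (k, l)) = (if i = j then 1 else 0)"
    and "\<bar>R i j\<bar> \<le> sqrt (mat_inv A $$ (i, i))"
proof -
  let ?R = "mat_inv_sqrt d A" 
  note p = mat_inv_sqrt_props[OF A]
  have cR: "?R \<in> carrier_mat d d" using p(1) by (simp add: pos_def_mat_def)
  have cA: "A \<in> carrier_mat d d" using A by (simp add: pos_def_mat_def)
  have sym: "R i j = R j i" if "i < d" "j < d" for i j using p(1) that by (auto simp: pos_def_mat_iff R_def)
  then show "R i j = R j i" using ij by simp
  have "?R * (?R * A) = 1\<^sub>m d"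
    by (simp only: assoc_mult_mat[OF cR cR cA, symmetric] p(2) pos_def_mat_inv(2)[OF A])
  then have "(?R * A) * ?R = 1\<^sub>m d"
    by (rule mat_mult_left_right_inverse[OF cR mult_carrier_mat[OF cR cA]])
  then have "(if i = j then 1 else 0) = ((?R * A) * ?R) $$ (i, j)" using ij by simp
  also have "\<dots> = (\<Sum>l<d. (\<Sum>k<d. R i k * A $$ (k, l)) * R l j)"
    using cR cA ij mat_mult_index[of "?R * A" d ?R i j] mat_mult_index[OF cR cA]
    by (simp add: R_def del: index_mult_mat)
  also have "\<dots> = (\<Sum>l<d. \<Sum>k<d. R i k * R j l * A $$ (k, l))"
  proof (intro sum.cong refl)
    fix l assume l: "l \<in> {..<d}"
    have "R l j = R j l" using l ij by (intro sym) auto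
    then show "(\<Sum>k<d. R i k * A $$ (k, l)) * R l j = (\<Sum>k<d. R i k * R j l * A $$ (k, l))"
      unfolding sum_distrib_right by (intro sum.cong refl) simp
  qed
  also have "\<dots> = (\<Sum>k<d. \<Sum>l<d. R i k * R j l * A $$ (k, l))" by (rule sum.swap)
  finally show "(\<Sum>k<d. \<Sum>l<d. R i k * R j l * A $$ (k, l)) = (if i = j then 1 else 0)" by simp
  have "(R i j)\<^sup>2 \<le> (\<Sum>l<d. R i l * R l i)"
    using member_le_sum[of j "{..<d}" "\<lambda>l. R i l * R l i"] ij sym by (simp add: power2_eq_square)
  also have "\<dots> = mat_inv A $$ (i, i)"
    using mat_mult_index[OF cR cR ij(1) ij(1)] p(2) by (simp add: R_def)
  finally show "\<bar>R i j\<bar> \<le> sqrt (mat_inv A $$ (i, i))" by (simp add: real_le_rsqrt)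
qed

section \<open>Lebesgue measure and rotations of pairs of vectors\<close>

abbreviation leb :: "nat \<Rightarrow> (nat \<Rightarrow> real) measure" where
  "leb d \<equiv> Pi\<^sub>M {..<d} (\<lambda>_. lborel)"

lemma sets_leb [measurable_cong]: "sets (leb d) = sets (Pi\<^sub>M {..<d} (\<lambda>_. borel))"
  by (intro sets_PiM_cong) auto

lemma space_leb: "space (leb d) = Rd d" by (simp add: space_PiM)

interpretation lb: product_sigma_finite "\<lambda>_::nat. lborel :: real measure"
  by (simp add: product_sigma_finite_def sigma_finite_lborel)

lemma sigma_finite_leb: "sigma_finite_measure (leb d)"
  by (rule lb.sigma_finite) simp

text \<open>
  Lebesgue measure is a product, so translations and the reflection \<open>x \<mapsto> - x\<close> are handled one coordinate at a
  time.
\<close>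

lemma leb_affine:
  assumes "\<bar>\<sigma>\<bar> = (1::real)"
  shows "distr (leb d) (leb d) (\<lambda>x. \<lambda>i\<in>{..<d}. \<sigma> * x i + c i) = leb d" (is "distr _ _ ?T = _")
proof (rule lb.PiM_eqI)
  have m: "?T \<in> leb d \<rightarrow>\<^sub>M leb d" by measurable
  fix A :: "nat \<Rightarrow> real set" assume A: "\<And>i. i \<in> {..<d} \<Longrightarrow> A i \<in> sets lborel"
  have "emeasure (distr (leb d) (leb d) ?T) (Pi\<^sub>E {..<d} A) = emeasure (leb d) (?T -` Pi\<^sub>E {..<d} A \<inter> space (leb d))"
    using A by (intro emeasure_distr m sets_PiM_I_finite) auto
  also have "?T -` Pi\<^sub>E {..<d} A \<inter> space (leb d) = Pi\<^sub>E {..<d} (\<lambda>i. (\<lambda>x. c i + \<sigma> * x) -` A i)"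
    by (auto simp: space_PiM PiE_iff extensional_def add.commute)
  also have "emeasure (leb d) \<dots> = (\<Prod>i<d. emeasure lborel ((\<lambda>x. c i + \<sigma> * x) -` A i))"
  proof (rule lb.emeasure_PiM)
    fix i assume "i \<in> {..<d}"
    then have "A i \<in> sets borel" using A by simp
    then have "(\<lambda>x. c i + \<sigma> * x) -` A i \<inter> space borel \<in> sets borel" by (intro measurable_sets) auto
    then show "(\<lambda>x. c i + \<sigma> * x) -` A i \<in> sets lborel" by simp
  qed simp
  also have "\<dots> = (\<Prod>i<d. emeasure lborel (A i))"
  proof (rule prod.cong[OF refl])
    fix i assume "i \<in> {..<d}"
    then have Ai: "A i \<in> sets borel" using A by simp
    have "lborel = density (distr lborel borel (\<lambda>x. c i + \<sigma> * x)) (\<lambda>_. ennreal \<bar>\<sigma>\<bar>)"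
      using assms by (intro lborel_real_affine) auto
    also have "\<dots> = distr lborel borel (\<lambda>x. c i + \<sigma> * x)" using assms by (simp add: density_1)
    finally have "emeasure lborel (A i) = emeasure (distr lborel borel (\<lambda>x. c i + \<sigma> * x)) (A i)" by simp
    then show "emeasure lborel ((\<lambda>x. c i + \<sigma> * x) -` A i) = emeasure lborel (A i)"
      using Ai by (simp add: emeasure_distr)
  qed
  finally show "emeasure (distr (leb d) (leb d) ?T) (Pi\<^sub>E {..<d} A) = (\<Prod>i<d. emeasure lborel (A i))" .
qed simp_all

lemma nn_integral_leb_affine:
  assumes "\<bar>\<sigma>\<bar> = (1::real)" and [measurable]: "f \<in> borel_measurable (leb d)"
  shows "(\<integral>\<^sup>+x. f (\<lambda>i\<in>{..<d}. \<sigma> * x i + c i) \<partial>leb d) = (\<integral>\<^sup>+x. f x \<partial>leb d)"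
proof -
  have "(\<integral>\<^sup>+x. f x \<partial>leb d) = (\<integral>\<^sup>+x. f x \<partial>distr (leb d) (leb d) (\<lambda>x. \<lambda>i\<in>{..<d}. \<sigma> * x i + c i))"
    by (simp add: leb_affine[OF assms(1)])
  also have "\<dots> = (\<integral>\<^sup>+x. f (\<lambda>i\<in>{..<d}. \<sigma> * x i + c i) \<partial>leb d)"
    by (rule nn_integral_distr) measurable
  finally show ?thesis ..
qed

definition rot :: "nat \<Rightarrow> real \<Rightarrow> (nat \<Rightarrow> real) \<Rightarrow> (nat \<Rightarrow> real) \<Rightarrow> nat \<Rightarrow> real" where
  "rot d \<theta> x y = (\<lambda>i\<in>{..<d}. cos \<theta> * x i + sin \<theta> * y i)"

definition shear :: "nat \<Rightarrow> real \<Rightarrow> (nat \<Rightarrow> real) \<Rightarrow> (nat \<Rightarrow> real) \<Rightarrow> nat \<Rightarrow> real" where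
  "shear d a x y = (\<lambda>i\<in>{..<d}. x i + a * y i)"

lemma measurable_shear [measurable]:
  "(\<lambda>(x, y). shear d a x y) \<in> leb d \<Otimes>\<^sub>M leb d \<rightarrow>\<^sub>M leb d"
  "(\<lambda>(x, y). shear d a y x) \<in> leb d \<Otimes>\<^sub>M leb d \<rightarrow>\<^sub>M leb d"
  unfolding shear_def by (simp_all add: split_beta')

lemma measurable_rot [measurable]:
  "(\<lambda>(x, y). rot d a x y) \<in> leb d \<Otimes>\<^sub>M leb d \<rightarrow>\<^sub>M leb d"
  unfolding rot_def by (simp add: split_beta')

lemma nn_integral_shear:
  assumes f[measurable]: "f \<in> borel_measurable (leb d \<Otimes>\<^sub>M leb d)"
  shows "(\<integral>\<^sup>+(x, y). f (shear d a x y, y) \<partial>(leb d \<Otimes>\<^sub>M leb d)) = (\<integral>\<^sup>+z. f z \<partial>(leb d \<Otimes>\<^sub>M leb d))"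
    and "(\<integral>\<^sup>+(x, y). f (x, shear d a y x) \<partial>(leb d \<Otimes>\<^sub>M leb d)) = (\<integral>\<^sup>+z. f z \<partial>(leb d \<Otimes>\<^sub>M leb d))"
proof -
  interpret sigma_finite_measure "leb d" by (rule sigma_finite_leb)
  interpret pair_sigma_finite "leb d" "leb d" ..
  have "(\<integral>\<^sup>+z. f (shear d a (fst z) (snd z), snd z) \<partial>(leb d \<Otimes>\<^sub>M leb d))
      = (\<integral>\<^sup>+y. \<integral>\<^sup>+x. f (shear d a x y, y) \<partial>leb d \<partial>leb d)"
    by (subst nn_integral_snd[symmetric]) simp_all
  also have "\<dots> = (\<integral>\<^sup>+y. \<integral>\<^sup>+x. f (x, y) \<partial>leb d \<partial>leb d)"
  proof (rule nn_integral_cong)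
    fix y assume y[measurable]: "y \<in> space (leb d)"
    have [measurable]: "(\<lambda>x. f (x, y)) \<in> borel_measurable (leb d)" by measurable
    show "(\<integral>\<^sup>+x. f (shear d a x y, y) \<partial>leb d) = (\<integral>\<^sup>+x. f (x, y) \<partial>leb d)"
      using nn_integral_leb_affine[of 1 "\<lambda>x. f (x, y)" d "\<lambda>i. a * y i"] by (simp add: shear_def)
  qed
  also have "\<dots> = (\<integral>\<^sup>+z. f z \<partial>(leb d \<Otimes>\<^sub>M leb d))" by (rule nn_integral_snd) measurable
  finally show "(\<integral>\<^sup>+(x, y). f (shear d a x y, y) \<partial>(leb d \<Otimes>\<^sub>M leb d)) = (\<integral>\<^sup>+z. f z \<partial>(leb d \<Otimes>\<^sub>M leb d))"
    by (simp add: split_beta')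
  have "(\<integral>\<^sup>+z. f (fst z, shear d a (snd z) (fst z)) \<partial>(leb d \<Otimes>\<^sub>M leb d))
      = (\<integral>\<^sup>+x. \<integral>\<^sup>+y. f (x, shear d a y x) \<partial>leb d \<partial>leb d)"
    by (subst sigma_finite_measure.nn_integral_fst[OF sigma_finite_leb, symmetric]) simp_all
  also have "\<dots> = (\<integral>\<^sup>+x. \<integral>\<^sup>+y. f (x, y) \<partial>leb d \<partial>leb d)"
  proof (rule nn_integral_cong)
    fix x assume x[measurable]: "x \<in> space (leb d)"
    have [measurable]: "(\<lambda>y. f (x, y)) \<in> borel_measurable (leb d)" by measurable
    show "(\<integral>\<^sup>+y. f (x, shear d a y x) \<partial>leb d) = (\<integral>\<^sup>+y. f (x, y) \<partial>leb d)"
      using nn_integral_leb_affine[of 1 "\<lambda>y. f (x, y)" d "\<lambda>i. a * x i"] by (simp add: shear_def)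
  qed
  also have "\<dots> = (\<integral>\<^sup>+z. f z \<partial>(leb d \<Otimes>\<^sub>M leb d))" by (rule sigma_finite_measure.nn_integral_fst[OF sigma_finite_leb]) measurable
  finally show "(\<integral>\<^sup>+(x, y). f (x, shear d a y x) \<partial>(leb d \<Otimes>\<^sub>M leb d)) = (\<integral>\<^sup>+z. f z \<partial>(leb d \<Otimes>\<^sub>M leb d))"
    by (simp add: split_beta')
qed

text \<open>
  A plane rotation is a product of three shears with coefficients \<open>(1 - cos \<theta>) / sin \<theta>\<close>, \<open>- sin \<theta>\<close> and
  again \<open>(1 - cos \<theta>) / sin \<theta>\<close>. Each shear translates one vector by a multiple of the other and so preserves
  Lebesgue measure by Fubini's theorem; this gives the invariance in lemma \<open>nn_integral_rot\<close>.
\<close>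

lemma rot_shears:
  fixes d :: nat and x y :: "nat \<Rightarrow> real"
  assumes "sin \<theta> \<noteq> 0"
  defines "a \<equiv> (1 - cos \<theta>) / sin \<theta>" and "b \<equiv> - sin \<theta>"
  defines "y' \<equiv> shear d b y (shear d a x y)"
  shows "shear d a (shear d a x y) y' = rot d \<theta> x y" and "y' = rot d (\<theta> + pi / 2) x y"
proof -
  have ab: "a * b = cos \<theta> - 1" using assms by (simp add: a_def b_def)
  have "a * (1 + cos \<theta>) = (1 - (cos \<theta>)\<^sup>2) / sin \<theta>" by (simp add: a_def power2_eq_square algebra_simps)
  also have "1 - (cos \<theta>)\<^sup>2 = (sin \<theta>)\<^sup>2" by (simp add: sin_squared_eq)
  finally have a2: "a * (1 + cos \<theta>) = sin \<theta>" using assms by (simp add: power2_eq_square)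
  have e1: "x i + a * y i + a * (y i + b * (x i + a * y i)) = cos \<theta> * x i + sin \<theta> * y i" for i
  proof -
    have "x i + a * y i + a * (y i + b * (x i + a * y i)) = (1 + a * b) * x i + a * (2 + a * b) * y i"
      by (simp add: algebra_simps)
    also have "\<dots> = cos \<theta> * x i + a * (1 + cos \<theta>) * y i" unfolding ab by (simp add: algebra_simps)
    finally show ?thesis by (simp add: a2)
  qed
  have e2: "y i + b * (x i + a * y i) = cos (\<theta> + pi / 2) * x i + sin (\<theta> + pi / 2) * y i" for i
  proof -
    have "y i + b * (x i + a * y i) = b * x i + (1 + a * b) * y i" by (simp add: algebra_simps)
    then show ?thesis unfolding ab by (simp add: b_def cos_add sin_add)
  qed
  show "shear d a (shear d a x y) y' = rot d \<theta> x y"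
    unfolding y'_def by (auto simp: fun_eq_iff shear_def rot_def e1[symmetric])
  show "y' = rot d (\<theta> + pi / 2) x y"
    unfolding y'_def by (auto simp: fun_eq_iff shear_def rot_def e2[symmetric])
qed

lemma nn_integral_rot:
  assumes [measurable]: "f \<in> borel_measurable (leb d \<Otimes>\<^sub>M leb d)" and "sin \<theta> \<noteq> 0"
  shows "(\<integral>\<^sup>+(x, y). f (rot d \<theta> x y, rot d (\<theta> + pi/2) x y) \<partial>(leb d \<Otimes>\<^sub>M leb d)) = (\<integral>\<^sup>+z. f z \<partial>(leb d \<Otimes>\<^sub>M leb d))"
proof -
  define a where "a = (1 - cos \<theta>) / sin \<theta>"
  define b where "b = - sin \<theta>"
  define g where "g = (\<lambda>(x, y). f (shear d a x y, y))"
  define h where "h = (\<lambda>(x, y). g (x, shear d b y x))"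
  have g[measurable]: "g \<in> borel_measurable (leb d \<Otimes>\<^sub>M leb d)" unfolding g_def by measurable
  have h[measurable]: "h \<in> borel_measurable (leb d \<Otimes>\<^sub>M leb d)" unfolding h_def by measurable
  have "(\<integral>\<^sup>+z. f z \<partial>(leb d \<Otimes>\<^sub>M leb d)) = (\<integral>\<^sup>+z. g z \<partial>(leb d \<Otimes>\<^sub>M leb d))"
    using nn_integral_shear(1)[of f d a] by (simp add: g_def)
  also have "\<dots> = (\<integral>\<^sup>+z. h z \<partial>(leb d \<Otimes>\<^sub>M leb d))"
    using nn_integral_shear(2)[of g d b] by (simp add: h_def)
  also have "\<dots> = (\<integral>\<^sup>+(x, y). h (shear d a x y, y) \<partial>(leb d \<Otimes>\<^sub>M leb d))"
    using nn_integral_shear(1)[of h d a] by simp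
  also have "(\<lambda>(x, y). h (shear d a x y, y)) = (\<lambda>(x, y). f (rot d \<theta> x y, rot d (\<theta> + pi/2) x y))"
  proof -
    have "h (shear d a x y, y) = f (rot d \<theta> x y, rot d (\<theta> + pi/2) x y)" for x y
      using rot_shears[OF assms(2), where d=d and x=x and y=y] by (simp add: h_def g_def a_def b_def)
    then show ?thesis by auto
  qed
  finally show ?thesis ..
qed

section \<open>Gaussian integrals and tails\<close>

definition gdens :: "nat \<Rightarrow> real \<Rightarrow> (nat \<Rightarrow> real) \<Rightarrow> real" where
  "gdens d n x = sqrt (n / (2 * pi)) ^ d * exp (- (n / 2 * dot d x x))"

text \<open>
  The centred Gaussian law with covariance \<open>1 / n\<close> times the identity.
\<close>

definition gauss :: "nat \<Rightarrow> real \<Rightarrow> (nat \<Rightarrow> real) measure" where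
  "gauss d n = density (leb d) (\<lambda>x. ennreal (gdens d n x))"

lemma gdens_nonneg [simp]: "0 \<le> gdens d n x" if "0 < n" using that by (simp add: gdens_def)

lemma gdens_measurable [measurable]: "gdens d n \<in> borel_measurable (leb d)"
  unfolding gdens_def by measurable

lemma sets_gauss [measurable_cong, simp]: "sets (gauss d n) = sets (leb d)" by (simp add: gauss_def)

lemma space_gauss [simp]: "space (gauss d n) = Rd d" by (simp add: gauss_def space_leb)

lemma gdens_eq_prod:
  assumes "0 < n"
  shows "gdens d n x = (\<Prod>i<d. normal_density 0 (1 / sqrt n) (x i))"
proof -
  have "(\<Prod>i<d. normal_density 0 (1 / sqrt n) (x i)) = (\<Prod>i<d. sqrt (n / (2 * pi)) * exp (- (n / 2 * (x i * x i))))"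
    using assms by (intro prod.cong refl) (simp add: normal_density_def field_simps real_sqrt_divide real_sqrt_mult power2_eq_square)
  then show ?thesis
    by (simp add: prod.distrib exp_sum[symmetric] gdens_def sum_negf sum_distrib_left)
qed

lemma nn_integral_gauss_prod:
  assumes n: "0 < n" and f[measurable]: "\<And>i. i < d \<Longrightarrow> f i \<in> borel_measurable borel" and nn: "\<And>i x. 0 \<le> f i x"
  shows "(\<integral>\<^sup>+x. ennreal (\<Prod>i<d. f i (x i)) \<partial>gauss d n)
     = (\<Prod>i<d. \<integral>\<^sup>+x. ennreal (normal_density 0 (1 / sqrt n) x * f i x) \<partial>lborel)"
proof -
  have [measurable]: "(\<lambda>x. \<Prod>i<d. f i (x i)) \<in> borel_measurable (leb d)"
    by (intro borel_measurable_prod measurable_compose[OF measurable_component_singleton[of _ "{..<d}" "\<lambda>_. lborel"]]) auto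
  have "(\<integral>\<^sup>+x. ennreal (\<Prod>i<d. f i (x i)) \<partial>gauss d n) = (\<integral>\<^sup>+x. ennreal (gdens d n x) * ennreal (\<Prod>i<d. f i (x i)) \<partial>leb d)"
    unfolding gauss_def by (rule nn_integral_density) measurable
  also have "\<dots> = (\<integral>\<^sup>+x. (\<Prod>i<d. ennreal (normal_density 0 (1 / sqrt n) (x i) * f i (x i))) \<partial>leb d)"
    by (intro nn_integral_cong)
       (simp add: gdens_eq_prod[OF n] ennreal_mult[symmetric] prod_nonneg nn prod.distrib[symmetric] prod_ennreal)
  also have "\<dots> = (\<Prod>i<d. \<integral>\<^sup>+x. ennreal (normal_density 0 (1 / sqrt n) x * f i x) \<partial>lborel)"
    by (rule lb.product_nn_integral_prod) auto
  finally show ?thesis .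
qed

lemma nn_integral_normal_density:
  assumes "0 < \<sigma>" shows "(\<integral>\<^sup>+x. ennreal (normal_density \<mu> \<sigma> x) \<partial>lborel) = 1"
  using assms by (subst nn_integral_eq_integral) (auto simp: integrable_normal_density integral_normal_density)

lemma nn_integral_gauss_exp_sq:
  assumes n: "0 < n" and l: "\<alpha> < 1"
  shows "(\<integral>\<^sup>+x. ennreal (exp (\<alpha> * (n / 2 * dot d x x))) \<partial>gauss d n) = ennreal ((1 / sqrt (1 - \<alpha>)) ^ d)"
proof -
  have "(\<integral>\<^sup>+x. ennreal (exp (\<alpha> * (n / 2 * dot d x x))) \<partial>gauss d n)
      = (\<integral>\<^sup>+x. ennreal (\<Prod>i<d. exp (\<alpha> * n / 2 * (x i * x i))) \<partial>gauss d n)"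
    by (simp add: exp_sum[symmetric] sum_distrib_left mult.assoc)
  also have "\<dots> = (\<Prod>i<d. \<integral>\<^sup>+x. ennreal (normal_density 0 (1 / sqrt n) x * exp (\<alpha> * n / 2 * (x * x))) \<partial>lborel)"
    by (rule nn_integral_gauss_prod[OF n]) auto
  also have "(\<integral>\<^sup>+x. ennreal (normal_density 0 (1 / sqrt n) x * exp (\<alpha> * n / 2 * (x * x))) \<partial>lborel) = ennreal (1 / sqrt (1 - \<alpha>))"
  proof -
    have p: "0 < n * (1 - \<alpha>)" using n l by simp
    have "normal_density 0 (1 / sqrt n) x * exp (\<alpha> * n / 2 * (x * x))
        = 1 / sqrt (1 - \<alpha>) * normal_density 0 (1 / sqrt (n * (1 - \<alpha>))) x" for x
    proof -
      have "exp (- (n / 2 * x\<^sup>2)) * exp (\<alpha> * n / 2 * (x * x)) = exp (- (n * (1 - \<alpha>) / 2 * x\<^sup>2))"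
        by (simp add: exp_add[symmetric] power2_eq_square field_simps)
      moreover have "normal_density 0 (1 / sqrt n) x = sqrt (n / (2 * pi)) * exp (- (n / 2 * x\<^sup>2))"
        using n by (simp add: normal_density_def field_simps real_sqrt_divide real_sqrt_mult power2_eq_square)
      moreover have "normal_density 0 (1 / sqrt (n * (1 - \<alpha>))) x = sqrt (n * (1 - \<alpha>) / (2 * pi)) * exp (- (n * (1 - \<alpha>) / 2 * x\<^sup>2))"
        using p n l by (simp add: normal_density_def field_simps real_sqrt_divide real_sqrt_mult power2_eq_square)
      moreover have "sqrt (n / (2 * pi)) = 1 / sqrt (1 - \<alpha>) * sqrt (n * (1 - \<alpha>) / (2 * pi))"
        using l by (simp add: real_sqrt_divide real_sqrt_mult)
      ultimately show ?thesis by simp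
    qed
    then have "(\<integral>\<^sup>+x. ennreal (normal_density 0 (1 / sqrt n) x * exp (\<alpha> * n / 2 * (x * x))) \<partial>lborel)
      = (\<integral>\<^sup>+x. ennreal (1 / sqrt (1 - \<alpha>)) * ennreal (normal_density 0 (1 / sqrt (n * (1 - \<alpha>))) x) \<partial>lborel)"
      using l by (intro nn_integral_cong) (simp add: ennreal_mult[symmetric])
    also have "\<dots> = ennreal (1 / sqrt (1 - \<alpha>))"
      using p by (subst nn_integral_cmult) (auto simp: nn_integral_normal_density)
    finally show ?thesis .
  qed
  finally show ?thesis using l by (simp add: ennreal_power)
qed

lemma prob_space_gauss: "0 < n \<Longrightarrow> prob_space (gauss d n)"
  using nn_integral_gauss_exp_sq[of n 0 d] by (intro prob_spaceI) simp

lemma nn_integral_gauss_exp_lin: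
  assumes n: "0 < n"
  shows "(\<integral>\<^sup>+x. ennreal (exp (dot d v x)) \<partial>gauss d n) = ennreal (exp (dot d v v / (2 * n)))"
proof -
  have "(\<integral>\<^sup>+x. ennreal (exp (dot d v x)) \<partial>gauss d n) = (\<integral>\<^sup>+x. ennreal (\<Prod>i<d. exp (v i * x i)) \<partial>gauss d n)"
    by (simp add: exp_sum[symmetric])
  also have "\<dots> = (\<Prod>i<d. \<integral>\<^sup>+x. ennreal (normal_density 0 (1 / sqrt n) x * exp (v i * x)) \<partial>lborel)"
    by (rule nn_integral_gauss_prod[OF n]) auto
  also have "\<dots> = (\<Prod>i<d. ennreal (exp (v i * v i / (2 * n))))"
  proof (rule prod.cong[OF refl])
    fix i
    have "normal_density 0 (1 / sqrt n) x * exp (v i * x) = exp (v i * v i / (2 * n)) * normal_density (v i / n) (1 / sqrt n) x" for x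
    proof -
      have "- (n * x\<^sup>2) / 2 + v i * x = v i * v i / (2 * n) - n * (x - v i / n)\<^sup>2 / 2"
        using n by (simp add: power2_eq_square field_simps)
      then have "exp (- (n * x\<^sup>2) / 2) * exp (v i * x) = exp (v i * v i / (2 * n)) * exp (- (n * (x - v i / n)\<^sup>2) / 2)"
        by (simp add: exp_add[symmetric])
      moreover have "2 * (1 / sqrt n)\<^sup>2 = 2 / n" using n by (simp add: power_divide)
      ultimately show ?thesis using n by (simp add: normal_density_def mult_ac)
    qed
    then have "(\<integral>\<^sup>+x. ennreal (normal_density 0 (1 / sqrt n) x * exp (v i * x)) \<partial>lborel)
      = (\<integral>\<^sup>+x. ennreal (exp (v i * v i / (2 * n))) * ennreal (normal_density (v i / n) (1 / sqrt n) x) \<partial>lborel)"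
      by (simp add: ennreal_mult)
    also have "\<dots> = ennreal (exp (v i * v i / (2 * n)))"
      using n by (subst nn_integral_cmult) (auto simp: nn_integral_normal_density)
    finally show "(\<integral>\<^sup>+x. ennreal (normal_density 0 (1 / sqrt n) x * exp (v i * x)) \<partial>lborel) = ennreal (exp (v i * v i / (2 * n)))" .
  qed
  also have "\<dots> = ennreal (exp (dot d v v / (2 * n)))"
    by (simp add: prod_ennreal exp_sum[symmetric] sum_divide_distrib)
  finally show ?thesis .
qed

text \<open>The exact constant is \<open>1\<close>; the bound \<open>z\<^sup>2 \<le> 2 (e\<^sup>z + e\<^sup>-\<^sup>z)\<close> reduces a cruder one to the
  exponential moment.\<close>

lemma nn_integral_gauss_lin_sq:
  assumes n: "0 < n"
  shows "(\<integral>\<^sup>+x. ennreal ((dot d v x)\<^sup>2) \<partial>gauss d n) \<le> ennreal (8 * dot d v v / n)"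
proof (cases "dot d v v = 0")
  case True
  then have "v i = 0" if "i < d" for i using that by (subst (asm) sum_nonneg_eq_0_iff) auto
  then show ?thesis using True by simp
next
  case False
  define s where "s = sqrt (n / dot d v v)"
  have dv: "0 < dot d v v" using False sum_nonneg[of "{..<d}" "\<lambda>i. v i * v i"] by auto
  then have s: "0 < s" "s\<^sup>2 = n / dot d v v" using n by (auto simp: s_def)
  have e: "ennreal ((dot d v x)\<^sup>2) \<le> ennreal (2 / s\<^sup>2) * (ennreal (exp (dot d (\<lambda>i. s * v i) x)) + ennreal (exp (dot d (\<lambda>i. - s * v i) x)))" for x
  proof -
    define z where "z = s * dot d v x"
    have sq: "z\<^sup>2 \<le> 2 * (exp z + exp (- z))"
    proof -
      have "z\<^sup>2 / 2 \<le> exp \<bar>z\<bar>"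
        using exp_lower_Taylor_quadratic[of "\<bar>z\<bar>"] by simp
      moreover have "exp \<bar>z\<bar> \<le> exp z + exp (- z)" by (cases "z \<ge> 0") auto
      ultimately show ?thesis by simp
    qed
    have "(dot d v x)\<^sup>2 = 1 / s\<^sup>2 * z\<^sup>2" using s(1) by (simp add: z_def power_mult_distrib)
    also have "\<dots> \<le> 1 / s\<^sup>2 * (2 * (exp z + exp (- z)))" using sq by (intro mult_left_mono) auto
    finally have "ennreal ((dot d v x)\<^sup>2) \<le> ennreal (2 / s\<^sup>2 * (exp z + exp (- z)))"
      by (intro ennreal_leI) simp
    also have "\<dots> = ennreal (2 / s\<^sup>2) * (ennreal (exp z) + ennreal (exp (- z)))"
      by (subst ennreal_mult) auto
    also have "z = dot d (\<lambda>i. s * v i) x" by (simp add: z_def sum_distrib_left mult.assoc)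
    also have "- dot d (\<lambda>i. s * v i) x = dot d (\<lambda>i. - s * v i) x" by (simp add: sum_negf)
    finally show ?thesis .
  qed
  have "(\<integral>\<^sup>+x. ennreal ((dot d v x)\<^sup>2) \<partial>gauss d n)
     \<le> (\<integral>\<^sup>+x. ennreal (2 / s\<^sup>2) * (ennreal (exp (dot d (\<lambda>i. s * v i) x)) + ennreal (exp (dot d (\<lambda>i. - s * v i) x))) \<partial>gauss d n)"
    by (intro nn_integral_mono e)
  also have "\<dots> = ennreal (2 / s\<^sup>2) * (ennreal (exp (1/2)) + ennreal (exp (1/2)))"
  proof -
    have "dot d (\<lambda>i. s * v i) (\<lambda>i. s * v i) = s\<^sup>2 * dot d v v" "dot d (\<lambda>i. - s * v i) (\<lambda>i. - s * v i) = s\<^sup>2 * dot d v v"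
      by (simp_all add: sum_distrib_left power2_eq_square mult_ac)
    then have "dot d (\<lambda>i. s * v i) (\<lambda>i. s * v i) / (2 * n) = 1 / 2" "dot d (\<lambda>i. - s * v i) (\<lambda>i. - s * v i) / (2 * n) = 1 / 2"
      using s n dv by auto
    then show ?thesis
      by (subst nn_integral_cmult, simp, subst nn_integral_add) (simp_all only: nn_integral_gauss_exp_lin[OF n], simp_all)
  qed
  also have "\<dots> = ennreal (2 / s\<^sup>2 * (exp (1/2) + exp (1/2)))"
    by (subst ennreal_mult, simp, simp, subst ennreal_plus) simp_all
  also have "\<dots> \<le> ennreal (8 * dot d v v / n)"
  proof (rule ennreal_leI)
    have "exp (1/2) \<le> (2::real)" using exp_half_le2 by simp
    then have "2 / s\<^sup>2 * (exp (1/2) + exp (1/2)) \<le> 2 / s\<^sup>2 * 4" by (intro mult_left_mono) auto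
    then show "2 / s\<^sup>2 * (exp (1/2) + exp (1/2)) \<le> 8 * dot d v v / n" using s by (simp add: mult.commute)
  qed
  finally show ?thesis .
qed

text \<open>
  Moments of \<open>y = n \<parallel>x\<parallel>\<^sup>2\<close> come from the exponential moment alone, as \<open>y\<^sup>2 \<le> 32 d\<^sup>2 exp (y / (4 d))\<close> and the
  expectation of the right-hand exponential is bounded in \<open>d\<close> by Bernoulli's inequality.
\<close>

lemma gauss_fourth_moment:
  assumes n: "0 < n" and d: "1 \<le> d"
  shows "(\<integral>\<^sup>+x. ennreal ((n * dot d x x)\<^sup>2) \<partial>gauss d n) \<le> ennreal (64 * real d ^ 2)"
proof -
  let ?l = "1 / (2 * real d)"
  have "(n * dot d x x)\<^sup>2 \<le> 32 * real d ^ 2 * exp (?l * (n / 2 * dot d x x))" for x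
  proof -
    have "0 \<le> dot d x x" by (intro sum_nonneg) auto
    then have z: "0 \<le> ?l * (n / 2 * dot d x x)" (is "0 \<le> ?z") using n by auto
    have "?z\<^sup>2 / 2 \<le> exp ?z" using exp_lower_Taylor_quadratic[OF z] z by linarith
    then have "(4 * real d)\<^sup>2 * (?z\<^sup>2 / 2) \<le> (4 * real d)\<^sup>2 * exp ?z" by (intro mult_left_mono) auto
    moreover have "(4 * real d)\<^sup>2 * (?z\<^sup>2 / 2) = (n * dot d x x)\<^sup>2 / 2"
      using d by (simp add: power2_eq_square field_simps)
    ultimately show ?thesis by (simp add: power_mult_distrib)
  qed
  then have "(\<integral>\<^sup>+x. ennreal ((n * dot d x x)\<^sup>2) \<partial>gauss d n)
     \<le> (\<integral>\<^sup>+x. ennreal (32 * real d ^ 2) * ennreal (exp (?l * (n / 2 * dot d x x))) \<partial>gauss d n)"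
    by (intro nn_integral_mono) (simp add: ennreal_mult[symmetric] ennreal_leI)
  also have "\<dots> = ennreal (32 * real d ^ 2) * ennreal ((1 / sqrt (1 - ?l)) ^ d)"
    using d by (subst nn_integral_cmult) (simp, subst nn_integral_gauss_exp_sq[OF n], simp_all)
  also have "\<dots> = ennreal (32 * real d ^ 2 * (1 / sqrt (1 - ?l)) ^ d)"
    using d by (simp add: ennreal_mult)
  also have "\<dots> \<le> ennreal (32 * real d ^ 2 * 2)"
  proof (intro ennreal_leI mult_left_mono)
    have "1 + real d * (- ?l) \<le> (1 + - ?l) ^ d" using d by (intro Bernoulli_inequality) auto
    then have b: "1 / 2 \<le> (1 - ?l) ^ d" using d by simp
    have p: "0 < 1 - ?l" using d by simp
    have "1 / 2 \<le> sqrt ((1 - ?l) ^ d)"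
      using b by (intro real_le_rsqrt order_trans[OF _ b]) (auto simp: power2_eq_square)
    then have "inverse (sqrt (1 - ?l) ^ d) \<le> inverse (1 / 2)"
      by (intro le_imp_inverse_le) (auto simp: real_sqrt_power)
    then show "(1 / sqrt (1 - ?l)) ^ d \<le> 2" by (simp add: power_one_over inverse_eq_divide)
  qed simp
  finally show ?thesis by simp
qed

text \<open>
  Chernoff's bound with parameter \<open>\<alpha> / 2\<close>. It is applied at \<open>3 d\<close>, at \<open>13 d / 4\<close> and at their sum \<open>25 d / 4\<close>,
  which is \<open>n \<rho>\<^sup>2\<close> for the radius \<open>\<rho>\<close> at which the inversion integral is split.
\<close>

lemma gauss_tail:
  assumes n: "0 < n" and l: "0 \<le> \<alpha>" "\<alpha> < 1"
  shows "emeasure (gauss d n) {x \<in> Rd d. a * real d \<le> n * dot d x x} \<le> ennreal ((exp (- (\<alpha> * a / 2)) / sqrt (1 - \<alpha>)) ^ d)"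
proof -
  have [measurable]: "{x \<in> Rd d. a * real d \<le> n * dot d x x} \<in> sets (leb d)"
    unfolding space_leb[symmetric] by measurable
  have "emeasure (gauss d n) {x \<in> Rd d. a * real d \<le> n * dot d x x}
     = (\<integral>\<^sup>+x. indicator {x \<in> Rd d. a * real d \<le> n * dot d x x} x \<partial>gauss d n)" by simp
  also have "\<dots> \<le> (\<integral>\<^sup>+x. ennreal (exp (- (\<alpha> * a / 2)) ^ d) * ennreal (exp (\<alpha> * (n / 2 * dot d x x))) \<partial>gauss d n)"
  proof (rule nn_integral_mono)
    fix x
    have "1 \<le> exp (- (\<alpha> * a / 2)) ^ d * exp (\<alpha> * (n / 2 * dot d x x))" if "a * real d \<le> n * dot d x x"
    proof -
      have "\<alpha> / 2 * (a * real d) \<le> \<alpha> / 2 * (n * dot d x x)" using that l by (intro mult_left_mono) auto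
      then have "0 \<le> real d * - (\<alpha> * a / 2) + \<alpha> * (n / 2 * dot d x x)" by (simp add: algebra_simps)
      then show ?thesis by (simp add: exp_of_nat_mult[symmetric] exp_add[symmetric])
    qed
    then show "indicator {x \<in> Rd d. a * real d \<le> n * dot d x x} x \<le> ennreal (exp (- (\<alpha> * a / 2)) ^ d) * ennreal (exp (\<alpha> * (n / 2 * dot d x x)))"
      by (auto simp: indicator_def ennreal_mult[symmetric] simp flip: ennreal_1 intro!: ennreal_leI)
  qed
  also have "\<dots> = ennreal (exp (- (\<alpha> * a / 2)) ^ d) * ennreal ((1 / sqrt (1 - \<alpha>)) ^ d)"
    by (subst nn_integral_cmult) (simp, subst nn_integral_gauss_exp_sq[OF n l(2)], simp_all)
  also have "\<dots> = ennreal ((exp (- (\<alpha> * a / 2)) / sqrt (1 - \<alpha>)) ^ d)"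
    using l by (simp add: ennreal_mult[symmetric] power_mult_distrib[symmetric] del: power_mult_distrib)
  finally show ?thesis .
qed

lemma vnorm_sq: "(vnorm d x)\<^sup>2 = dot d x x"
  by (simp add: L2_set_def sum_nonneg power2_eq_square)

lemma vnorm_measurable [measurable]: "vnorm d \<in> borel_measurable (leb d)"
  unfolding L2_set_def by measurable

lemma vnorm_nonneg [simp]: "0 \<le> vnorm d x" by (rule L2_set_nonneg)

lemma gauss_tail_3:
  assumes n: "0 < n" and d: "1 \<le> d"
  shows "emeasure (gauss d n) {x \<in> Rd d. 3 * real d \<le> n * dot d x x} \<le> ennreal (5 / (2 * real d))"
proof -
  let ?c = "exp (- (1/2 * 3 / 2)) / sqrt (1 - 1/2) :: real"
  have "?c\<^sup>2 = 2 / exp (3/2)"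
    by (simp add: power_divide exp_minus field_simps) (simp add: exp_double[symmetric])
  moreover have "exp (3/2) \<ge> (4 :: real)"
  proof -
    have "(4::real) \<le> (1 + (3/4) + (3/4)\<^sup>2/2)\<^sup>2" by (simp add: power2_eq_square)
    also have "\<dots> \<le> (exp (3/4))\<^sup>2" by (intro power_mono exp_lower_Taylor_quadratic) auto
    also have "\<dots> = exp (3/2)" by (simp add: exp_double[symmetric])
    finally show ?thesis .
  qed
  then have "2 / exp (3/2) \<le> (1 / 2 :: real)" by (simp add: divide_le_eq)
  moreover have "1 / 2 \<le> (1 / (1 + 2/5) :: real)\<^sup>2" by (simp add: power2_eq_square)
  ultimately have "?c\<^sup>2 \<le> (1 / (1 + 2/5))\<^sup>2" by linarith
  then have c: "?c \<le> 1 / (1 + 2/5)" by (rule power2_le_imp_le) simp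
  have "emeasure (gauss d n) {x \<in> Rd d. 3 * real d \<le> n * dot d x x} \<le> ennreal (?c ^ d)"
    by (rule gauss_tail[OF n]) auto
  also have "\<dots> \<le> ennreal (5 / (2 * real d))"
  proof (rule ennreal_leI)
    have "?c ^ d \<le> (1 / (1 + 2/5)) ^ d" by (rule power_mono[OF c]) simp
    also have "\<dots> = 1 / (1 + 2/5) ^ d" by (rule power_one_over)
    also have "\<dots> \<le> 1 / (real d * (2/5))"
      using Bernoulli_inequality[of "2/5 :: real" d] d by (intro divide_left_mono mult_pos_pos) auto
    finally show "?c ^ d \<le> 5 / (2 * real d)" by simp
  qed
  finally show ?thesis .
qed

lemma gauss_tail_13_4:
  assumes n: "0 < n" and d: "1 \<le> d"
  shows "emeasure (gauss d n) {x \<in> Rd d. 13 / 4 * real d \<le> n * dot d x x} \<le> ennreal (2 / 3)"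
proof -
  let ?c = "exp (- (1/2 * (13/4) / 2)) / sqrt (1 - 1/2) :: real"
  have "?c\<^sup>2 = 2 / exp (13/8)"
    by (simp add: power_divide exp_minus field_simps) (simp add: exp_double[symmetric])
  moreover have "exp (13/8) \<ge> (9/2 :: real)"
  proof -
    have "(9/2::real) \<le> (1 + (13/16) + (13/16)\<^sup>2/2)\<^sup>2" by (simp add: power2_eq_square)
    also have "\<dots> \<le> (exp (13/16))\<^sup>2" by (intro power_mono exp_lower_Taylor_quadratic) auto
    also have "\<dots> = exp (13/8)" by (simp add: exp_double[symmetric])
    finally show ?thesis .
  qed
  then have "2 / exp (13/8) \<le> (2 / (9/2) :: real)" by (intro divide_left_mono) auto
  ultimately have "?c\<^sup>2 \<le> (2/3)\<^sup>2" by (simp add: power2_eq_square)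
  then have c: "?c \<le> 2/3" by (rule power2_le_imp_le) simp
  have "emeasure (gauss d n) {x \<in> Rd d. 13/4 * real d \<le> n * dot d x x} \<le> ennreal (?c ^ d)"
    by (rule gauss_tail[OF n]) auto
  also have "\<dots> \<le> ennreal (2/3)"
  proof (rule ennreal_leI)
    have "?c ^ d \<le> (2/3) ^ d" by (rule power_mono[OF c]) simp
    also have "\<dots> \<le> (2/3) ^ 1" using d by (intro power_decreasing) auto
    finally show "?c ^ d \<le> 2/3" by simp
  qed
  finally show ?thesis .
qed

lemma gauss_tail_25_4:
  assumes n: "0 < n"
  shows "emeasure (gauss d n) {x \<in> Rd d. 25 / 4 * real d \<le> n * dot d x x} \<le> ennreal (exp (- real d))"
proof -
  let ?c = "exp (- (3/4 * (25/4) / 2)) / sqrt (1 - 3/4) :: real"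
  have s: "sqrt (1 - 3/4) = (1/2::real)" by (rule real_sqrt_unique) (auto simp: power2_eq_square)
  have "2 \<le> exp (43/32::real)" using exp_ge_add_one_self[of "43/32::real"] by linarith
  then have c: "?c \<le> exp (- 1)"
  proof -
    have "exp (43/32) * exp (- (75/32)) = exp (- 1 :: real)" unfolding mult_exp_exp by simp
    moreover have "2 * exp (- (75/32)) \<le> exp (43/32) * exp (- (75/32) :: real)"
      using \<open>2 \<le> exp (43/32)\<close> by (rule mult_right_mono) simp
    ultimately show ?thesis unfolding s by (simp add: mult.commute)
  qed
  have "emeasure (gauss d n) {x \<in> Rd d. 25/4 * real d \<le> n * dot d x x} \<le> ennreal (?c ^ d)"
    by (rule gauss_tail[OF n]) auto
  also have "\<dots> \<le> ennreal (exp (- 1) ^ d)"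
    by (intro ennreal_leI power_mono[OF c]) auto
  also have "exp (- 1) ^ d = exp (- real d)" by (simp add: exp_of_nat_mult[symmetric])
  finally show ?thesis .
qed

lemma rot_sq_sum:
  "dot d (rot d \<theta> x y) (rot d \<theta> x y) + dot d (rot d (\<theta> + pi/2) x y) (rot d (\<theta> + pi/2) x y) = dot d x x + dot d y y"
proof -
  have "(c * a + s * b) * (c * a + s * b) + (c * b - s * a) * (c * b - s * a) = (s\<^sup>2 + c\<^sup>2) * (a * a + b * b)" for a b c s :: real
    by (simp add: algebra_simps power2_eq_square)
  then have e: "(cos \<theta> * a + sin \<theta> * b) * (cos \<theta> * a + sin \<theta> * b) + (cos \<theta> * b - sin \<theta> * a) * (cos \<theta> * b - sin \<theta> * a)
      = a * a + b * b" for a b by simp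
  have "dot d (rot d \<theta> x y) (rot d \<theta> x y) + dot d (rot d (\<theta> + pi/2) x y) (rot d (\<theta> + pi/2) x y)
    = (\<Sum>i<d. (cos \<theta> * x i + sin \<theta> * y i) * (cos \<theta> * x i + sin \<theta> * y i) + (cos \<theta> * y i - sin \<theta> * x i) * (cos \<theta> * y i - sin \<theta> * x i))"
    by (simp add: rot_def sum.distrib cos_add sin_add)
  then show ?thesis unfolding e by (simp add: sum.distrib)
qed

text \<open>
  The density of a pair depends only on \<open>\<parallel>x\<parallel>\<^sup>2 + \<parallel>y\<parallel>\<^sup>2\<close>, which a rotation preserves.
\<close>

lemma nn_integral_gauss_rot:
  assumes n: "0 < n" and f: "f \<in> borel_measurable (leb d \<Otimes>\<^sub>M leb d)" and \<theta>: "sin \<theta> \<noteq> 0"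
  shows "(\<integral>\<^sup>+(x, y). f (rot d \<theta> x y, rot d (\<theta> + pi/2) x y) \<partial>(gauss d n \<Otimes>\<^sub>M gauss d n))
    = (\<integral>\<^sup>+z. f z \<partial>(gauss d n \<Otimes>\<^sub>M gauss d n))"
proof -
  note f[measurable]
  interpret prob_space "gauss d n" by (rule prob_space_gauss[OF n])
  have dens: "gauss d n \<Otimes>\<^sub>M gauss d n = density (leb d \<Otimes>\<^sub>M leb d) (\<lambda>(x, y). ennreal (gdens d n x) * ennreal (gdens d n y))"
    unfolding gauss_def
  proof (rule pair_measure_density)
    show "sigma_finite_measure (density (leb d) (\<lambda>x. ennreal (gdens d n x)))"
      using sigma_finite_measure_axioms by (simp add: gauss_def)
  qed (use sigma_finite_leb in auto)
  define g where "g = (\<lambda>(x, y). ennreal (gdens d n x) * ennreal (gdens d n y))"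
  have g[measurable]: "g \<in> borel_measurable (leb d \<Otimes>\<^sub>M leb d)" unfolding g_def by measurable
  have grot: "g (rot d \<theta> x y, rot d (\<theta> + pi/2) x y) = g (x, y)" for x y
  proof -
    have gg: "gdens d n a * gdens d n b = sqrt (n / (2 * pi)) ^ d * sqrt (n / (2 * pi)) ^ d * exp (- (n / 2 * (dot d a a + dot d b b)))" for a b
      by (simp add: gdens_def algebra_simps exp_add[symmetric])
    show ?thesis using n by (simp add: g_def ennreal_mult[symmetric] gg rot_sq_sum)
  qed
  have "(\<integral>\<^sup>+z. f z \<partial>(gauss d n \<Otimes>\<^sub>M gauss d n)) = (\<integral>\<^sup>+z. g z * f z \<partial>(leb d \<Otimes>\<^sub>M leb d))"
    unfolding dens g_def[symmetric] by (rule nn_integral_density) measurable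
  also have "\<dots> = (\<integral>\<^sup>+(x, y). g (rot d \<theta> x y, rot d (\<theta> + pi/2) x y) * f (rot d \<theta> x y, rot d (\<theta> + pi/2) x y) \<partial>(leb d \<Otimes>\<^sub>M leb d))"
    by (rule nn_integral_rot[OF _ \<theta>, symmetric, of "\<lambda>z. g z * f z"]) measurable
  also have "\<dots> = (\<integral>\<^sup>+z. g z * (case z of (x, y) \<Rightarrow> f (rot d \<theta> x y, rot d (\<theta> + pi/2) x y)) \<partial>(leb d \<Otimes>\<^sub>M leb d))"
    by (simp add: grot split_beta')
  also have "\<dots> = (\<integral>\<^sup>+(x, y). f (rot d \<theta> x y, rot d (\<theta> + pi/2) x y) \<partial>(gauss d n \<Otimes>\<^sub>M gauss d n))"
    unfolding dens g_def[symmetric] by (rule nn_integral_density[symmetric]) measurable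
  finally show ?thesis ..
qed

text \<open>
  The Gaussian density with inverse variance \<open>d / r\<^sup>2\<close> has total mass one and is at least
  \<open>(d / (2 \<pi> r\<^sup>2))\<^sup>d\<^sup>/\<^sup>2 exp (- d / 2)\<close> on the ball of radius \<open>r\<close>; this choice of the variance is the best one and
  has the exponential rate of the true volume.
\<close>

lemma emeasure_ball_le:
  assumes n: "0 < n" and d: "1 \<le> d" and r: "0 < r"
  shows "ennreal (sqrt (n / (2 * pi)) ^ d) * emeasure (leb d) {x \<in> Rd d. vnorm d x \<le> r}
    \<le> ennreal ((sqrt (n * exp 1 / real d) * r) ^ d)"
proof -
  define s where "s = real d / r\<^sup>2"
  have s: "0 < s" using d r by (simp add: s_def)
  define k where "k = sqrt (s / (2 * pi)) ^ d * exp (- (real d / 2))"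
  have k: "0 < k" using s by (simp add: k_def)
  interpret prob_space "gauss d s" by (rule prob_space_gauss[OF s])
  let ?B = "{x \<in> Rd d. vnorm d x \<le> r}"
  have [measurable]: "?B \<in> sets (leb d)" unfolding space_leb[symmetric] by measurable
  have "ennreal k * emeasure (leb d) ?B = (\<integral>\<^sup>+x. ennreal k * indicator ?B x \<partial>leb d)"
    by (simp add: nn_integral_cmult_indicator)
  also have "\<dots> \<le> (\<integral>\<^sup>+x. ennreal (gdens d s x) * indicator (space (leb d)) x \<partial>leb d)"
  proof (rule nn_integral_mono)
    fix x
    have "k \<le> gdens d s x" if "vnorm d x \<le> r"
    proof -
      have "dot d x x \<le> r\<^sup>2" unfolding vnorm_sq[symmetric] using that by (intro power_mono) auto
      then have "s / 2 * dot d x x \<le> s / 2 * r\<^sup>2" using s by (intro mult_left_mono) auto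
      also have "\<dots> = real d / 2" using r by (simp add: s_def)
      finally show ?thesis unfolding k_def gdens_def using s by (intro mult_left_mono) auto
    qed
    then show "ennreal k * indicator ?B x \<le> ennreal (gdens d s x) * indicator (space (leb d)) x"
      by (auto simp: indicator_def space_leb intro!: ennreal_leI)
  qed
  also have "\<dots> = emeasure (gauss d s) (space (leb d))"
    unfolding gauss_def by (rule emeasure_density[symmetric]) auto
  also have "\<dots> = 1" using emeasure_space_1 by (simp add: space_leb)
  finally have 1: "ennreal k * emeasure (leb d) ?B \<le> 1" .
  have "sqrt (n / (2 * pi)) ^ d = (sqrt (n * exp 1 / real d) * r) ^ d * k"
  proof -
    have "sqrt (n / (2 * pi)) = sqrt (n * exp 1 / real d) * r * (sqrt (s / (2 * pi)) * exp (- (1 / 2)))"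
    proof -
      have "exp (- (1/2)) = sqrt (exp (- 1 :: real))" by (rule real_sqrt_unique[symmetric]) (auto simp: exp_double[symmetric])
      moreover have "r = sqrt (r\<^sup>2)" using r by simp
      ultimately have "sqrt (n * exp 1 / real d) * r * (sqrt (s / (2 * pi)) * exp (- (1 / 2)))
        = sqrt (n * exp 1 / real d * r\<^sup>2 * (s / (2 * pi)) * exp (- 1))"
        by (simp only: real_sqrt_mult mult.assoc)
      also have "n * exp 1 / real d * r\<^sup>2 * (s / (2 * pi)) * exp (- 1) = n / (2 * pi)"
        using d r by (simp add: s_def field_simps exp_minus)
      finally show ?thesis by simp
    qed
    moreover have "exp (- (real d / 2)) = exp (- (1 / 2)) ^ d" by (simp add: exp_of_nat_mult[symmetric])
    ultimately show ?thesis unfolding k_def by (simp add: power_mult_distrib)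
  qed
  then have "ennreal (sqrt (n / (2 * pi)) ^ d) * emeasure (leb d) ?B
      = ennreal ((sqrt (n * exp 1 / real d) * r) ^ d) * (ennreal k * emeasure (leb d) ?B)"
    using k r n by (simp add: ennreal_mult mult.assoc)
  also have "\<dots> \<le> ennreal ((sqrt (n * exp 1 / real d) * r) ^ d) * 1" by (intro mult_left_mono 1) auto
  finally show ?thesis by simp
qed

text \<open>
  A decreasing radial function is an integral of indicators of balls, so by Tonelli's theorem only volumes of
  balls are needed.
\<close>

lemma layer_cake:
  assumes n: "0 < n" and d: "1 \<le> d" and \<rho>: "0 < \<rho>" and f[measurable]: "f \<in> borel_measurable borel"
    and F: "\<And>s. \<rho> \<le> s \<Longrightarrow> F s \<le> (\<integral>\<^sup>+r. f r * indicator {s..} r \<partial>lborel)"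
  shows "ennreal (sqrt (n / (2 * pi)) ^ d) * (\<integral>\<^sup>+x. F (vnorm d x) * indicator {x \<in> Rd d. \<rho> \<le> vnorm d x} x \<partial>leb d)
    \<le> (\<integral>\<^sup>+r. f r * ennreal ((sqrt (n * exp 1 / real d) * r) ^ d) * indicator {\<rho>..} r \<partial>lborel)"
proof -
  interpret sigma_finite_measure "leb d" by (rule sigma_finite_leb)
  interpret pair_sigma_finite "leb d" lborel ..
  let ?k = "ennreal (sqrt (n / (2 * pi)) ^ d)"
  define g where "g = (\<lambda>(x, r). f r * indicator {x \<in> space (leb d). \<rho> \<le> vnorm d x} x * (if vnorm d x \<le> r then 1 else 0))"
  have [measurable]: "g \<in> borel_measurable (leb d \<Otimes>\<^sub>M lborel)" unfolding g_def by measurable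
  have "(\<integral>\<^sup>+x. F (vnorm d x) * indicator {x \<in> Rd d. \<rho> \<le> vnorm d x} x \<partial>leb d) \<le> (\<integral>\<^sup>+x. \<integral>\<^sup>+r. g (x, r) \<partial>lborel \<partial>leb d)"
  proof (rule nn_integral_mono)
    fix x assume "x \<in> space (leb d)"
    show "F (vnorm d x) * indicator {x \<in> Rd d. \<rho> \<le> vnorm d x} x \<le> (\<integral>\<^sup>+r. g (x, r) \<partial>lborel)"
    proof (cases "x \<in> Rd d \<and> \<rho> \<le> vnorm d x")
      case True
      then have "g (x, r) = f r * indicator {vnorm d x..} r" for r
        by (auto simp: g_def space_leb indicator_def)
      then show ?thesis using F[of "vnorm d x"] True by simp
    qed auto
  qed
  also have "\<dots> = (\<integral>\<^sup>+r. \<integral>\<^sup>+x. g (x, r) \<partial>leb d \<partial>lborel)" by (rule Fubini'[symmetric]) measurable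
  finally have "?k * (\<integral>\<^sup>+x. F (vnorm d x) * indicator {x \<in> Rd d. \<rho> \<le> vnorm d x} x \<partial>leb d)
     \<le> ?k * (\<integral>\<^sup>+r. \<integral>\<^sup>+x. g (x, r) \<partial>leb d \<partial>lborel)" by (rule mult_left_mono) simp
  also have "\<dots> = (\<integral>\<^sup>+r. ?k * (\<integral>\<^sup>+x. g (x, r) \<partial>leb d) \<partial>lborel)"
    by (rule nn_integral_cmult[symmetric]) measurable
  also have "\<dots> \<le> (\<integral>\<^sup>+r. f r * ennreal ((sqrt (n * exp 1 / real d) * r) ^ d) * indicator {\<rho>..} r \<partial>lborel)"
  proof (rule nn_integral_mono)
    fix r :: real
    let ?B = "{x \<in> Rd d. vnorm d x \<le> r}"
    have [measurable]: "?B \<in> sets (leb d)" unfolding space_leb[symmetric] by measurable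
    have "(\<integral>\<^sup>+x. g (x, r) \<partial>leb d) \<le> (\<integral>\<^sup>+x. f r * indicator {\<rho>..} r * indicator ?B x \<partial>leb d)"
      by (intro nn_integral_mono) (auto simp: g_def indicator_def space_leb)
    also have "\<dots> = f r * indicator {\<rho>..} r * emeasure (leb d) ?B" by (rule nn_integral_cmult_indicator) measurable
    finally have "?k * (\<integral>\<^sup>+x. g (x, r) \<partial>leb d) \<le> ?k * (f r * indicator {\<rho>..} r * emeasure (leb d) ?B)"
      by (rule mult_left_mono) simp
    also have "\<dots> = f r * indicator {\<rho>..} r * (?k * emeasure (leb d) ?B)" by (simp add: mult_ac)
    also have "\<dots> \<le> f r * ennreal ((sqrt (n * exp 1 / real d) * r) ^ d) * indicator {\<rho>..} r"
    proof (cases "\<rho> \<le> r")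
      case True
      then have "0 < r" using \<rho> by simp
      from mult_left_mono[OF emeasure_ball_le[OF n d this], of "f r"] show ?thesis using True by simp
    qed simp
    finally show "?k * (\<integral>\<^sup>+x. g (x, r) \<partial>leb d) \<le> f r * ennreal ((sqrt (n * exp 1 / real d) * r) ^ d) * indicator {\<rho>..} r" .
  qed
  finally show ?thesis .
qed

section \<open>Tails of radial integrals\<close>

lemma nn_integral_exp_atLeast:
  assumes "0 \<le> a" "0 < b"
  shows "(\<integral>\<^sup>+r. ennreal (a * exp (- (b * r))) * indicator {s..} r \<partial>lborel) = ennreal (a / b * exp (- (b * s)))"
proof -
  have "(\<integral>\<^sup>+r. ennreal (a * exp (- (b * r))) * indicator {s..} r \<partial>lborel) = ennreal (0 - (- (a / b) * exp (- (b * s))))"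
  proof (rule nn_integral_FTC_atLeast)
    show "((\<lambda>r. - (a / b) * exp (- (b * r))) has_real_derivative a * exp (- (b * r))) (at r)" for r
      using assms by (auto intro!: derivative_eq_intros)
    have "((\<lambda>r. - (a / b) * exp (- (b * r))) \<longlongrightarrow> - (a / b) * 0) at_top"
      by (intro tendsto_mult tendsto_const filterlim_compose[OF exp_at_bot] filterlim_compose[OF filterlim_uminus_at_bot_at_top]
            filterlim_tendsto_pos_mult_at_top[OF tendsto_const assms(2)] filterlim_ident)
    then show "((\<lambda>r. - (a / b) * exp (- (b * r))) \<longlongrightarrow> 0) at_top" by simp
  qed (use assms in auto)
  then show ?thesis by simp
qed

lemma nn_integral_powr_atLeast:
  assumes "0 < b" "0 \<le> s"
  shows "(\<integral>\<^sup>+r. ennreal (b * (1 + r) powr (- b - 1)) * indicator {s..} r \<partial>lborel) = ennreal ((1 + s) powr (- b))"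
proof -
  have "(\<integral>\<^sup>+r. ennreal (b * (1 + r) powr (- b - 1)) * indicator {s..} r \<partial>lborel) = ennreal (0 - (- ((1 + s) powr (- b))))"
  proof (rule nn_integral_FTC_atLeast)
    show "((\<lambda>r. - ((1 + r) powr (- b))) has_real_derivative b * (1 + r) powr (- b - 1)) (at r)" if "s \<le> r" for r
      using assms that by (auto intro!: derivative_eq_intros)
    have "((\<lambda>r. - ((1 + r) powr (- b))) \<longlongrightarrow> - 0) at_top"
      using assms by (intro tendsto_minus tendsto_neg_powr filterlim_tendsto_add_at_top[OF tendsto_const] filterlim_ident) auto
    then show "((\<lambda>r. - ((1 + r) powr (- b))) \<longlongrightarrow> 0) at_top" by simp
  qed (use assms in auto)
  then show ?thesis by simp
qed

text \<open>
  In the variable \<open>u = r (n / d)\<^sup>1\<^sup>/\<^sup>2 \<ge> 5/2\<close> the integrand is \<open>u\<^sup>d exp (- d u)\<close> up to constants. The tangent bound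
  \<open>u \<le> (5/2) exp (2 u / 5 - 1)\<close> at the endpoint leaves the factor \<open>((5/2) exp (- 2))\<^sup>d\<close>, which is below
  \<open>exp (- d)\<close> because \<open>5/2 < e\<close>.
\<close>

lemma outer_exp_bound:
  assumes n: "0 < n" and d: "1 \<le> d"
  defines "\<rho> \<equiv> 5/2 * sqrt (real d / n)"
  shows "ennreal (sqrt (n / (2 * pi)) ^ d) * (\<integral>\<^sup>+x. ennreal (exp (- (sqrt (n * real d) * vnorm d x))) * indicator {x \<in> Rd d. \<rho> \<le> vnorm d x} x \<partial>leb d)
     \<le> ennreal (5 / 3 * exp (- real d))"
proof -
  define c where "c = sqrt (n * real d)"
  have c: "0 < c" using n d by (simp add: c_def)
  have \<rho>: "0 < \<rho>" using n d by (simp add: \<rho>_def)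
  have "sqrt (n * real d) * sqrt (real d / n) = sqrt (real d * real d)"
    using n by (simp flip: real_sqrt_mult)
  then have c\<rho>: "c * \<rho> = 5/2 * real d" by (simp add: c_def \<rho>_def)
  define A :: real where "A = (5/2 * exp (- (1/2))) ^ d"
  have pt: "(sqrt (n * exp 1 / real d) * r) ^ d \<le> A * exp (2/5 * (c * r))" if "0 \<le> r" for r
  proof -
    define x where "x = r * sqrt (n / real d)"
    have "sqrt (real d) * sqrt (real d) = real d" by simp
    then have cx: "c * r = real d * x"
      using d n by (simp add: c_def x_def real_sqrt_mult real_sqrt_divide field_simps)
    have x0: "0 \<le> x" using that n by (simp add: x_def)
    have e: "exp (1/2) = sqrt (exp (1::real))" by (rule real_sqrt_unique[symmetric]) (auto simp: exp_double[symmetric])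
    have "1 + (2/5 * x - 1) \<le> exp (2/5 * x - 1)" by (rule exp_ge_add_one_self)
    then have "x \<le> 5/2 * exp (2/5 * x - 1)" by simp
    then have "exp (1/2) * x \<le> exp (1/2) * (5/2 * exp (2/5 * x - 1))" by (intro mult_left_mono) auto
    also have "\<dots> = 5/2 * exp (- (1/2)) * exp (2/5 * x)" by (simp add: exp_add[symmetric])
    finally have "(exp (1/2) * x) ^ d \<le> (5/2 * exp (- (1/2)) * exp (2/5 * x)) ^ d"
      using x0 by (intro power_mono) auto
    also have "\<dots> = A * exp (real d * (2/5 * x))" by (simp only: A_def power_mult_distrib exp_of_nat_mult)
    also have "real d * (2/5 * x) = 2/5 * (c * r)" by (simp add: cx)
    also have "exp (1/2) * x = sqrt (n * exp 1 / real d) * r" by (simp add: e x_def real_sqrt_mult real_sqrt_divide)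
    finally show ?thesis .
  qed
  have A: "0 \<le> A" by (simp add: A_def)
  have "ennreal (sqrt (n / (2 * pi)) ^ d) * (\<integral>\<^sup>+x. ennreal (exp (- (c * vnorm d x))) * indicator {x \<in> Rd d. \<rho> \<le> vnorm d x} x \<partial>leb d)
    \<le> (\<integral>\<^sup>+r. ennreal (c * exp (- (c * r))) * ennreal ((sqrt (n * exp 1 / real d) * r) ^ d) * indicator {\<rho>..} r \<partial>lborel)"
    using c by (intro layer_cake[OF n d \<rho>, where F="\<lambda>s. ennreal (exp (- (c * s)))"]) (auto simp: nn_integral_exp_atLeast)
  also have "\<dots> \<le> (\<integral>\<^sup>+r. ennreal (A * c * exp (- (3/5 * c * r))) * indicator {\<rho>..} r \<partial>lborel)"
  proof (rule nn_integral_mono)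
    fix r :: real
    have "c * exp (- (c * r)) * (sqrt (n * exp 1 / real d) * r) ^ d \<le> A * c * exp (- (3/5 * c * r))" if "\<rho> \<le> r"
    proof -
      have "c * exp (- (c * r)) * (sqrt (n * exp 1 / real d) * r) ^ d \<le> c * exp (- (c * r)) * (A * exp (2/5 * (c * r)))"
        using that \<rho> c by (intro mult_left_mono pt) auto
      also have "\<dots> = A * c * (exp (- (c * r)) * exp (2/5 * (c * r)))" by simp
      also have "exp (- (c * r)) * exp (2/5 * (c * r)) = exp (- (3/5 * c * r))" by (simp add: exp_add[symmetric])
      finally show ?thesis .
    qed
    then show "ennreal (c * exp (- (c * r))) * ennreal ((sqrt (n * exp 1 / real d) * r) ^ d) * indicator {\<rho>..} r
      \<le> ennreal (A * c * exp (- (3/5 * c * r))) * indicator {\<rho>..} r"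
      using c \<rho> n by (auto simp: indicator_def ennreal_mult[symmetric] intro!: ennreal_leI)
  qed
  also have "\<dots> = ennreal (A * c / (3/5 * c) * exp (- (3/5 * c * \<rho>)))"
    using A c by (intro nn_integral_exp_atLeast) auto
  also have "\<dots> \<le> ennreal (5 / 3 * exp (- real d))"
  proof (rule ennreal_leI)
    have "exp (- (3/5 * c * \<rho>)) = exp (- (3/2)) ^ d"
      using c\<rho> by (simp add: exp_of_nat_mult[symmetric] mult.assoc)
    then have "A * exp (- (3/5 * c * \<rho>)) = (5/2 * (exp (- (1/2)) * exp (- (3/2)))) ^ d"
      by (simp only: A_def power_mult_distrib mult.assoc)
    also have "exp (- (1/2)) * exp (- (3/2)) = exp (- 2 :: real)" by (simp add: mult_exp_exp)
    finally have "A * exp (- (3/5 * c * \<rho>)) = (5/2 * exp (- 2)) ^ d" .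
    also have "(5/2 * exp (- 2)) ^ d \<le> exp (- 1 :: real) ^ d"
    proof (rule power_mono)
      have "5/2 \<le> exp (1::real)" using exp_lower_Taylor_quadratic[of "1::real"] by simp
      then have "5/2 * exp (- 2) \<le> exp 1 * exp (- 2 :: real)" by (rule mult_right_mono) simp
      then show "5/2 * exp (- 2) \<le> exp (- 1 :: real)" by (simp add: mult_exp_exp)
    qed simp
    also have "\<dots> = exp (- real d)" by (simp add: exp_of_nat_mult[symmetric])
    finally show "A * c / (3/5 * c) * exp (- (3/5 * c * \<rho>)) \<le> 5 / 3 * exp (- real d)" using c by simp
  qed
  finally show ?thesis by (simp add: c_def)
qed

text \<open>The maximum over \<open>r\<close> of \<open>r\<^sup>d (1 + r)\<^sup>-\<^sup>q\<close> is attained at \<open>r = d / (q - d)\<close>.\<close>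

lemma power_le_powr_one_plus:
  assumes r: "0 < r" and d: "1 \<le> d" and q: "real d < q"
  shows "r ^ d \<le> (1 + r) powr q * (real d / q) ^ d * exp (- real d + real d ^ 2 / q)"
proof -
  define w where "w = r / (1 + r)"
  define p where "p = real d / q"
  have w: "0 < w" "w < 1" using r by (auto simp: w_def)
  have p: "0 < p" "p < 1" using d q by (auto simp: p_def)
  have q0: "0 < q" using d q by simp
  have w1: "1 - w = 1 / (1 + r)" using r by (simp add: w_def field_simps)
  have l1: "ln w - ln p \<le> w / p - 1" using ln_le_minus_one[of "w / p"] w p by (simp add: ln_div)
  have l2: "ln (1 - w) - ln (1 - p) \<le> (1 - w) / (1 - p) - 1" using ln_le_minus_one[of "(1 - w) / (1 - p)"] w p by (simp add: ln_div)
  have l3: "ln (1 - p) \<le> - p" using ln_le_minus_one[of "1 - p"] p by simp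
  have "real d * (ln w - ln p) \<le> real d * (w / p - 1)" using l1 by (rule mult_left_mono) simp
  also have "\<dots> = q * w - real d" using d q0 by (simp add: p_def field_simps)
  finally have m1: "real d * (ln w - ln p) \<le> q * w - real d" .
  have "(q - real d) * (ln (1 - w) - ln (1 - p)) \<le> (q - real d) * ((1 - w) / (1 - p) - 1)" using l2 q by (intro mult_left_mono) auto
  also have "\<dots> = q * (1 - w) - (q - real d)"
  proof -
    have "(q - real d) / (1 - p) = q" using q q0 by (simp add: p_def field_simps)
    then have "(q - real d) * ((1 - w) / (1 - p)) = q * (1 - w)"
      by (metis (no_types) times_divide_eq_left times_divide_eq_right mult.commute)
    then show ?thesis by (simp add: right_diff_distrib)
  qed
  finally have m2: "(q - real d) * (ln (1 - w) - ln (1 - p)) \<le> q * (1 - w) - (q - real d)" .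
  have m3: "(q - real d) * ln (1 - p) \<le> (q - real d) * (- p)" using l3 q by (intro mult_left_mono) auto
  have pp: "(q - real d) * (- p) = - real d + real d ^ 2 / q" using q0 by (simp add: p_def field_simps power2_eq_square)
  have "real d * ln w + (q - real d) * ln (1 - w) \<le> real d * ln p - real d + real d ^ 2 / q"
    using m1 m2 m3 unfolding pp by (simp add: algebra_simps)
  moreover have "ln w = ln r - ln (1 + r)" using r by (simp add: w_def ln_div)
  moreover have "ln (1 - w) = - ln (1 + r)" using r by (simp add: w1 ln_div)
  ultimately have "real d * ln r \<le> q * ln (1 + r) + real d * ln p + (- real d + real d ^ 2 / q)"
    by (simp add: algebra_simps)
  then have "exp (real d * ln r) \<le> exp (q * ln (1 + r) + real d * ln p + (- real d + real d ^ 2 / q))" by simp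
  also have "\<dots> = (1 + r) powr q * p ^ d * exp (- real d + real d ^ 2 / q)"
    using r p by (simp add: exp_add powr_def exp_of_nat_mult)
  also have "exp (real d * ln r) = r ^ d" using r by (simp add: exp_of_nat_mult)
  finally show ?thesis by (simp add: p_def)
qed

text \<open>
  Half of the exponent \<open>m\<close> is spent on dominating \<open>r\<^sup>d\<close>, the other half on integrability. The domination gains
  \<open>exp (- d)\<close>, which pays for the factor \<open>2\<^sup>d\<close> lost by halving.
\<close>

lemma outer_powr_bound:
  assumes n: "0 < n" and d: "1 \<le> d" and m: "10 * real d \<le> m" and \<rho>: "0 < \<rho>"
  shows "ennreal (sqrt (n / (2 * pi)) ^ d) * (\<integral>\<^sup>+x. ennreal ((1 + vnorm d x) powr (- m)) * indicator {x \<in> Rd d. \<rho> \<le> vnorm d x} x \<partial>leb d)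
     \<le> ennreal (2 * (exp 1 * n * real d / m\<^sup>2) powr (real d / 2))"
proof -
  have m0: "0 < m" using m d by simp
  define A where "A = (exp 1 * n * real d / m\<^sup>2) powr (real d / 2)"
  have pt: "(sqrt (n * exp 1 / real d) * r) ^ d \<le> A * (1 + r) powr (m / 2)" if "0 < r" for r
  proof -
    have "r ^ d \<le> (1 + r) powr (m / 2) * ((real d / (m / 2)) ^ d * exp (- real d + real d ^ 2 / (m / 2)))"
      using power_le_powr_one_plus[OF that d, of "m / 2"] m m0 d by (simp add: mult.assoc)
    also have "(real d / (m / 2)) ^ d * exp (- real d + real d ^ 2 / (m / 2)) = (real d / m * (2 * exp (- 1 + 2 * real d / m))) ^ d"
    proof -
      have "- real d + real d ^ 2 / (m / 2) = real d * (- 1 + 2 * real d / m)"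
        using m0 by (simp add: field_simps power2_eq_square)
      then have "(real d / (m / 2)) ^ d * exp (- real d + real d ^ 2 / (m / 2)) = ((real d / (m / 2)) * exp (- 1 + 2 * real d / m)) ^ d"
        by (simp only: exp_of_nat_mult power_mult_distrib)
      then show ?thesis by (simp add: mult_ac)
    qed
    finally have "r ^ d \<le> (1 + r) powr (m / 2) * (real d / m * (2 * exp (- 1 + 2 * real d / m))) ^ d" .
    also have "\<dots> \<le> (1 + r) powr (m / 2) * (real d / m * 1) ^ d"
    proof (intro mult_left_mono power_mono)
      have "2 * real d / m \<le> 1 / 5" using m m0 by (simp add: field_simps)
      then have "2 * exp (- 1 + 2 * real d / m) \<le> 2 * exp (- (4 / 5))" by simp
      also have "\<dots> \<le> 1"
      proof -
        have "2 \<le> exp (4/5 :: real)" using exp_lower_Taylor_quadratic[of "4/5 :: real"] by (simp add: power2_eq_square)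
        then show ?thesis by (simp add: exp_minus field_simps)
      qed
      finally show "2 * exp (- 1 + 2 * real d / m) \<le> 1" .
    qed (use m0 in auto)
    finally have "r ^ d \<le> (1 + r) powr (m / 2) * (real d / m) ^ d" by simp
    then have "sqrt (n * exp 1 / real d) ^ d * r ^ d \<le> sqrt (n * exp 1 / real d) ^ d * ((1 + r) powr (m / 2) * (real d / m) ^ d)"
      using n by (intro mult_left_mono) auto
    also have "\<dots> = (sqrt (n * exp 1 / real d) * (real d / m)) ^ d * (1 + r) powr (m / 2)" by (simp only: power_mult_distrib mult_ac)
    also have "sqrt (n * exp 1 / real d) * (real d / m) = sqrt (exp 1 * n * real d / m\<^sup>2)"
    proof -
      have "real d / m = sqrt ((real d / m)\<^sup>2)" using m0 by simp
      then have "sqrt (n * exp 1 / real d) * (real d / m) = sqrt (n * exp 1 / real d * (real d / m)\<^sup>2)" by (metis real_sqrt_mult)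
      also have "n * exp 1 / real d * (real d / m)\<^sup>2 = exp 1 * n * real d / m\<^sup>2" using d by (simp add: power2_eq_square)
      finally show ?thesis .
    qed
    also have "sqrt (exp 1 * n * real d / m\<^sup>2) ^ d = A"
    proof -
      have pos: "0 < exp 1 * n * real d / m\<^sup>2" using n d m0 by simp
      then have "sqrt (exp 1 * n * real d / m\<^sup>2) ^ d = sqrt (exp 1 * n * real d / m\<^sup>2) powr real d" by (simp add: powr_realpow)
      also have "\<dots> = A" unfolding A_def using pos by (simp add: powr_half_sqrt[symmetric] powr_powr)
      finally show ?thesis .
    qed
    finally show ?thesis by (simp add: power_mult_distrib)
  qed
  have A: "0 \<le> A" by (simp add: A_def)
  have "ennreal (sqrt (n / (2 * pi)) ^ d) * (\<integral>\<^sup>+x. ennreal ((1 + vnorm d x) powr (- m)) * indicator {x \<in> Rd d. \<rho> \<le> vnorm d x} x \<partial>leb d)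
    \<le> (\<integral>\<^sup>+r. ennreal (m * (1 + r) powr (- m - 1)) * ennreal ((sqrt (n * exp 1 / real d) * r) ^ d) * indicator {\<rho>..} r \<partial>lborel)"
    using m0 \<rho> by (intro layer_cake[OF n d \<rho>, where F="\<lambda>s. ennreal ((1 + s) powr (- m))"]) (auto simp: nn_integral_powr_atLeast)
  also have "\<dots> \<le> (\<integral>\<^sup>+r. ennreal (2 * A) * (ennreal (m / 2 * (1 + r) powr (- (m / 2) - 1)) * indicator {\<rho>..} r) \<partial>lborel)"
  proof (rule nn_integral_mono)
    fix r :: real
    have "m * (1 + r) powr (- m - 1) * (sqrt (n * exp 1 / real d) * r) ^ d \<le> 2 * A * (m / 2 * (1 + r) powr (- (m / 2) - 1))" if "\<rho> \<le> r"
    proof -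
      have "m * (1 + r) powr (- m - 1) * (sqrt (n * exp 1 / real d) * r) ^ d \<le> m * (1 + r) powr (- m - 1) * (A * (1 + r) powr (m / 2))"
        using that \<rho> m0 by (intro mult_left_mono pt) auto
      also have "\<dots> = m * A * ((1 + r) powr (- m - 1) * (1 + r) powr (m / 2))" by simp
      also have "(1 + r) powr (- m - 1) * (1 + r) powr (m / 2) = (1 + r) powr (- (m / 2) - 1)"
        by (simp add: powr_add[symmetric])
      finally show ?thesis by (simp add: mult_ac)
    qed
    then show "ennreal (m * (1 + r) powr (- m - 1)) * ennreal ((sqrt (n * exp 1 / real d) * r) ^ d) * indicator {\<rho>..} r
      \<le> ennreal (2 * A) * (ennreal (m / 2 * (1 + r) powr (- (m / 2) - 1)) * indicator {\<rho>..} r)"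
      using m0 \<rho> n A by (auto simp: indicator_def ennreal_mult[symmetric] intro!: ennreal_leI)
  qed
  also have "\<dots> = ennreal (2 * A) * ennreal ((1 + \<rho>) powr (- (m / 2)))"
    using m0 \<rho> by (subst nn_integral_cmult) (auto simp only: nn_integral_powr_atLeast[of "m / 2" \<rho>] intro: order_less_imp_le, auto)
  also have "\<dots> \<le> ennreal (2 * A) * ennreal 1"
    using m0 \<rho> by (intro mult_left_mono ennreal_leI) (auto simp: powr_minus inverse_le_1_iff ge_one_powr_ge_zero)
  finally show ?thesis by (simp add: A_def)
qed

section \<open>Derivatives of the logarithm of a characteristic function\<close>

text \<open>
  Dominated convergence is a statement about sequences, so derivatives of integrals are taken as limits of
  difference quotients.
\<close>

lemma has_vector_derivative_iff_quotient:
  fixes f :: "real \<Rightarrow> 'a::real_normed_vector"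
  shows "(f has_vector_derivative D) (at s) \<longleftrightarrow> ((\<lambda>y. (f y - f s) /\<^sub>R (y - s)) \<longlongrightarrow> D) (at s)"
proof -
  have "(f has_vector_derivative D) (at s) \<longleftrightarrow> ((\<lambda>y. norm ((f y - f s) - (y - s) *\<^sub>R D) / norm (y - s)) \<longlongrightarrow> 0) (at s)"
    by (simp add: has_vector_derivative_def has_derivative_iff_norm bounded_linear_scaleR_left)
  also have "\<dots> \<longleftrightarrow> ((\<lambda>y. norm ((f y - f s) /\<^sub>R (y - s) - D)) \<longlongrightarrow> 0) (at s)"
  proof (rule filterlim_cong[OF refl refl])
    show "\<forall>\<^sub>F y in at s. norm ((f y - f s) - (y - s) *\<^sub>R D) / norm (y - s) = norm ((f y - f s) /\<^sub>R (y - s) - D)"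
      unfolding eventually_at_filter
    proof (rule always_eventually, intro allI impI)
      fix y assume y: "y \<noteq> s"
      have "(f y - f s) /\<^sub>R (y - s) - D = ((f y - f s) - (y - s) *\<^sub>R D) /\<^sub>R (y - s)"
        using y by (simp add: scaleR_diff_right)
      then show "norm ((f y - f s) - (y - s) *\<^sub>R D) / norm (y - s) = norm ((f y - f s) /\<^sub>R (y - s) - D)"
        by (simp add: divide_inverse mult.commute)
    qed
  qed
  also have "\<dots> \<longleftrightarrow> ((\<lambda>y. (f y - f s) /\<^sub>R (y - s)) \<longlongrightarrow> D) (at s)"
    by (simp add: tendsto_norm_zero_iff LIM_zero_iff)
  finally show ?thesis .
qed

lemma norm_cis_diff_le: "cmod (cis a - cis b) \<le> \<bar>a - b\<bar>"
proof -
  have "cis a - cis b = cis b * (cis (a - b) - 1)" by (simp add: right_diff_distrib cis_mult)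
  then have "cmod (cis a - cis b) = cmod (cis (a - b) - 1)" by (simp add: norm_mult)
  also have "\<dots> \<le> \<bar>a - b\<bar>" using iexp_approx1[of "a - b" 0] by (simp add: cis_conv_exp)
  finally show ?thesis .
qed

definition unitv :: "nat \<Rightarrow> nat \<Rightarrow> real" where "unitv i = (\<lambda>j. if j = i then 1 else 0)"

text \<open>
  A random vector \<open>Y\<close> in \<open>\<real>\<^sup>d\<close> with four moments.
\<close>

locale charfun = prob_space M for M :: "'a measure" +
  fixes d :: nat and Y :: "nat \<Rightarrow> 'a \<Rightarrow> real"
  assumes Y_meas [measurable]: "\<And>i. i < d \<Longrightarrow> Y i \<in> borel_measurable M"
    and Y4: "integrable M (\<lambda>x. (1 + (\<Sum>i<d. \<bar>Y i x\<bar>)) ^ 4)"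
begin

definition S :: "'a \<Rightarrow> real" where "S x = 1 + (\<Sum>i<d. \<bar>Y i x\<bar>)"

lemma S_ge_1: "1 \<le> S x" by (simp add: S_def sum_nonneg)

lemma Y_le_S: "i < d \<Longrightarrow> \<bar>Y i x\<bar> \<le> S x"
  using member_le_sum[of i "{..<d}" "\<lambda>i. \<bar>Y i x\<bar>"] by (simp add: S_def)

lemma S_meas [measurable]: "S \<in> borel_measurable M" unfolding S_def by measurable

definition ip :: "(nat \<Rightarrow> real) \<Rightarrow> 'a \<Rightarrow> real" where "ip t x = (\<Sum>i<d. t i * Y i x)"

lemma ip_meas [measurable]: "ip t \<in> borel_measurable M" unfolding ip_def by measurable

lemma ip_le: "\<bar>ip t x\<bar> \<le> (\<Sum>i<d. \<bar>t i\<bar>) * S x"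
proof -
  have "\<bar>ip t x\<bar> \<le> (\<Sum>i<d. \<bar>t i\<bar> * \<bar>Y i x\<bar>)"
    unfolding ip_def by (rule order_trans[OF sum_abs]) (simp add: abs_mult)
  also have "\<dots> \<le> (\<Sum>i<d. \<bar>t i\<bar> * S x)" by (intro sum_mono mult_left_mono Y_le_S) auto
  finally show ?thesis by (simp add: sum_distrib_right)
qed

definition iu :: "(nat \<Rightarrow> real) \<Rightarrow> 'a \<Rightarrow> complex" where "iu u x = \<i> * of_real (ip u x)"

lemma iu_meas [measurable]: "iu u \<in> borel_measurable M" unfolding iu_def by measurable

text \<open>
  Growth of order \<open>k\<close> in \<open>Y\<close>; four orders are integrable, and differentiating an integral costs one.
\<close>

definition ord :: "nat \<Rightarrow> ('a \<Rightarrow> complex) \<Rightarrow> bool" where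
  "ord k q \<longleftrightarrow> q \<in> borel_measurable M \<and> (\<exists>C. \<forall>x. cmod (q x) \<le> C * S x ^ k)"

lemma ord_const: "ord 0 (\<lambda>_. c)" by (auto simp: ord_def)

lemma ord_iu_mult:
  assumes "ord k q" shows "ord (Suc k) (\<lambda>x. iu u x * q x)"
proof -
  have [measurable]: "q \<in> borel_measurable M" using assms by (simp add: ord_def)
  obtain C where C: "\<And>x. cmod (q x) \<le> C * S x ^ k" using assms by (auto simp: ord_def)
  have "cmod (iu u x * q x) \<le> ((\<Sum>i<d. \<bar>u i\<bar>) * C) * S x ^ Suc k" for x
  proof -
    have "cmod (iu u x * q x) \<le> ((\<Sum>i<d. \<bar>u i\<bar>) * S x) * (C * S x ^ k)"
      unfolding norm_mult using S_ge_1[of x]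
      by (intro mult_mono C) (auto simp: iu_def norm_mult ip_le sum_nonneg)
    then show ?thesis by (simp add: mult_ac)
  qed
  then show ?thesis unfolding ord_def by (intro conjI exI) auto
qed

lemma ord_iu: "ord 1 (iu u)"
  using ord_iu_mult[OF ord_const, of u 1] by simp

lemma ord_mono:
  assumes "ord k q" "k \<le> l" shows "ord l q"
proof -
  obtain C where C: "\<And>x. cmod (q x) \<le> C * S x ^ k" using assms by (auto simp: ord_def)
  have "cmod (q x) \<le> \<bar>C\<bar> * S x ^ l" for x
  proof -
    have "cmod (q x) \<le> C * S x ^ k" by (rule C)
    also have "\<dots> \<le> \<bar>C\<bar> * S x ^ l" using S_ge_1[of x] assms(2)
      by (intro mult_mono power_increasing) auto
    finally show ?thesis .
  qed
  then show ?thesis using assms unfolding ord_def by blast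
qed

lemma ord_integrable_S:
  assumes "ord 3 q" shows "integrable M (\<lambda>x. S x * cmod (q x))"
proof -
  have [measurable]: "q \<in> borel_measurable M" using assms by (simp add: ord_def)
  obtain C where C: "\<And>x. cmod (q x) \<le> C * S x ^ 3" using assms by (auto simp: ord_def)
  show ?thesis
  proof (rule Bochner_Integration.integrable_bound[of M "\<lambda>x. \<bar>C\<bar> * S x ^ 4"])
    show "integrable M (\<lambda>x. \<bar>C\<bar> * S x ^ 4)" using Y4 by (simp add: S_def)
    show "AE x in M. norm (S x * cmod (q x)) \<le> norm (\<bar>C\<bar> * S x ^ 4)"
    proof (rule AE_I2)
      fix x
      have "S x * cmod (q x) \<le> S x * (C * S x ^ 3)" using S_ge_1[of x] by (intro mult_left_mono C) auto
      also have "\<dots> \<le> \<bar>C\<bar> * S x ^ 4" using S_ge_1[of x] by (simp add: power_numeral_reduce mult_right_mono mult_ac)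
      finally show "norm (S x * cmod (q x)) \<le> norm (\<bar>C\<bar> * S x ^ 4)" using S_ge_1[of x] by simp
    qed
  qed simp
qed

lemma ord_integrable:
  assumes "ord 4 q" shows "integrable M q"
proof -
  have [measurable]: "q \<in> borel_measurable M" using assms by (simp add: ord_def)
  obtain C where C: "\<And>x. cmod (q x) \<le> C * S x ^ 4" using assms by (auto simp: ord_def)
  show ?thesis
  proof (rule Bochner_Integration.integrable_bound[of M "\<lambda>x. C * S x ^ 4"])
    show "integrable M (\<lambda>x. C * S x ^ 4)" using Y4 by (simp add: S_def)
    show "AE x in M. norm (q x) \<le> norm (C * S x ^ 4)" using C by (intro AE_I2) (smt (verit) real_norm_def)
  qed simp
qed

text \<open>
  The expectation of \<open>q exp (i t \<bullet> Y)\<close>. All derivatives of the characteristic function have this form.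
\<close>

definition G :: "('a \<Rightarrow> complex) \<Rightarrow> (nat \<Rightarrow> real) \<Rightarrow> complex" where
  "G q t = (\<integral>x. q x * cis (ip t x) \<partial>M)"

lemma integrable_G:
  assumes "ord 4 q" shows "integrable M (\<lambda>x. q x * cis (ip t x))"
proof -
  have [measurable]: "q \<in> borel_measurable M" using assms by (simp add: ord_def)
  show ?thesis
    by (rule Bochner_Integration.integrable_bound[OF ord_integrable[OF assms]]) (auto simp: norm_mult cis_conv_exp)
qed

text \<open>
  The derivative is taken along an arbitrary differentiable curve, since rays, coordinate lines and circles are
  all needed. Along a sequence the difference quotients of the curve are bounded, which gives the dominating
  function.
\<close>

lemma G_deriv:
  assumes q: "ord 3 q" and p: "\<And>i. i < d \<Longrightarrow> ((\<lambda>s. p s i) has_real_derivative p' i) (at s)"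
  shows "((\<lambda>s. G q (p s)) has_vector_derivative G (\<lambda>x. iu p' x * q x) (p s)) (at s)"
  unfolding has_vector_derivative_iff_quotient tendsto_at_iff_sequentially
proof (intro allI impI, unfold comp_def)
  fix X :: "nat \<Rightarrow> real" assume X: "\<forall>k. X k \<in> UNIV - {s}" "X \<longlonglongrightarrow> s"
  have qm[measurable]: "q \<in> borel_measurable M" using q by (simp add: ord_def)
  have q4: "ord 4 q" by (rule ord_mono[OF q]) simp
  have Xs: "X k \<noteq> s" for k using X by auto
  have quot: "(\<lambda>k. (p (X k) i - p s i) / (X k - s)) \<longlonglongrightarrow> p' i" if "i < d" for i
  proof -
    have "((\<lambda>s. p s i) has_vector_derivative p' i) (at s)"
      using p[OF that] by (simp add: has_real_derivative_iff_has_vector_derivative)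
    then show ?thesis using X
      unfolding has_vector_derivative_iff_quotient tendsto_at_iff_sequentially comp_def
      by (auto simp: divide_inverse mult.commute)
  qed
  have "\<forall>i. \<exists>B. i < d \<longrightarrow> (\<forall>k. \<bar>(p (X k) i - p s i) / (X k - s)\<bar> \<le> B)"
  proof
    fix i
    show "\<exists>B. i < d \<longrightarrow> (\<forall>k. \<bar>(p (X k) i - p s i) / (X k - s)\<bar> \<le> B)"
    proof (cases "i < d")
      case True
      from convergent_imp_Bseq[OF convergentI[OF quot[OF True]]] show ?thesis
        by (auto simp: Bseq_def)
    qed simp
  qed
  then obtain B where B: "\<And>i k. i < d \<Longrightarrow> \<bar>(p (X k) i - p s i) / (X k - s)\<bar> \<le> B i" by metis
  define b where "b = (\<Sum>i<d. B i)"
  have bB: "(\<Sum>i<d. \<bar>(p (X k) i - p s i) / (X k - s)\<bar>) \<le> b" for k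
    unfolding b_def by (intro sum_mono B) auto
  define h where "h = (\<lambda>k x. (q x * (cis (ip (p (X k)) x) - cis (ip (p s) x))) /\<^sub>R (X k - s))"
  have "(\<lambda>k. \<integral>x. h k x \<partial>M) \<longlonglongrightarrow> (\<integral>x. iu p' x * q x * cis (ip (p s) x) \<partial>M)"
  proof (rule integral_dominated_convergence[where w = "\<lambda>x. b * (S x * cmod (q x))"])
    show "(\<lambda>x. iu p' x * q x * cis (ip (p s) x)) \<in> borel_measurable M"
      unfolding cis_conv_exp by measurable
    show "h k \<in> borel_measurable M" for k unfolding h_def cis_conv_exp by measurable
    show "integrable M (\<lambda>x. b * (S x * cmod (q x)))" using ord_integrable_S[OF q] by simp
    show "AE x in M. (\<lambda>k. h k x) \<longlonglongrightarrow> iu p' x * q x * cis (ip (p s) x)"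
    proof (rule AE_I2)
      fix x
      have "((\<lambda>s. ip (p s) x) has_real_derivative ip p' x) (at s)"
        unfolding ip_def using p by (auto intro!: derivative_eq_intros)
      then have "((\<lambda>s. \<i> * of_real (ip (p s) x)) has_vector_derivative (\<i> * of_real (ip p' x))) (at s)"
        by (intro has_vector_derivative_mult_right has_vector_derivative_of_real)
      from field_vector_diff_chain_at[OF this DERIV_exp]
      have "((\<lambda>s. cis (ip (p s) x)) has_vector_derivative (ip p' x *\<^sub>R (\<i> * cis (ip (p s) x)))) (at s)"
        by (simp add: cis_conv_exp comp_def scaleR_conv_of_real mult_ac)
      then have "(\<lambda>k. (cis (ip (p (X k)) x) - cis (ip (p s) x)) /\<^sub>R (X k - s)) \<longlonglongrightarrow> ip p' x *\<^sub>R (\<i> * cis (ip (p s) x))"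
        using X unfolding has_vector_derivative_iff_quotient tendsto_at_iff_sequentially comp_def by auto
      then have "(\<lambda>k. q x * ((cis (ip (p (X k)) x) - cis (ip (p s) x)) /\<^sub>R (X k - s))) \<longlonglongrightarrow> q x * (ip p' x *\<^sub>R (\<i> * cis (ip (p s) x)))"
        by (intro tendsto_mult tendsto_const)
      then show "(\<lambda>k. h k x) \<longlonglongrightarrow> iu p' x * q x * cis (ip (p s) x)"
        by (simp add: h_def iu_def scaleR_conv_of_real mult_ac)
    qed
    show "AE x in M. norm (h k x) \<le> b * (S x * cmod (q x))" for k
    proof (rule AE_I2)
      fix x
      have "norm (h k x) = cmod (q x) * (cmod (cis (ip (p (X k)) x) - cis (ip (p s) x)) / \<bar>X k - s\<bar>)"
        by (simp add: h_def norm_mult divide_inverse)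
      also have "\<dots> \<le> cmod (q x) * (\<bar>ip (p (X k)) x - ip (p s) x\<bar> / \<bar>X k - s\<bar>)"
        by (intro mult_left_mono divide_right_mono norm_cis_diff_le) auto
      also have "\<bar>ip (p (X k)) x - ip (p s) x\<bar> / \<bar>X k - s\<bar> = \<bar>ip (\<lambda>i. (p (X k) i - p s i) / (X k - s)) x\<bar>"
      proof -
        have "(ip (p (X k)) x - ip (p s) x) / (X k - s) = ip (\<lambda>i. (p (X k) i - p s i) / (X k - s)) x"
          by (simp add: ip_def sum_subtractf[symmetric] sum_divide_distrib left_diff_distrib)
        then show ?thesis by (simp flip: abs_divide)
      qed
      also have "cmod (q x) * \<bar>ip (\<lambda>i. (p (X k) i - p s i) / (X k - s)) x\<bar> \<le> cmod (q x) * (b * S x)"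
      proof (rule mult_left_mono)
        show "\<bar>ip (\<lambda>i. (p (X k) i - p s i) / (X k - s)) x\<bar> \<le> b * S x"
          using S_ge_1[of x] by (intro order_trans[OF ip_le] mult_right_mono bB) auto
      qed simp
      finally show "norm (h k x) \<le> b * (S x * cmod (q x))" by (simp add: mult_ac)
    qed
  qed
  moreover have "(\<integral>x. h k x \<partial>M) = (G q (p (X k)) - G q (p s)) /\<^sub>R (X k - s)" for k
    unfolding h_def G_def by (subst Bochner_Integration.integral_diff[symmetric]) (auto simp: integrable_G[OF q4] right_diff_distrib)
  ultimately show "(\<lambda>k. (G q (p (X k)) - G q (p s)) /\<^sub>R (X k - s)) \<longlonglongrightarrow> G (\<lambda>x. iu p' x * q x) (p s)"
    by (simp add: G_def)
qed

definition chi :: "(nat \<Rightarrow> real) \<Rightarrow> complex" where "chi t = G (\<lambda>_. 1) t"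

text \<open>
  Expectation with respect to the complex measure with density \<open>exp (i t \<bullet> Y)\<close>, normalized.
\<close>

definition T :: "('a \<Rightarrow> complex) \<Rightarrow> (nat \<Rightarrow> real) \<Rightarrow> complex" where "T q t = G q t / chi t"

text \<open>
  The derivative of the normalized expectation of \<open>q\<close> in the direction \<open>w\<close>: a covariance with \<open>i w \<bullet> Y\<close>.
\<close>

definition D :: "(nat \<Rightarrow> real) \<Rightarrow> ('a \<Rightarrow> complex) \<Rightarrow> (nat \<Rightarrow> real) \<Rightarrow> complex" where
  "D w q t = T (\<lambda>x. iu w x * q x) t - T (iu w) t * T q t"

lemma T_deriv:
  assumes q: "ord 3 q" and p: "\<And>i. i < d \<Longrightarrow> ((\<lambda>s. p s i) has_real_derivative p' i) (at s)"
    and nz: "chi (p s) \<noteq> 0"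
  shows "((\<lambda>s. T q (p s)) has_vector_derivative D p' q (p s)) (at s)"
proof -
  have 1: "((\<lambda>s. G q (p s)) has_vector_derivative G (\<lambda>x. iu p' x * q x) (p s)) (at s)" by (rule G_deriv[OF q p])
  have 2: "((\<lambda>s. chi (p s)) has_vector_derivative G (iu p') (p s)) (at s)"
    using G_deriv[OF ord_mono[OF ord_const, of 3 1] p] by (simp add: chi_def)
  have 3: "((inverse \<circ> (\<lambda>s. chi (p s))) has_vector_derivative (G (iu p') (p s) * - (inverse (chi (p s)) ^ 2))) (at s)"
    using nz DERIV_inverse[OF nz] by (intro field_vector_diff_chain_at[OF 2]) (simp add: numeral_2_eq_2)
  have "((\<lambda>s. G q (p s) * inverse (chi (p s))) has_vector_derivative
      (G q (p s) * (G (iu p') (p s) * - (inverse (chi (p s)) ^ 2)) + G (\<lambda>x. iu p' x * q x) (p s) * inverse (chi (p s)))) (at s)"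
    by (rule has_vector_derivative_mult[OF 1 3[unfolded comp_def]])
  then show ?thesis
    by (simp add: T_def D_def divide_inverse power2_eq_square algebra_simps)
qed

abbreviation m1 :: "(nat \<Rightarrow> real) \<Rightarrow> (nat \<Rightarrow> real) \<Rightarrow> complex" where "m1 u \<equiv> T (iu u)"
abbreviation iu2 :: "(nat \<Rightarrow> real) \<Rightarrow> (nat \<Rightarrow> real) \<Rightarrow> 'a \<Rightarrow> complex" where "iu2 u v \<equiv> (\<lambda>x. iu u x * iu v x)"
abbreviation iu3 :: "(nat \<Rightarrow> real) \<Rightarrow> (nat \<Rightarrow> real) \<Rightarrow> (nat \<Rightarrow> real) \<Rightarrow> 'a \<Rightarrow> complex" where
  "iu3 w u v \<equiv> (\<lambda>x. iu w x * (iu u x * iu v x))"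

text \<open>
  The joint cumulants of \<open>i w \<bullet> Y\<close>, \<open>i u \<bullet> Y\<close>, \<open>\<dots>\<close> under the complex tilt, that is, the directional
  derivatives of \<open>log \<chi>\<close>. The fourth one is left in the form in which the product rule produces it.
\<close>

definition K2 where "K2 u v t = D u (iu v) t"

definition K3 where "K3 w u v t = T (iu3 w u v) t - m1 w t * T (iu2 u v) t - T (iu2 w u) t * m1 v t
    - m1 u t * T (iu2 w v) t + 2 * (m1 w t * m1 u t * m1 v t)"

definition K4 where "K4 z w u v t = D z (iu3 w u v) t - (D z (iu w) t * T (iu2 u v) t + m1 w t * D z (iu2 u v) t)
    - (D z (iu2 w u) t * m1 v t + T (iu2 w u) t * D z (iu v) t)
    - (D z (iu u) t * T (iu2 w v) t + m1 u t * D z (iu2 w v) t)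
    + 2 * (D z (iu w) t * m1 u t * m1 v t + m1 w t * D z (iu u) t * m1 v t + m1 w t * m1 u t * D z (iu v) t)"

lemma ord_iu' [simp, intro]: "1 \<le> k \<Longrightarrow> ord k (iu u)" using ord_mono[OF ord_iu] .
lemma ord_iu2 [simp, intro]: "2 \<le> k \<Longrightarrow> ord k (iu2 u v)"
  using ord_mono[OF ord_iu_mult[OF ord_iu]] by (simp add: numeral_2_eq_2)
lemma ord_iu3 [simp, intro]: "3 \<le> k \<Longrightarrow> ord k (iu3 w u v)"
  using ord_mono[OF ord_iu_mult[OF ord_iu_mult[OF ord_iu]]] by (simp add: numeral_3_eq_3)

context
  fixes p :: "real \<Rightarrow> nat \<Rightarrow> real" and z s
  assumes p: "\<And>i. i < d \<Longrightarrow> ((\<lambda>s. p s i) has_real_derivative z i) (at s)"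
    and nz: "chi (p s) \<noteq> 0"
begin

lemma K1_deriv: "((\<lambda>s. m1 u (p s)) has_vector_derivative K2 z u (p s)) (at s)"
  unfolding K2_def by (rule T_deriv[OF _ p nz]) auto

lemma K2_deriv: "((\<lambda>s. K2 u v (p s)) has_vector_derivative K3 z u v (p s)) (at s)"
proof -
  have K2: "K2 u v t = T (iu2 u v) t - m1 u t * m1 v t" for t by (simp add: K2_def D_def)
  have 1: "((\<lambda>s. m1 w (p s)) has_vector_derivative D z (iu w) (p s)) (at s)" for w
    by (rule T_deriv[OF _ p nz]) auto
  have 2: "((\<lambda>s. T (iu2 u v) (p s)) has_vector_derivative D z (iu2 u v) (p s)) (at s)"
    by (rule T_deriv[OF _ p nz]) auto
  have "((\<lambda>s. T (iu2 u v) (p s) - m1 u (p s) * m1 v (p s)) has_vector_derivative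
     (D z (iu2 u v) (p s) - (m1 u (p s) * D z (iu v) (p s) + D z (iu u) (p s) * m1 v (p s)))) (at s)"
    by (intro has_vector_derivative_diff has_vector_derivative_mult 1 2)
  then show ?thesis unfolding K2[abs_def] by (simp add: K3_def D_def algebra_simps)
qed

lemma K3_deriv: "((\<lambda>s. K3 w u v (p s)) has_vector_derivative K4 z w u v (p s)) (at s)"
proof -
  have 1: "((\<lambda>s. m1 w (p s)) has_vector_derivative D z (iu w) (p s)) (at s)" for w
    by (rule T_deriv[OF _ p nz]) auto
  have 2: "((\<lambda>s. T (iu2 u v) (p s)) has_vector_derivative D z (iu2 u v) (p s)) (at s)" for u v
    by (rule T_deriv[OF _ p nz]) auto
  have 3: "((\<lambda>s. T (iu3 w u v) (p s)) has_vector_derivative D z (iu3 w u v) (p s)) (at s)"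
    by (rule T_deriv[OF _ p nz]) auto
  have "((\<lambda>s. K3 w u v (p s)) has_vector_derivative
     (D z (iu3 w u v) (p s) - (m1 w (p s) * D z (iu2 u v) (p s) + D z (iu w) (p s) * T (iu2 u v) (p s))
      - (T (iu2 w u) (p s) * D z (iu v) (p s) + D z (iu2 w u) (p s) * m1 v (p s))
      - (m1 u (p s) * D z (iu2 w v) (p s) + D z (iu u) (p s) * T (iu2 w v) (p s))
      + 2 * (m1 w (p s) * m1 u (p s) * D z (iu v) (p s) + (m1 w (p s) * D z (iu u) (p s) + D z (iu w) (p s) * m1 u (p s)) * m1 v (p s)))) (at s)"
    unfolding K3_def by (intro has_vector_derivative_diff has_vector_derivative_add has_vector_derivative_mult has_vector_derivative_mult_right 1 2 3)
  then show ?thesis by (simp add: K4_def algebra_simps)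
qed

end

end

section \<open>Multilinear forms and tensors\<close>

text \<open>
  Linearity in the first \<open>d\<close> coordinates, stated as the expansion in the unit vectors because that is the form in
  which a tensor is evaluated.
\<close>

definition mlin :: "nat \<Rightarrow> ((nat \<Rightarrow> real) \<Rightarrow> 'a::real_vector) \<Rightarrow> bool" where
  "mlin d f \<longleftrightarrow> (\<forall>u. f u = (\<Sum>i<d. u i *\<^sub>R f (unitv i)))"

lemma mlinD: "mlin d f \<Longrightarrow> f u = (\<Sum>i<d. u i *\<^sub>R f (unitv i))" unfolding mlin_def by blast

lemma mlin_add: "mlin d f \<Longrightarrow> mlin d g \<Longrightarrow> mlin d (\<lambda>u. f u + g u)"
  unfolding mlin_def[of d "\<lambda>u. f u + g u"]
proof
  fix u assume "mlin d f" "mlin d g"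
  from mlinD[OF this(1), of u] mlinD[OF this(2), of u]
  show "f u + g u = (\<Sum>i<d. u i *\<^sub>R (f (unitv i) + g (unitv i)))"
    by (simp only: scaleR_add_right sum.distrib)
qed

lemma mlin_diff: "mlin d f \<Longrightarrow> mlin d g \<Longrightarrow> mlin d (\<lambda>u. f u - g u)"
  unfolding mlin_def[of d "\<lambda>u. f u - g u"]
proof
  fix u assume "mlin d f" "mlin d g"
  from mlinD[OF this(1), of u] mlinD[OF this(2), of u]
  show "f u - g u = (\<Sum>i<d. u i *\<^sub>R (f (unitv i) - g (unitv i)))"
    by (simp only: scaleR_diff_right sum_subtractf)
qed

lemma mlin_linear:
  assumes h: "linear h" and f: "mlin d f" shows "mlin d (\<lambda>u. h (f u))"
  unfolding mlin_def
proof
  fix u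
  have "h (f u) = h (\<Sum>i<d. u i *\<^sub>R f (unitv i))" using mlinD[OF f, of u] by simp
  also have "\<dots> = (\<Sum>i<d. u i *\<^sub>R h (f (unitv i)))" by (simp add: linear_sum[OF h] linear_cmul[OF h])
  finally show "h (f u) = (\<Sum>i<d. u i *\<^sub>R h (f (unitv i)))" .
qed

lemma mlin_mult: "mlin d f \<Longrightarrow> mlin d (\<lambda>u. c * f u :: complex)" "mlin d f \<Longrightarrow> mlin d (\<lambda>u. f u * c :: complex)"
  by (auto intro!: mlin_linear[where h = "\<lambda>x. c * x"] mlin_linear[where h = "\<lambda>x. x * c"]
      bounded_linear.linear[OF bounded_linear_mult_right] bounded_linear.linear[OF bounded_linear_mult_left])

lemma mlin_Re_Im: "mlin d f \<Longrightarrow> mlin d (\<lambda>u. Re (f u))" "mlin d f \<Longrightarrow> mlin d (\<lambda>u. Im (f u))"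
  by (auto intro!: mlin_linear[where h = Re] mlin_linear[where h = Im]
      bounded_linear.linear[OF bounded_linear_Re] bounded_linear.linear[OF bounded_linear_Im])

lemma mlin_cong:
  assumes f: "mlin d f" and "\<And>i. i < d \<Longrightarrow> u i = v i" shows "f u = f v"
  using assms(2) by (simp add: mlinD[OF f, of u] mlinD[OF f, of v])

lemma mlin_scale: assumes f: "mlin d f" shows "f (\<lambda>i. a * u i) = a *\<^sub>R f u"
  by (simp add: mlinD[OF f, of "\<lambda>i. a * u i"] mlinD[OF f, of u] scaleR_sum_right)

text \<open>
  The operator norm only tests unit vectors; homogeneity extends a bound to all vectors.
\<close>

lemma mlin_bound:
  fixes f :: "(nat \<Rightarrow> real) \<Rightarrow> real"
  assumes f: "mlin d f" and b: "\<And>u. u \<in> Rd d \<Longrightarrow> vnorm d u = 1 \<Longrightarrow> \<bar>f u\<bar> \<le> c"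
  shows "\<bar>f u\<bar> \<le> c * vnorm d u"
proof (cases "vnorm d u = 0")
  case True
  then have "u i = 0" if "i < d" for i using that by (auto simp: L2_set_def sum_nonneg_eq_0_iff)
  then have "f u = 0" by (simp add: mlinD[OF f, of u])
  then show ?thesis using True by simp
next
  case False
  then have p: "0 < vnorm d u" using vnorm_nonneg[of u d] by linarith
  define v where "v = (\<lambda>i\<in>{..<d}. (1 / vnorm d u) * u i)"
  have "(vnorm d v)\<^sup>2 = dot d u u / (vnorm d u)\<^sup>2"
    unfolding vnorm_sq[of v d] by (simp add: v_def sum_divide_distrib power2_eq_square)
  also have "\<dots> = 1" using p by (simp add: vnorm_sq[of u d, symmetric])
  finally have "(vnorm d v)\<^sup>2 = 1" .
  then have "vnorm d v = 1" using vnorm_nonneg[of v d] by (auto simp: power2_eq_1_iff)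
  then have "\<bar>f v\<bar> \<le> c" by (intro b) (auto simp: v_def)
  moreover have "f v = (1 / vnorm d u) *\<^sub>R f u"
    using mlin_cong[OF f, of v "\<lambda>i. (1 / vnorm d u) * u i"] mlin_scale[OF f, of "1 / vnorm d u" u] by (simp add: v_def)
  ultimately show ?thesis using p by (simp add: abs_mult field_simps)
qed

lemma sum_index_lists_Suc:
  fixes d :: nat and g :: "nat list \<Rightarrow> real"
  shows
  "(\<Sum>is | set is \<subseteq> {..<d} \<and> length is = Suc k. g is) = (\<Sum>i<d. \<Sum>is | set is \<subseteq> {..<d} \<and> length is = k. g (i # is))"
proof -
  let ?L = "\<lambda>k. {is. set is \<subseteq> {..<d} \<and> length is = k}"
  have fin: "finite (?L k)" for k by (rule finite_lists_length_eq) simp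
  have eq: "?L (Suc k) = (\<lambda>(i, is). i # is) ` ({..<d} \<times> ?L k)"
    by (auto simp: length_Suc_conv image_iff)
  have "(\<Sum>is\<in>?L (Suc k). g is) = (\<Sum>(i, is)\<in>{..<d} \<times> ?L k. g (i # is))"
    unfolding eq by (subst sum.reindex) (auto simp: inj_on_def split_beta')
  also have "\<dots> = (\<Sum>i<d. \<Sum>is\<in>?L k. g (i # is))" by (rule sum.cartesian_product[symmetric])
  finally show ?thesis .
qed

lemma sum_index_lists_0: "(\<Sum>is | set is \<subseteq> {..<d} \<and> length is = 0. g is) = g []"
proof -
  have "{is. set is \<subseteq> {..<d} \<and> length is = 0} = {[]}" by auto
  then show ?thesis by simp
qed

lemma tensor_apply_multilinear_3:
  assumes N: "\<And>i j k. i < d \<Longrightarrow> j < d \<Longrightarrow> k < d \<Longrightarrow> N [i, j, k] = f (unitv i) (unitv j) (unitv k)"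
    and l: "\<And>b c. mlin d (\<lambda>a. f a b c)" "\<And>a c. mlin d (\<lambda>b. f a b c)" "\<And>a b. mlin d (\<lambda>c. f a b c)"
  shows "tensor_apply d 3 N u = f (u 0) (u 1) (u 2)"
proof -
  have "tensor_apply d 3 N u = (\<Sum>i<d. \<Sum>j<d. \<Sum>k<d. N [i, j, k] * (u 0 i * u 1 j * u 2 k))"
    unfolding tensor_apply_def
    by (simp add: eval_nat_numeral sum_index_lists_Suc sum_index_lists_0[simplified] mult_ac)
  also have "\<dots> = (\<Sum>i<d. u 0 i * (\<Sum>j<d. u 1 j * (\<Sum>k<d. u 2 k * f (unitv i) (unitv j) (unitv k))))"
    unfolding sum_distrib_left by (intro sum.cong refl) (simp add: N)
  also have "\<dots> = f (u 0) (u 1) (u 2)"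
  proof -
    have k: "(\<Sum>k<d. u 2 k * f a b (unitv k)) = f a b (u 2)" for a b
      using mlinD[OF l(3)[of a b], of "u 2"] by simp
    have j: "(\<Sum>k<d. u 1 k * f a (unitv k) c) = f a (u 1) c" for a c
      using mlinD[OF l(2)[of a c], of "u 1"] by simp
    have i: "(\<Sum>k<d. u 0 k * f (unitv k) b c) = f (u 0) b c" for b c
      using mlinD[OF l(1)[of b c], of "u 0"] by simp
    show ?thesis by (simp only: i j k)
  qed
  finally show ?thesis .
qed

lemma tensor_apply_multilinear_4:
  assumes N: "\<And>h i j k. h < d \<Longrightarrow> i < d \<Longrightarrow> j < d \<Longrightarrow> k < d \<Longrightarrow> N [h, i, j, k] = f (unitv h) (unitv i) (unitv j) (unitv k)"
    and l: "\<And>a b c. mlin d (\<lambda>z. f z a b c)" "\<And>z b c. mlin d (\<lambda>a. f z a b c)" "\<And>z a c. mlin d (\<lambda>b. f z a b c)" "\<And>z a b. mlin d (\<lambda>c. f z a b c)"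
  shows "tensor_apply d 4 N u = f (u 0) (u 1) (u 2) (u 3)"
proof -
  have "tensor_apply d 4 N u = (\<Sum>h<d. \<Sum>i<d. \<Sum>j<d. \<Sum>k<d. N [h, i, j, k] * (u 0 h * u 1 i * u 2 j * u 3 k))"
    unfolding tensor_apply_def
    by (simp add: eval_nat_numeral sum_index_lists_Suc sum_index_lists_0[simplified] mult_ac)
  also have "\<dots> = (\<Sum>h<d. u 0 h * (\<Sum>i<d. u 1 i * (\<Sum>j<d. u 2 j * (\<Sum>k<d. u 3 k * f (unitv h) (unitv i) (unitv j) (unitv k)))))"
    unfolding sum_distrib_left by (intro sum.cong refl) (simp add: N)
  also have "\<dots> = f (u 0) (u 1) (u 2) (u 3)"
  proof -
    have k: "(\<Sum>k<d. u 3 k * f z a b (unitv k)) = f z a b (u 3)" for z a b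
      using mlinD[OF l(4)[of z a b], of "u 3"] by simp
    have j: "(\<Sum>k<d. u 2 k * f z a (unitv k) c) = f z a (u 2) c" for z a c
      using mlinD[OF l(3)[of z a c], of "u 2"] by simp
    have i: "(\<Sum>k<d. u 1 k * f z (unitv k) b c) = f z (u 1) b c" for z b c
      using mlinD[OF l(2)[of z b c], of "u 1"] by simp
    have h: "(\<Sum>k<d. u 0 k * f (unitv k) a b c) = f (u 0) a b c" for a b c
      using mlinD[OF l(1)[of a b c], of "u 0"] by simp
    show ?thesis by (simp only: h i j k)
  qed
  finally show ?thesis .
qed

context charfun
begin

lemma ip_cong: "(\<And>i. i < d \<Longrightarrow> t i = t' i) \<Longrightarrow> ip t x = ip t' x" by (simp add: ip_def)

lemma T_cong: "(\<And>i. i < d \<Longrightarrow> t i = t' i) \<Longrightarrow> T q t = T q t'"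
  by (simp add: T_def chi_def G_def ip_cong[of t t'])

lemma chi_cong: "(\<And>i. i < d \<Longrightarrow> t i = t' i) \<Longrightarrow> chi t = chi t'"
  by (simp add: chi_def G_def ip_cong[of t t'])

lemma chi_0: "(\<And>i. i < d \<Longrightarrow> t i = 0) \<Longrightarrow> chi t = 1"
  by (simp add: chi_def G_def ip_def prob_space)

lemma T_0: "(\<And>i. i < d \<Longrightarrow> t i = 0) \<Longrightarrow> T q t = (\<integral>x. q x \<partial>M)"
  by (simp add: T_def chi_0) (simp add: G_def ip_def)

lemma chi_uminus: "chi (\<lambda>i. - t i) = cnj (chi t)"
  using Bochner_Integration.integral_cnj[of M "\<lambda>x. cis (ip t x)"]
  by (simp add: chi_def G_def ip_def sum_negf cis_cnj)

lemma ip_unitv: "i < d \<Longrightarrow> ip (unitv i) x = Y i x"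
  by (simp add: ip_def unitv_def if_distrib[of "\<lambda>x. x * _"] cong: if_cong)

lemma iu_expand: "iu u x = (\<Sum>i<d. of_real (u i) * iu (unitv i) x)"
proof -
  have "ip u x = (\<Sum>i<d. u i * ip (unitv i) x)" by (simp add: ip_unitv) (simp add: ip_def)
  then show ?thesis by (simp add: iu_def sum_distrib_left mult_ac)
qed

lemma mlin_T:
  assumes "ord 3 q"
  shows "mlin d (\<lambda>u. T (\<lambda>x. iu u x * q x) t)"
  unfolding mlin_def
proof
  fix u
  have o: "ord 4 (\<lambda>x. iu v x * q x)" for v using ord_iu_mult[OF assms] by simp
  have "G (\<lambda>x. iu u x * q x) t = (\<integral>x. (\<Sum>i<d. of_real (u i) * (iu (unitv i) x * q x * cis (ip t x))) \<partial>M)"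
    unfolding G_def by (subst iu_expand[of u]) (simp only: sum_distrib_right mult.assoc)
  also have "\<dots> = (\<Sum>i<d. of_real (u i) * G (\<lambda>x. iu (unitv i) x * q x) t)"
    unfolding G_def using integrable_G[OF o] by (subst Bochner_Integration.integral_sum) auto
  finally show "T (\<lambda>x. iu u x * q x) t = (\<Sum>i<d. u i *\<^sub>R T (\<lambda>x. iu (unitv i) x * q x) t)"
    by (simp add: T_def sum_divide_distrib scaleR_conv_of_real)
qed

lemma mlin_m1: "mlin d (\<lambda>u. m1 u t)"
  using mlin_T[OF ord_mono[OF ord_const, of 3 1]] by simp

lemma mlin_m2: "mlin d (\<lambda>u. T (iu2 u v) t)" "mlin d (\<lambda>v. T (iu2 u v) t)"
proof -
  show "mlin d (\<lambda>u. T (iu2 u v) t)" by (rule mlin_T) auto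
  have eq: "(\<lambda>v. T (iu2 u v) t) = (\<lambda>v. T (iu2 v u) t)" by (simp add: mult.commute)
  show "mlin d (\<lambda>v. T (iu2 u v) t)" by (subst eq, rule mlin_T) auto
qed

lemma mlin_m3: "mlin d (\<lambda>w. T (iu3 w u v) t)" "mlin d (\<lambda>u. T (iu3 w u v) t)" "mlin d (\<lambda>v. T (iu3 w u v) t)"
proof -
  show "mlin d (\<lambda>w. T (iu3 w u v) t)" by (rule mlin_T) auto
  have eq: "(\<lambda>u. T (iu3 w u v) t) = (\<lambda>u. T (iu3 u w v) t)" by (simp add: mult_ac)
  show "mlin d (\<lambda>u. T (iu3 w u v) t)" by (subst eq, rule mlin_T) auto
  have eq: "(\<lambda>v. T (iu3 w u v) t) = (\<lambda>v. T (iu3 v w u) t)" by (simp add: mult_ac)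
  show "mlin d (\<lambda>v. T (iu3 w u v) t)" by (subst eq, rule mlin_T) auto
qed

lemma mlin_m4: "mlin d (\<lambda>z. T (\<lambda>x. iu z x * iu3 w u v x) t)" "mlin d (\<lambda>w. T (\<lambda>x. iu z x * iu3 w u v x) t)"
   "mlin d (\<lambda>u. T (\<lambda>x. iu z x * iu3 w u v x) t)" "mlin d (\<lambda>v. T (\<lambda>x. iu z x * iu3 w u v x) t)"
proof -
  show "mlin d (\<lambda>z. T (\<lambda>x. iu z x * iu3 w u v x) t)" by (rule mlin_T) auto
  have eq: "(\<lambda>w. T (\<lambda>x. iu z x * iu3 w u v x) t) = (\<lambda>w. T (\<lambda>x. iu w x * iu3 z u v x) t)" by (simp add: mult_ac)
  show "mlin d (\<lambda>w. T (\<lambda>x. iu z x * iu3 w u v x) t)" by (subst eq, rule mlin_T) auto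
  have eq: "(\<lambda>u. T (\<lambda>x. iu z x * iu3 w u v x) t) = (\<lambda>u. T (\<lambda>x. iu u x * iu3 z w v x) t)" by (simp add: mult_ac)
  show "mlin d (\<lambda>u. T (\<lambda>x. iu z x * iu3 w u v x) t)" by (subst eq, rule mlin_T) auto
  have eq: "(\<lambda>v. T (\<lambda>x. iu z x * iu3 w u v x) t) = (\<lambda>v. T (\<lambda>x. iu v x * iu3 z w u x) t)" by (simp add: mult_ac)
  show "mlin d (\<lambda>v. T (\<lambda>x. iu z x * iu3 w u v x) t)" by (subst eq, rule mlin_T) auto
qed

lemma mlin_K3: "mlin d (\<lambda>w. K3 w u v t)" "mlin d (\<lambda>u. K3 w u v t)" "mlin d (\<lambda>v. K3 w u v t)"
  unfolding K3_def
  by (intro mlin_add mlin_diff mlin_mult mlin_m1 mlin_m2 mlin_m3)+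

lemma mlin_K4: "mlin d (\<lambda>z. K4 z w u v t)" "mlin d (\<lambda>w. K4 z w u v t)" "mlin d (\<lambda>u. K4 z w u v t)" "mlin d (\<lambda>v. K4 z w u v t)"
  unfolding K4_def D_def
  by (intro mlin_add mlin_diff mlin_mult mlin_m1 mlin_m2 mlin_m3 mlin_m4)+

definition S4 :: real where "S4 = (\<integral>x. S x ^ 4 \<partial>M)"

lemma T_le:
  assumes q: "ord 4 q" and qS: "\<And>x. cmod (q x) \<le> S x ^ 4"
  shows "cmod (T q t) \<le> S4 / cmod (chi t)"
proof -
  have "cmod (G q t) \<le> (\<integral>x. cmod (q x * cis (ip t x)) \<partial>M)"
    unfolding G_def by (rule integral_norm_bound)
  also have "\<dots> \<le> S4" unfolding S4_def
  proof (rule integral_mono)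
    show "integrable M (\<lambda>x. cmod (q x * cis (ip t x)))" using integrable_G[OF q] by (rule integrable_norm)
    show "integrable M (\<lambda>x. S x ^ 4)" using Y4 by (simp add: S_def)
    show "cmod (q x * cis (ip t x)) \<le> S x ^ 4" for x using qS[of x] by (simp add: norm_mult)
  qed
  finally show ?thesis by (simp add: T_def norm_divide divide_right_mono)
qed

lemma m_unitv_le:
  fixes t :: "nat \<Rightarrow> real"
  assumes "z < d" "w < d" "u < d" "v < d"
  defines "b \<equiv> 1 + S4 / cmod (chi t)"
  shows "cmod (m1 (unitv u) t) \<le> b" "cmod (T (iu2 (unitv u) (unitv v)) t) \<le> b"
    "cmod (T (iu3 (unitv w) (unitv u) (unitv v)) t) \<le> b"
    "cmod (T (\<lambda>x. iu (unitv z) x * iu3 (unitv w) (unitv u) (unitv v) x) t) \<le> b"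
proof -
  have Y: "cmod (iu (unitv i) x) \<le> S x" if "i < d" for i x
    using Y_le_S[OF that] that by (simp add: iu_def norm_mult ip_unitv)
  have p: "S x ^ k \<le> S x ^ 4" if "k \<le> 4" for k x using S_ge_1[of x] that by (intro power_increasing) auto
  note Sp = order_trans[OF _ p]
  have S0: "0 \<le> S x" for x using S_ge_1[of x] by simp
  have le: "S4 / cmod (chi t) \<le> b" by (simp add: b_def)
  have 1: "cmod (iu (unitv u) x) \<le> S x ^ 1" for x using Y assms by simp
  show "cmod (m1 (unitv u) t) \<le> b"
    by (rule order_trans[OF T_le le]) (use Sp[OF 1] in auto)
  have 2: "cmod (iu2 (unitv u) (unitv v) x) \<le> S x ^ 2" for x
    using Y assms S0 unfolding norm_mult power2_eq_square by (intro mult_mono) auto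
  show "cmod (T (iu2 (unitv u) (unitv v)) t) \<le> b"
    by (rule order_trans[OF T_le le]) (use Sp[OF 2] in auto)
  have 3: "cmod (iu3 (unitv w) (unitv u) (unitv v) x) \<le> S x ^ 3" for x
  proof -
    have "cmod (iu3 (unitv w) (unitv u) (unitv v) x) \<le> S x * S x ^ 2"
      unfolding norm_mult[of "iu (unitv w) x"] using 2 Y assms S0 by (intro mult_mono) auto
    then show ?thesis by (simp add: power_numeral_reduce)
  qed
  show "cmod (T (iu3 (unitv w) (unitv u) (unitv v)) t) \<le> b"
    by (rule order_trans[OF T_le le]) (use Sp[OF 3] in auto)
  have 4: "cmod (iu (unitv z) x * iu3 (unitv w) (unitv u) (unitv v) x) \<le> S x ^ 4" for x
  proof -
    have "cmod (iu (unitv z) x * iu3 (unitv w) (unitv u) (unitv v) x) \<le> S x * S x ^ 3"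
      unfolding norm_mult[of "iu (unitv z) x"] using 3 Y assms S0 by (intro mult_mono) auto
    then show ?thesis by (simp add: power_numeral_reduce)
  qed
  show "cmod (T (\<lambda>x. iu (unitv z) x * iu3 (unitv w) (unitv u) (unitv v) x) t) \<le> b"
  proof (rule order_trans[OF T_le le])
    show "ord 4 (\<lambda>x. iu (unitv z) x * iu3 (unitv w) (unitv u) (unitv v) x)"
      using ord_iu_mult[OF ord_iu3[of 3]] by simp
  qed (rule 4)
qed

end

lemma norm_mult_le: "cmod x \<le> a \<Longrightarrow> cmod y \<le> b \<Longrightarrow> cmod (x * y) \<le> a * b"
  unfolding norm_mult by (intro mult_mono) (auto intro: order_trans[OF norm_ge_zero])

lemma norm_add_le: "cmod x \<le> a \<Longrightarrow> cmod y \<le> b \<Longrightarrow> cmod (x + y) \<le> a + b"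
  by (rule norm_triangle_le) simp

lemma norm_diff_le: "cmod x \<le> a \<Longrightarrow> cmod y \<le> b \<Longrightarrow> cmod (x - y) \<le> a + b"
  using norm_triangle_ineq4[of x y] by linarith

context charfun
begin

text \<open>
  Crude bounds of the entries of the cumulant tensors. Their only purpose is to make the suprema over the domain
  finite, so the constants do not matter.
\<close>

lemma K_unitv_le:
  fixes t :: "nat \<Rightarrow> real"
  assumes "z < d" "w < d" "u < d" "v < d"
  defines "b \<equiv> 1 + S4 / cmod (chi t)"
  shows "cmod (K3 (unitv w) (unitv u) (unitv v) t) \<le> 6 * b ^ 3"
    and "cmod (K4 (unitv z) (unitv w) (unitv u) (unitv v) t) \<le> 26 * b ^ 4"
proof -
  note m0 = m_unitv_le[where t=t, folded b_def]
  note zd = assms(1)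
  note m = m0(1)[OF zd zd _ zd] m0(2)[OF zd zd] m0(3)[OF zd] m0(4)
  have S40: "0 \<le> S4" unfolding S4_def by (intro integral_nonneg_AE AE_I2 zero_le_power) (use S_ge_1 in \<open>auto intro: order_trans[of 0 1]\<close>)
  then have b: "1 \<le> b" by (simp add: b_def)
  have b2: "cmod (2::complex) \<le> 2" by simp
  have "cmod (K3 (unitv w) (unitv u) (unitv v) t) \<le> b + b * b + b * b + b * b + 2 * (b * b * b)"
    unfolding K3_def by (intro norm_add_le norm_diff_le norm_mult_le m assms b2)
  also have "\<dots> \<le> b ^ 3 + b ^ 3 + b ^ 3 + b ^ 3 + 2 * b ^ 3"
    using power_increasing[OF _ b, of 1 3] power_increasing[OF _ b, of 2 3] 
    by (simp add: power2_eq_square power3_eq_cube)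
  finally show "cmod (K3 (unitv w) (unitv u) (unitv v) t) \<le> 6 * b ^ 3" by simp
  have D1: "cmod (D (unitv z) (iu (unitv i)) t) \<le> b + b * b" if "i < d" for i
    unfolding D_def by (intro norm_diff_le norm_mult_le m assms that)
  have D2: "cmod (D (unitv z) (iu2 (unitv i) (unitv j)) t) \<le> b + b * b" if "i < d" "j < d" for i j
    unfolding D_def by (intro norm_diff_le norm_mult_le m assms that)
  have D3: "cmod (D (unitv z) (iu3 (unitv w) (unitv u) (unitv v)) t) \<le> b + b * b"
    unfolding D_def by (intro norm_diff_le norm_mult_le m assms)
  have "cmod (K4 (unitv z) (unitv w) (unitv u) (unitv v) t) \<le> (b + b * b) + ((b + b * b) * b + b * (b + b * b))
      + ((b + b * b) * b + b * (b + b * b)) + ((b + b * b) * b + b * (b + b * b))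
      + 2 * ((b + b * b) * b * b + b * (b + b * b) * b + b * b * (b + b * b))"
    unfolding K4_def by (intro norm_add_le norm_diff_le norm_mult_le m D1 D2 D3 assms b2)
  also have "\<dots> = b + 7 * b ^ 2 + 12 * b ^ 3 + 6 * b ^ 4" by (simp add: algebra_simps power_numeral_reduce)
  also have "\<dots> \<le> 26 * b ^ 4"
    using power_increasing[OF _ b, of 1 4] power_increasing[OF _ b, of 2 4] power_increasing[OF _ b, of 3 4] by simp
  finally show "cmod (K4 (unitv z) (unitv w) (unitv u) (unitv v) t) \<le> 26 * b ^ 4" .
qed

end

section \<open>Taylor bounds for a centred law with identity covariance\<close>

lemma Re_deriv: "(f has_vector_derivative c) (at s) \<Longrightarrow> ((\<lambda>s. Re (f s)) has_real_derivative Re c) (at s)"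
  using bounded_linear.has_vector_derivative[OF bounded_linear_Re] by (simp add: has_real_derivative_iff_has_vector_derivative)

lemma Im_deriv: "(f has_vector_derivative c) (at s) \<Longrightarrow> ((\<lambda>s. Im (f s)) has_real_derivative Im c) (at s)"
  using bounded_linear.has_vector_derivative[OF bounded_linear_Im] by (simp add: has_real_derivative_iff_has_vector_derivative)

text \<open>
  A centred vector with identity covariance whose characteristic function has a logarithm on a ball, with bounds
  there on the imaginary part of the third and on the real part of the fourth cumulants.
\<close>

locale charlog = charfun M d Y for M :: "'a measure" and d :: nat and Y :: "nat \<Rightarrow> 'a \<Rightarrow> real" +
  fixes L :: "(nat \<Rightarrow> real) \<Rightarrow> complex" and \<rho> c3 c4 :: real
  assumes d1: "1 \<le> d" and rho: "0 < \<rho>" and c3_nonneg: "0 \<le> c3" and c4_nonneg: "0 \<le> c4"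
    and mean: "\<And>i. i < d \<Longrightarrow> (\<integral>x. Y i x \<partial>M) = 0"
    and cov: "\<And>i j. i < d \<Longrightarrow> j < d \<Longrightarrow> (\<integral>x. Y i x * Y j x \<partial>M) = (if i = j then 1 else 0)"
    and exp_L: "\<And>t. vnorm d t < \<rho> \<Longrightarrow> exp (L t) = chi t"
    and L_deriv: "\<And>p p' s. (\<And>i. i < d \<Longrightarrow> ((\<lambda>s. p s i) has_real_derivative p' i) (at s)) \<Longrightarrow>
       vnorm d (p s) < \<rho> \<Longrightarrow> ((\<lambda>s. L (p s)) has_vector_derivative T (iu p') (p s)) (at s)"
    and L_0: "L (\<lambda>i. 0) = 0"
    and L_odd: "\<And>t. vnorm d t < \<rho> \<Longrightarrow> Im (L (\<lambda>i\<in>{..<d}. - t i)) = - Im (L t)"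
    and L_meas [measurable]: "L \<in> borel_measurable (leb d)"
    and c3: "\<And>w u v t. vnorm d t < \<rho> \<Longrightarrow> \<bar>Im (K3 w u v t)\<bar> \<le> c3 * vnorm d w * vnorm d u * vnorm d v"
    and c4: "\<And>z w u v t. vnorm d t < \<rho> \<Longrightarrow> \<bar>Re (K4 z w u v t)\<bar> \<le> c4 * vnorm d z * vnorm d w * vnorm d u * vnorm d v"
begin

lemma chi_nz: "vnorm d t < \<rho> \<Longrightarrow> chi t \<noteq> 0" using exp_L[of t] by auto

lemma vnorm_scale: "vnorm d (\<lambda>i. s * t i) = \<bar>s\<bar> * vnorm d t"
proof -
  have "vnorm d (\<lambda>i. s * t i) = sqrt (s\<^sup>2 * (\<Sum>i<d. (t i)\<^sup>2))"
    by (simp add: L2_set_def power_mult_distrib sum_distrib_left)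
  then show ?thesis by (simp add: L2_set_def real_sqrt_mult)
qed

lemma Y_int: "i < d \<Longrightarrow> integrable M (Y i)"
proof -
  assume i: "i < d"
  have "integrable M (\<lambda>x. Im (iu (unitv i) x))"
    using ord_integrable[OF ord_iu'[of 4 "unitv i"]] by simp
  then show ?thesis using i by (simp add: iu_def ip_unitv cong: integrable_cong)
qed

lemma YY_int: "i < d \<Longrightarrow> j < d \<Longrightarrow> integrable M (\<lambda>x. Y i x * Y j x)"
proof -
  assume i: "i < d" "j < d"
  have "integrable M (\<lambda>x. - Re (iu2 (unitv i) (unitv j) x))"
    using ord_integrable[OF ord_iu2[of 4 "unitv i" "unitv j"]] by (intro integrable_minus integrable_Re) simp
  then show ?thesis using i by (simp add: iu_def ip_unitv cong: integrable_cong)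
qed

lemma m1_at_0: "m1 u (\<lambda>i. 0) = 0"
proof -
  have "(\<integral>x. ip u x \<partial>M) = (\<Sum>i<d. u i * (\<integral>x. Y i x \<partial>M))"
    unfolding ip_def by (subst Bochner_Integration.integral_sum) (auto intro: Y_int)
  then have "(\<integral>x. ip u x \<partial>M) = 0" by (simp add: mean)
  then show ?thesis by (simp add: T_0 iu_def)
qed

lemma K2_at_0: "K2 u v (\<lambda>i. 0) = - of_real (dot d u v)"
proof -
  have "(\<integral>x. ip u x * ip v x \<partial>M) = (\<integral>x. (\<Sum>i<d. \<Sum>j<d. (u i * v j) * (Y i x * Y j x)) \<partial>M)"
    unfolding ip_def by (simp add: sum_product mult_ac)
  also have "\<dots> = (\<Sum>i<d. \<Sum>j<d. (u i * v j) * (\<integral>x. Y i x * Y j x \<partial>M))"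
  proof (subst Bochner_Integration.integral_sum)
    show "integrable M (\<lambda>x. \<Sum>j<d. (u i * v j) * (Y i x * Y j x))" if "i \<in> {..<d}" for i
      using that by (intro Bochner_Integration.integrable_sum integrable_mult_right YY_int) auto
    show "(\<Sum>i<d. \<integral>x. (\<Sum>j<d. (u i * v j) * (Y i x * Y j x)) \<partial>M) = (\<Sum>i<d. \<Sum>j<d. (u i * v j) * (\<integral>x. Y i x * Y j x \<partial>M))"
    proof (rule sum.cong[OF refl])
      fix i assume "i \<in> {..<d}"
      then show "(\<integral>x. (\<Sum>j<d. (u i * v j) * (Y i x * Y j x)) \<partial>M) = (\<Sum>j<d. (u i * v j) * (\<integral>x. Y i x * Y j x \<partial>M))"
        by (subst Bochner_Integration.integral_sum) (auto intro!: integrable_mult_right YY_int)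
    qed
  qed
  also have "\<dots> = dot d u v" by (simp add: cov if_distrib[of "\<lambda>x. _ * x"] cong: if_cong)
  finally have e: "(\<integral>x. ip u x * ip v x \<partial>M) = dot d u v" .
  have "T (iu2 u v) (\<lambda>i. 0) = (\<integral>x. - of_real (ip u x * ip v x) \<partial>M)"
    by (subst T_0) (simp_all add: iu_def mult_ac flip: integral_minus)
  also have "\<dots> = - of_real (\<integral>x. ip u x * ip v x \<partial>M)" by (simp only: integral_minus integral_complex_of_real)
  finally show ?thesis by (simp add: K2_def D_def m1_at_0 e)
qed

lemma K3_at_0: "Re (K3 w u v (\<lambda>i. 0)) = 0"
proof -
  have "T (iu3 w u v) (\<lambda>i. 0) = (\<integral>x. (- \<i>) * of_real (ip w x * (ip u x * ip v x)) \<partial>M)"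
    by (subst T_0) (simp_all add: iu_def mult_ac)
  also have "\<dots> = (- \<i>) * of_real (\<integral>x. ip w x * (ip u x * ip v x) \<partial>M)"
    by (simp only: integral_mult_right_zero integral_complex_of_real)
  finally show ?thesis by (simp add: K3_def m1_at_0)
qed

context
  fixes t assumes t: "vnorm d t < \<rho>"
begin

lemma ray_in: "0 \<le> s \<Longrightarrow> s \<le> 1 \<Longrightarrow> vnorm d (\<lambda>i. s * t i) < \<rho>"
  using t mult_right_mono[of s 1 "vnorm d t"] by (simp add: vnorm_scale)

lemma ray_deriv: "((\<lambda>s. s * t i) has_real_derivative t i) (at s)"
  by (auto intro!: derivative_eq_intros)

text \<open>
  The real part of the third cumulant vanishes at the origin, where it is \<open>- i\<close> times a real moment, so the
  expansion along a ray goes on to the fourth order.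
\<close>

lemma Re_L_taylor: "\<bar>Re (L t) + (vnorm d t)\<^sup>2 / 2\<bar> \<le> c4 * vnorm d t ^ 4 / 24"
proof -
  let ?p = "\<lambda>s i. s * t i"
  define df where "df = (\<lambda>(m::nat) s. if m = 0 then Re (L (?p s)) else if m = 1 then Re (m1 t (?p s))
     else if m = 2 then Re (K2 t t (?p s)) else if m = 3 then Re (K3 t t t (?p s)) else Re (K4 t t t t (?p s)))"
  have "\<exists>s>0. s < 1 \<and> Re (L (?p 1)) = (\<Sum>m<4. df m 0 / fact m * 1 ^ m) + df 4 s / fact 4 * 1 ^ 4"
  proof (rule Maclaurin)
    show "df 0 = (\<lambda>s. Re (L (?p s)))" by (simp add: df_def)
    show "\<forall>m s. m < 4 \<and> 0 \<le> s \<and> s \<le> 1 \<longrightarrow> (df m has_real_derivative df (Suc m) s) (at s)"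
    proof (intro allI impI, elim conjE)
      fix m :: nat and s :: real assume m: "m < 4" and s: "0 \<le> s" "s \<le> 1"
      note r = ray_in[OF s] 
      note nz = chi_nz[OF r]
      have "m = 0 \<or> m = 1 \<or> m = 2 \<or> m = 3" using m by auto
      then show "(df m has_real_derivative df (Suc m) s) (at s)"
        using Re_deriv[OF L_deriv[of ?p t s, OF ray_deriv r]] Re_deriv[OF K1_deriv[of ?p t s, OF ray_deriv nz]]
          Re_deriv[OF K2_deriv[of ?p t s, OF ray_deriv nz]] Re_deriv[OF K3_deriv[of ?p t s, OF ray_deriv nz]]
        by (elim disjE) (simp_all add: df_def numeral_2_eq_2 numeral_3_eq_3)
    qed
  qed auto
  then obtain s where s: "0 < s" "s < 1" and e: "Re (L t) = (\<Sum>m<4. df m 0 / fact m) + df 4 s / fact 4" by auto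
  have "(\<Sum>m<4. df m 0 / fact m) = - (vnorm d t)\<^sup>2 / 2"
    by (simp add: eval_nat_numeral df_def L_0 m1_at_0 K2_at_0 K3_at_0 vnorm_sq[unfolded power2_eq_square])
  moreover have "\<bar>df 4 s\<bar> \<le> c4 * vnorm d t ^ 4"
    using c4[OF ray_in[of s], of t t t t] s by (simp add: df_def power4_eq_xxxx mult_ac)
  ultimately show ?thesis using e by (simp add: fact_numeral)
qed

text \<open>
  The gradient of the imaginary part vanishes to second order at the origin: its value there is the mean and its
  derivative the imaginary part of a real covariance.
\<close>

lemma Im_grad_le: "\<bar>Im (m1 v t)\<bar> \<le> c3 * (vnorm d t)\<^sup>2 * vnorm d v / 2"
proof -
  let ?p = "\<lambda>s i. s * t i"
  define df where "df = (\<lambda>(m::nat) s. if m = 0 then Im (m1 v (?p s)) else if m = 1 then Im (K2 t v (?p s)) else Im (K3 t t v (?p s)))"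
  have "\<exists>s>0. s < 1 \<and> Im (m1 v (?p 1)) = (\<Sum>m<2. df m 0 / fact m * 1 ^ m) + df 2 s / fact 2 * 1 ^ 2"
  proof (rule Maclaurin)
    show "df 0 = (\<lambda>s. Im (m1 v (?p s)))" by (simp add: df_def)
    show "\<forall>m s. m < 2 \<and> 0 \<le> s \<and> s \<le> 1 \<longrightarrow> (df m has_real_derivative df (Suc m) s) (at s)"
    proof (intro allI impI, elim conjE)
      fix m :: nat and s :: real assume m: "m < 2" and s: "0 \<le> s" "s \<le> 1"
      note nz = chi_nz[OF ray_in[OF s]]
      have "m = 0 \<or> m = 1" using m by auto
      then show "(df m has_real_derivative df (Suc m) s) (at s)"
        using Im_deriv[OF K1_deriv[of ?p t s, OF ray_deriv nz]] Im_deriv[OF K2_deriv[of ?p t s, OF ray_deriv nz]]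
        by (elim disjE) (simp_all add: df_def numeral_2_eq_2)
    qed
  qed auto
  then obtain s where s: "0 < s" "s < 1" and e: "Im (m1 v t) = (\<Sum>m<2. df m 0 / fact m) + df 2 s / fact 2" by auto
  have "(\<Sum>m<2. df m 0 / fact m) = 0"
    by (simp add: eval_nat_numeral df_def m1_at_0 K2_at_0)
  moreover have "\<bar>df 2 s\<bar> \<le> c3 * (vnorm d t)\<^sup>2 * vnorm d v"
    using c3[OF ray_in[of s], of t t v] s by (simp add: df_def power2_eq_square mult_ac)
  ultimately show ?thesis using e by simp
qed

end

lemma Im_L_le:
  assumes t: "vnorm d t < \<rho>"
  shows "\<bar>Im (L t)\<bar> \<le> c3 * vnorm d t ^ 3 / 2"
proof -
  let ?p = "\<lambda>s i. s * t i"
  have "\<exists>s>0. s < 1 \<and> Im (L (?p 1)) - Im (L (?p 0)) = (1 - 0) * Im (m1 t (?p s))"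
    using Im_deriv[OF L_deriv[of ?p t, OF ray_deriv[OF t] ray_in[OF t]]] by (intro MVT2) auto
  then obtain s where s: "0 < s" "s < 1" and e: "Im (L t) = Im (m1 t (?p s))" by (auto simp: L_0)
  have "\<bar>Im (m1 t (?p s))\<bar> \<le> c3 * (vnorm d (?p s))\<^sup>2 * vnorm d t / 2"
    using s by (intro Im_grad_le ray_in[OF t]) auto
  also have "\<dots> \<le> c3 * (vnorm d t)\<^sup>2 * vnorm d t / 2"
    using s c3_nonneg mult_right_mono[of s 1 "vnorm d t"]
    by (intro divide_right_mono mult_right_mono mult_left_mono power_mono) (auto simp: vnorm_scale)
  finally show ?thesis using e by (simp add: power2_eq_square power3_eq_cube mult_ac)
qed

lemma Im_grad_sq_le:
  assumes t: "vnorm d t < \<rho>"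
  shows "dot d (\<lambda>i. Im (m1 (unitv i) t)) (\<lambda>i. Im (m1 (unitv i) t)) \<le> (c3 * (vnorm d t)\<^sup>2 / 2)\<^sup>2"
proof -
  let ?v = "\<lambda>i. Im (m1 (unitv i) t)"
  have "Im (m1 ?v t) = dot d ?v ?v"
    using mlinD[OF mlin_Re_Im(2)[OF mlin_m1[of t]], of ?v] by (simp only: real_scaleR_def)
  then have "(vnorm d ?v)\<^sup>2 \<le> c3 * (vnorm d t)\<^sup>2 * vnorm d ?v / 2"
    using Im_grad_le[OF t, of ?v] by (simp add: vnorm_sq)
  then have "vnorm d ?v \<le> c3 * (vnorm d t)\<^sup>2 / 2"
    using vnorm_nonneg[of ?v d] c3_nonneg by (cases "vnorm d ?v = 0") (auto simp: power2_eq_square)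
  then have "(vnorm d ?v)\<^sup>2 \<le> (c3 * (vnorm d t)\<^sup>2 / 2)\<^sup>2" by (intro power_mono) auto
  then show ?thesis by (simp add: vnorm_sq)
qed

lemma rot_in:
  assumes "dot d x x + dot d y y < \<rho>\<^sup>2" shows "vnorm d (rot d \<theta> x y) < \<rho>"
proof -
  have "0 \<le> dot d (rot d (\<theta> + pi/2) x y) (rot d (\<theta> + pi/2) x y)" by (intro sum_nonneg) auto
  then have "(vnorm d (rot d \<theta> x y))\<^sup>2 < \<rho>\<^sup>2" using rot_sq_sum[where d = d and \<theta> = \<theta> and x = x and y = y] assms unfolding vnorm_sq by linarith
  then show ?thesis using rho by (simp add: power_less_imp_less_base)
qed

text \<open>
  Along the half circle from \<open>x\<close> to \<open>- x\<close> the odd function \<open>Im L\<close> changes by \<open>- 2 Im L(x)\<close>. The fundamental theorem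
  of calculus and the Cauchy-Schwarz inequality bound the square of this change by \<open>\<pi>\<close> times the integral of the
  squared derivative. The velocity at angle \<open>\<theta>\<close> is the position at angle \<open>\<theta> + \<pi> / 2\<close>.
\<close>

lemma half_circle_bound:
  assumes x: "x \<in> Rd d" and xy: "dot d x x + dot d y y < \<rho>\<^sup>2"
  shows "ennreal (4 * (Im (L x))\<^sup>2) \<le> ennreal pi * (\<integral>\<^sup>+\<theta>. ennreal ((Im (m1 (rot d (\<theta> + pi/2) x y) (rot d \<theta> x y)))\<^sup>2) * indicator {0..pi} \<theta> \<partial>lborel)"
proof -
  define f where "f = (\<lambda>\<theta>. Im (m1 (rot d (\<theta> + pi/2) x y) (rot d \<theta> x y)))"
  have pd: "((\<lambda>\<theta>. rot d \<theta> x y i) has_real_derivative rot d (\<theta> + pi/2) x y i) (at \<theta>)" if "i < d" for i \<theta>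
    using that by (auto simp: rot_def cos_add sin_add intro!: derivative_eq_intros)
  have fd: "((\<lambda>\<theta>. Im (L (rot d \<theta> x y))) has_real_derivative f \<theta>) (at \<theta>)" for \<theta>
    unfolding f_def by (intro Im_deriv L_deriv pd rot_in xy)
  have fe: "f = (\<lambda>\<theta>. \<Sum>i<d. rot d (\<theta> + pi/2) x y i * Im (m1 (unitv i) (rot d \<theta> x y)))"
  proof
    fix \<theta>
    show "f \<theta> = (\<Sum>i<d. rot d (\<theta> + pi/2) x y i * Im (m1 (unitv i) (rot d \<theta> x y)))"
      unfolding f_def using mlinD[OF mlin_Re_Im(2)[OF mlin_m1[of "rot d \<theta> x y"]], of "rot d (\<theta> + pi/2) x y"]
      by (simp only: real_scaleR_def)
  qed
  have fc: "isCont f \<theta>" for \<theta>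
    unfolding fe
  proof (intro isCont_sum continuous_mult ballI)
    fix i assume "i \<in> {..<d}"
    then show "isCont (\<lambda>\<theta>. rot d (\<theta> + pi/2) x y i) \<theta>" by (simp add: rot_def)
    show "isCont (\<lambda>\<theta>. Im (m1 (unitv i) (rot d \<theta> x y))) \<theta>"
      using Im_deriv[OF K1_deriv[of "\<lambda>\<theta>. rot d \<theta> x y", OF pd chi_nz[OF rot_in[OF xy]]]] by (rule DERIV_isCont)
  qed
  have [measurable]: "f \<in> borel_measurable borel"
    using fc by (intro borel_measurable_continuous_onI) (simp add: continuous_on_eq_continuous_at)
  have ends: "Im (L (rot d pi x y)) - Im (L (rot d 0 x y)) = - 2 * Im (L x)"
  proof -
    have r0: "rot d 0 x y = x" using x by (auto simp: rot_def fun_eq_iff PiE_iff extensional_def)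
    have "vnorm d x < \<rho>" using rot_in[OF xy, of 0] by (simp add: r0)
    from L_odd[OF this] show ?thesis unfolding r0 by (simp add: rot_def)
  qed
  have bi: "has_bochner_integral lborel (\<lambda>\<theta>. f \<theta> * indicator {0..pi} \<theta>) (Im (L (rot d pi x y)) - Im (L (rot d 0 x y)))"
    by (rule has_bochner_integral_FTC_Icc_real) (use fd fc in auto)
  then have "ennreal \<bar>- 2 * Im (L x)\<bar> \<le> (\<integral>\<^sup>+\<theta>. ennreal (norm (f \<theta> * indicator {0..pi} \<theta>)) \<partial>lborel)"
    using integral_norm_bound_ennreal[of lborel "\<lambda>\<theta>. f \<theta> * indicator {0..pi} \<theta>"] ends
    by (simp add: has_bochner_integral_iff)
  also have "\<dots> = (\<integral>\<^sup>+\<theta>. ennreal \<bar>f \<theta> * indicator {0..pi} \<theta>\<bar> * indicator {0..pi} \<theta> \<partial>lborel)"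
    by (intro nn_integral_cong) (auto simp: indicator_def)
  finally have "(ennreal \<bar>- 2 * Im (L x)\<bar>)\<^sup>2 \<le> (\<integral>\<^sup>+\<theta>. ennreal \<bar>f \<theta> * indicator {0..pi} \<theta>\<bar> * indicator {0..pi} \<theta> \<partial>lborel)\<^sup>2"
    by (rule power_mono) simp
  also have "\<dots> \<le> (\<integral>\<^sup>+\<theta>. (ennreal \<bar>f \<theta> * indicator {0..pi} \<theta>\<bar>)\<^sup>2 \<partial>lborel) * (\<integral>\<^sup>+\<theta>. (indicator {0..pi} \<theta>)\<^sup>2 \<partial>lborel)"
    by (rule Cauchy_Schwarz_nn_integral) measurable
  also have "(\<integral>\<^sup>+\<theta>. (indicator {0..pi} \<theta>)\<^sup>2 \<partial>lborel) = (\<integral>\<^sup>+\<theta>. indicator {0..pi} \<theta> \<partial>lborel)"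
    by (intro nn_integral_cong) (auto simp: indicator_def)
  also have "\<dots> = ennreal pi" by simp
  also have "(\<integral>\<^sup>+\<theta>. (ennreal \<bar>f \<theta> * indicator {0..pi} \<theta>\<bar>)\<^sup>2 \<partial>lborel) = (\<integral>\<^sup>+\<theta>. ennreal ((f \<theta>)\<^sup>2) * indicator {0..pi} \<theta> \<partial>lborel)"
    by (intro nn_integral_cong) (auto simp: indicator_def ennreal_power)
  also have "(ennreal \<bar>- 2 * Im (L x)\<bar>)\<^sup>2 = ennreal (4 * (Im (L x))\<^sup>2)"
    by (simp add: ennreal_power power_mult_distrib abs_mult)
  finally show ?thesis by (simp add: f_def mult.commute)
qed

end

section \<open>A Poincare inequality for odd functions on a ball\<close>

lemma (in charfun) G_meas [measurable]:
  assumes [measurable]: "q \<in> borel_measurable M"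
  shows "G q \<in> borel_measurable (leb d)"
proof -
  have [measurable]: "(\<lambda>z. ip (fst z) (snd z)) \<in> borel_measurable (leb d \<Otimes>\<^sub>M M)"
    unfolding ip_def
  proof (intro borel_measurable_sum borel_measurable_times)
    fix i assume i: "i \<in> {..<d}"
    show "(\<lambda>z. fst z i) \<in> borel_measurable (leb d \<Otimes>\<^sub>M M)"
      using measurable_compose[OF measurable_fst measurable_component_singleton[OF i, of "\<lambda>_. lborel"]] by simp
    show "(\<lambda>z. Y i (snd z)) \<in> borel_measurable (leb d \<Otimes>\<^sub>M M)"
      using i by (intro measurable_compose[OF measurable_snd] Y_meas) auto
  qed
  have "(\<lambda>t. \<integral>x. q x * cis (ip t x) \<partial>M) \<in> borel_measurable (leb d)"
    unfolding cis_conv_exp by (intro borel_measurable_lebesgue_integral) (simp add: split_beta')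
  then show ?thesis by (simp add: G_def[abs_def])
qed

lemma (in charfun) chi_meas [measurable]: "chi \<in> borel_measurable (leb d)"
  unfolding chi_def[abs_def] by measurable

lemma (in charfun) T_meas [measurable]: "q \<in> borel_measurable M \<Longrightarrow> T q \<in> borel_measurable (leb d)"
  unfolding T_def[abs_def] by (intro borel_measurable_divide G_meas chi_meas)

lemma (in charfun) m1_joint_meas [measurable]: "(\<lambda>z. m1 (snd z) (fst z)) \<in> borel_measurable (leb d \<Otimes>\<^sub>M leb d)"
proof -
  have "(\<lambda>z. m1 (snd z) (fst z)) = (\<lambda>z. \<Sum>i<d. snd z i *\<^sub>R m1 (unitv i) (fst z))"
    by (rule ext, rule mlinD[OF mlin_m1])
  also have "\<dots> \<in> borel_measurable (leb d \<Otimes>\<^sub>M leb d)"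
  proof (intro borel_measurable_sum borel_measurable_scaleR)
    fix i assume i: "i \<in> {..<d}"
    show "(\<lambda>z. snd z i) \<in> borel_measurable (leb d \<Otimes>\<^sub>M leb d)"
      using measurable_compose[OF measurable_snd measurable_component_singleton[OF i, of "\<lambda>_. lborel"]] by simp
    show "(\<lambda>z. m1 (unitv i) (fst z)) \<in> borel_measurable (leb d \<Otimes>\<^sub>M leb d)" by measurable
  qed
  finally show ?thesis .
qed

lemma (in charfun) chi_le_1: "cmod (chi t) \<le> 1"
proof -
  have "cmod (chi t) \<le> (\<integral>x. cmod (cis (ip t x)) \<partial>M)"
    unfolding chi_def G_def by (simp add: integral_norm_bound[THEN order_trans])
  then show ?thesis by (simp add: prob_space)
qed

locale charlog_n = charlog M d Y L \<rho> c3 c4 for M :: "'a measure" and d Y L \<rho> c3 c4 +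
  fixes n :: real
  assumes n: "0 < n" and \<rho>_eq: "\<rho> = 5/2 * sqrt (real d / n)"
begin

lemma n_rho_sq: "n * \<rho>\<^sup>2 = 25/4 * real d"
  using n by (simp add: \<rho>_eq power_mult_distrib power_divide)

text \<open>
  The squared derivative of \<open>Im L\<close> at \<open>x\<close> in the direction \<open>y\<close>, on the rotation invariant event that keeps
  half circles in the ball.
\<close>

definition F :: "(nat \<Rightarrow> real) \<times> (nat \<Rightarrow> real) \<Rightarrow> ennreal" where
  "F = (\<lambda>z. ennreal ((Im (m1 (snd z) (fst z)))\<^sup>2) * (if dot d (fst z) (fst z) + dot d (snd z) (snd z) < \<rho>\<^sup>2 then 1 else 0))"

lemma F_meas [measurable]: "F \<in> borel_measurable (leb d \<Otimes>\<^sub>M leb d)"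
proof -
  have [measurable]: "(\<lambda>z. dot d (fst z) (fst z)) \<in> borel_measurable (leb d \<Otimes>\<^sub>M leb d)"
    "(\<lambda>z. dot d (snd z) (snd z)) \<in> borel_measurable (leb d \<Otimes>\<^sub>M leb d)" by measurable
  show ?thesis unfolding F_def by measurable
qed

text \<open>
  For fixed \<open>x\<close> the derivative is linear in the Gaussian vector \<open>y\<close>, so its mean square is of the order of the
  squared gradient divided by \<open>n\<close>. This is where a factor \<open>d\<close> is saved: bounding the derivative by the length of the
  gradient times that of \<open>y\<close> would lose it.
\<close>

lemma integral_F_le: "(\<integral>\<^sup>+z. F z \<partial>(gauss d n \<Otimes>\<^sub>M gauss d n)) \<le> ennreal (128 * c3\<^sup>2 * real d ^ 2 / n ^ 3)"
proof -
  interpret g: prob_space "gauss d n" by (rule prob_space_gauss[OF n])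
  have "(\<integral>\<^sup>+z. F z \<partial>(gauss d n \<Otimes>\<^sub>M gauss d n)) = (\<integral>\<^sup>+x. \<integral>\<^sup>+y. F (x, y) \<partial>gauss d n \<partial>gauss d n)"
    by (rule g.nn_integral_fst[symmetric]) measurable
  also have "\<dots> \<le> (\<integral>\<^sup>+x. ennreal (2 * c3\<^sup>2 / n ^ 3) * ennreal ((n * dot d x x)\<^sup>2) \<partial>gauss d n)"
  proof (rule nn_integral_mono)
    fix x
    let ?v = "\<lambda>i. Im (m1 (unitv i) x)"
    show "(\<integral>\<^sup>+y. F (x, y) \<partial>gauss d n) \<le> ennreal (2 * c3\<^sup>2 / n ^ 3) * ennreal ((n * dot d x x)\<^sup>2)"
    proof (cases "vnorm d x < \<rho>")
      case True
      have "(\<integral>\<^sup>+y. F (x, y) \<partial>gauss d n) \<le> (\<integral>\<^sup>+y. ennreal ((dot d ?v y)\<^sup>2) \<partial>gauss d n)"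
      proof (rule nn_integral_mono)
        fix y
        have "Im (m1 y x) = dot d ?v y"
          using mlinD[OF mlin_Re_Im(2)[OF mlin_m1[of x]], of y] by (simp only: real_scaleR_def mult.commute)
        then show "F (x, y) \<le> ennreal ((dot d ?v y)\<^sup>2)" by (simp add: F_def)
      qed
      also have "\<dots> \<le> ennreal (8 * dot d ?v ?v / n)" by (rule nn_integral_gauss_lin_sq[OF n])
      also have "\<dots> \<le> ennreal (8 * (c3 * (vnorm d x)\<^sup>2 / 2)\<^sup>2 / n)"
        using n Im_grad_sq_le[OF True] by (intro ennreal_leI divide_right_mono mult_left_mono) auto
      also have "8 * (c3 * (vnorm d x)\<^sup>2 / 2)\<^sup>2 / n = 2 * c3\<^sup>2 / n ^ 3 * (n * dot d x x)\<^sup>2"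
        unfolding vnorm_sq using n by (simp add: power2_eq_square power3_eq_cube)
      also have "ennreal \<dots> = ennreal (2 * c3\<^sup>2 / n ^ 3) * ennreal ((n * dot d x x)\<^sup>2)"
        using n by (intro ennreal_mult) auto
      finally show ?thesis .
    next
      case False
      have "\<rho>\<^sup>2 \<le> dot d x x" unfolding vnorm_sq[symmetric] using False rho by (intro power_mono) auto
      moreover have "0 \<le> dot d y y" for y :: "nat \<Rightarrow> real" by (intro sum_nonneg) auto
      ultimately have "F (x, y) = 0" for y
        using add_mono[of "\<rho>\<^sup>2" "dot d x x" 0 "dot d y y"] by (simp add: F_def)
      then show ?thesis by simp
    qed
  qed
  also have "\<dots> = ennreal (2 * c3\<^sup>2 / n ^ 3) * (\<integral>\<^sup>+x. ennreal ((n * dot d x x)\<^sup>2) \<partial>gauss d n)"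
    by (rule nn_integral_cmult) measurable
  also have "\<dots> \<le> ennreal (2 * c3\<^sup>2 / n ^ 3) * ennreal (64 * real d ^ 2)"
    by (intro mult_left_mono gauss_fourth_moment[OF n d1]) simp
  also have "\<dots> = ennreal (128 * c3\<^sup>2 * real d ^ 2 / n ^ 3)"
    using n by (simp add: ennreal_mult[symmetric])
  finally show ?thesis .
qed

text \<open>
  After rotating the pair, position and velocity are again an independent Gaussian pair, so every angle
  contributes the same amount.
\<close>

lemma poincare_pair:
  "(\<integral>\<^sup>+x. \<integral>\<^sup>+y. ennreal (4 * (Im (L x))\<^sup>2) * (if dot d x x + dot d y y < \<rho>\<^sup>2 then 1 else 0) \<partial>gauss d n \<partial>gauss d n)
     \<le> ennreal (pi\<^sup>2) * (\<integral>\<^sup>+z. F z \<partial>(gauss d n \<Otimes>\<^sub>M gauss d n))"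
proof -
  interpret g: prob_space "gauss d n" by (rule prob_space_gauss[OF n])
  interpret gg: pair_prob_space "gauss d n" "gauss d n" ..
  interpret P: pair_sigma_finite "gauss d n \<Otimes>\<^sub>M gauss d n" lborel ..
  define h where "h = (\<lambda>(z, \<theta>). F (rot d \<theta> (fst z) (snd z), rot d (\<theta> + pi/2) (fst z) (snd z)) * indicator {0..pi} \<theta>)"
  have rm: "(\<lambda>w. rot d (snd w + c) (fst (fst w)) (snd (fst w))) \<in> (leb d \<Otimes>\<^sub>M leb d) \<Otimes>\<^sub>M lborel \<rightarrow>\<^sub>M leb d" for c
    unfolding rot_def
  proof (rule measurable_restrict)
    fix i assume i: "i \<in> {..<d}"
    have [measurable]: "(\<lambda>w. fst (fst w) i) \<in> borel_measurable ((leb d \<Otimes>\<^sub>M leb d) \<Otimes>\<^sub>M lborel)"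
      "(\<lambda>w. snd (fst w) i) \<in> borel_measurable ((leb d \<Otimes>\<^sub>M leb d) \<Otimes>\<^sub>M lborel)"
      using measurable_compose[OF measurable_compose[OF measurable_fst measurable_fst] measurable_component_singleton[OF i, of "\<lambda>_. lborel"]]
        measurable_compose[OF measurable_compose[OF measurable_fst measurable_snd] measurable_component_singleton[OF i, of "\<lambda>_. lborel"]] by simp_all
    show "(\<lambda>w. cos (snd w + c) * fst (fst w) i + sin (snd w + c) * snd (fst w) i) \<in> (leb d \<Otimes>\<^sub>M leb d) \<Otimes>\<^sub>M lborel \<rightarrow>\<^sub>M lborel"
      by (simp) measurable
  qed
  note [measurable] = rm[of 0, simplified] rm[of "pi/2"]
  have h[measurable]: "h \<in> borel_measurable ((gauss d n \<Otimes>\<^sub>M gauss d n) \<Otimes>\<^sub>M lborel)"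
    unfolding h_def split_beta' by measurable
  have "(\<integral>\<^sup>+x. \<integral>\<^sup>+y. ennreal (4 * (Im (L x))\<^sup>2) * (if dot d x x + dot d y y < \<rho>\<^sup>2 then 1 else 0) \<partial>gauss d n \<partial>gauss d n)
      \<le> (\<integral>\<^sup>+x. \<integral>\<^sup>+y. ennreal pi * (\<integral>\<^sup>+\<theta>. h ((x, y), \<theta>) \<partial>lborel) \<partial>gauss d n \<partial>gauss d n)"
  proof (intro nn_integral_mono)
    fix x y assume x: "x \<in> space (gauss d n)"
    have F': "F (rot d \<theta> x y, rot d (\<theta> + pi/2) x y) = ennreal ((Im (m1 (rot d (\<theta> + pi/2) x y) (rot d \<theta> x y)))\<^sup>2)" if "dot d x x + dot d y y < \<rho>\<^sup>2" for \<theta>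
      using that by (simp add: F_def rot_sq_sum)
    show "ennreal (4 * (Im (L x))\<^sup>2) * (if dot d x x + dot d y y < \<rho>\<^sup>2 then 1 else 0) \<le> ennreal pi * (\<integral>\<^sup>+\<theta>. h ((x, y), \<theta>) \<partial>lborel)"
    proof (cases "dot d x x + dot d y y < \<rho>\<^sup>2")
      case True
      then show ?thesis using half_circle_bound[OF _ True] x by (simp add: h_def F')
    qed simp
  qed
  also have "\<dots> = (\<integral>\<^sup>+z. ennreal pi * (\<integral>\<^sup>+\<theta>. h (z, \<theta>) \<partial>lborel) \<partial>(gauss d n \<Otimes>\<^sub>M gauss d n))"
    by (rule g.nn_integral_fst) measurable
  also have "\<dots> = ennreal pi * (\<integral>\<^sup>+z. \<integral>\<^sup>+\<theta>. h (z, \<theta>) \<partial>lborel \<partial>(gauss d n \<Otimes>\<^sub>M gauss d n))"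
    by (rule nn_integral_cmult) measurable
  also have "(\<integral>\<^sup>+z. \<integral>\<^sup>+\<theta>. h (z, \<theta>) \<partial>lborel \<partial>(gauss d n \<Otimes>\<^sub>M gauss d n)) = (\<integral>\<^sup>+\<theta>. \<integral>\<^sup>+z. h (z, \<theta>) \<partial>(gauss d n \<Otimes>\<^sub>M gauss d n) \<partial>lborel)"
    by (rule P.Fubini'[symmetric]) measurable
  also have "\<dots> = (\<integral>\<^sup>+\<theta>. (\<integral>\<^sup>+z. F z \<partial>(gauss d n \<Otimes>\<^sub>M gauss d n)) * indicator {0..pi} \<theta> \<partial>lborel)"
  proof (rule nn_integral_cong_AE)
    (* The shears degenerate at the two end points, which form a null set. *)
    have "AE \<theta> in lborel. \<theta> \<noteq> 0 \<and> \<theta> \<noteq> pi" using AE_lborel_singleton[of "0::real"] AE_lborel_singleton[of pi] by eventually_elim simp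
    then show "AE \<theta> in lborel. (\<integral>\<^sup>+z. h (z, \<theta>) \<partial>(gauss d n \<Otimes>\<^sub>M gauss d n)) = (\<integral>\<^sup>+z. F z \<partial>(gauss d n \<Otimes>\<^sub>M gauss d n)) * indicator {0..pi} \<theta>"
    proof eventually_elim
      fix \<theta> :: real assume \<theta>: "\<theta> \<noteq> 0 \<and> \<theta> \<noteq> pi"
      show "(\<integral>\<^sup>+z. h (z, \<theta>) \<partial>(gauss d n \<Otimes>\<^sub>M gauss d n)) = (\<integral>\<^sup>+z. F z \<partial>(gauss d n \<Otimes>\<^sub>M gauss d n)) * indicator {0..pi} \<theta>"
      proof (cases "\<theta> \<in> {0..pi}")
        case True
        then have "sin \<theta> > 0" using \<theta> by (intro sin_gt_zero) auto
        then show ?thesis using nn_integral_gauss_rot[OF n F_meas, of \<theta>] True by (simp add: h_def split_beta')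
      qed (simp add: h_def)
    qed
  qed
  also have "\<dots> = (\<integral>\<^sup>+z. F z \<partial>(gauss d n \<Otimes>\<^sub>M gauss d n)) * ennreal pi"
    by (subst nn_integral_cmult_indicator) auto
  finally show ?thesis by (simp add: power2_eq_square ennreal_mult mult_ac)
qed

text \<open>
  For \<open>n \<parallel>x\<parallel>\<^sup>2 < 3 d\<close> an independent \<open>y\<close> satisfies \<open>\<parallel>x\<parallel>\<^sup>2 + \<parallel>y\<parallel>\<^sup>2 < \<rho>\<^sup>2\<close> with probability at least \<open>1/3\<close>, so
  the restriction on the pair can be removed at the cost of a constant.
\<close>

lemma Im_L_sq_small:
  "(\<integral>\<^sup>+x. ennreal ((Im (L x))\<^sup>2) * (if n * dot d x x < 3 * real d then 1 else 0) \<partial>gauss d n) \<le> ennreal (960 * c3\<^sup>2 * real d ^ 2 / n ^ 3)"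
proof -
  interpret g: prob_space "gauss d n" by (rule prob_space_gauss[OF n])
  have third: "ennreal (1/3) \<le> (\<integral>\<^sup>+y. (if n * dot d y y < 13/4 * real d then 1 else 0) \<partial>gauss d n)"
  proof -
    let ?A = "{y \<in> Rd d. 13/4 * real d \<le> n * dot d y y}"
    have [measurable]: "?A \<in> sets (leb d)" unfolding space_leb[symmetric] by measurable
    have "g.prob ?A \<le> 2/3"
      using gauss_tail_13_4[OF n d1] by (simp add: g.emeasure_eq_measure)
    then have "1/3 \<le> g.prob (space (gauss d n) - ?A)" by (subst g.prob_compl) auto
    then have "ennreal (1/3) \<le> emeasure (gauss d n) (space (gauss d n) - ?A)"
      unfolding g.emeasure_eq_measure by (rule ennreal_leI)
    also have "\<dots> = (\<integral>\<^sup>+y. indicator (space (gauss d n) - ?A) y \<partial>gauss d n)" by simp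
    also have "\<dots> \<le> (\<integral>\<^sup>+y. (if n * dot d y y < 13/4 * real d then 1 else 0) \<partial>gauss d n)"
      by (intro nn_integral_mono) (auto simp: indicator_def)
    finally show ?thesis .
  qed
  have "ennreal (4/3) * (\<integral>\<^sup>+x. ennreal ((Im (L x))\<^sup>2) * (if n * dot d x x < 3 * real d then 1 else 0) \<partial>gauss d n)
     = (\<integral>\<^sup>+x. ennreal (4/3) * (ennreal ((Im (L x))\<^sup>2) * (if n * dot d x x < 3 * real d then 1 else 0)) \<partial>gauss d n)"
    by (rule nn_integral_cmult[symmetric]) measurable
  also have "\<dots> \<le> (\<integral>\<^sup>+x. \<integral>\<^sup>+y. ennreal (4 * (Im (L x))\<^sup>2) * (if dot d x x + dot d y y < \<rho>\<^sup>2 then 1 else 0) \<partial>gauss d n \<partial>gauss d n)"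
  proof (rule nn_integral_mono)
    fix x
    show "ennreal (4/3) * (ennreal ((Im (L x))\<^sup>2) * (if n * dot d x x < 3 * real d then 1 else 0)) \<le>
      (\<integral>\<^sup>+y. ennreal (4 * (Im (L x))\<^sup>2) * (if dot d x x + dot d y y < \<rho>\<^sup>2 then 1 else 0) \<partial>gauss d n)"
    proof (cases "n * dot d x x < 3 * real d")
      case True
      have imp: "dot d x x + dot d y y < \<rho>\<^sup>2" if "n * dot d y y < 13/4 * real d" for y
      proof -
        have "n * (dot d x x + dot d y y) < n * \<rho>\<^sup>2" using True that unfolding n_rho_sq by (simp add: distrib_left)
        then show ?thesis using n by simp
      qed
      have "ennreal (4/3) * ennreal ((Im (L x))\<^sup>2) = ennreal (4 * (Im (L x))\<^sup>2) * ennreal (1/3)"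
        by (simp add: ennreal_mult[symmetric])
      also have "\<dots> \<le> ennreal (4 * (Im (L x))\<^sup>2) * (\<integral>\<^sup>+y. (if n * dot d y y < 13/4 * real d then 1 else 0) \<partial>gauss d n)"
        by (intro mult_left_mono third) simp
      also have "\<dots> = (\<integral>\<^sup>+y. ennreal (4 * (Im (L x))\<^sup>2) * (if n * dot d y y < 13/4 * real d then 1 else 0) \<partial>gauss d n)"
        by (rule nn_integral_cmult[symmetric]) measurable
      also have "\<dots> \<le> (\<integral>\<^sup>+y. ennreal (4 * (Im (L x))\<^sup>2) * (if dot d x x + dot d y y < \<rho>\<^sup>2 then 1 else 0) \<partial>gauss d n)"
        by (intro nn_integral_mono) (auto simp: imp)
      finally show ?thesis using True by simp
    qed simp
  qed
  also have "\<dots> \<le> ennreal (pi\<^sup>2) * ennreal (128 * c3\<^sup>2 * real d ^ 2 / n ^ 3)"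
    by (intro order_trans[OF poincare_pair] mult_left_mono integral_F_le) simp
  also have "\<dots> \<le> ennreal (4/3 * (960 * c3\<^sup>2 * real d ^ 2 / n ^ 3))"
  proof -
    have "pi\<^sup>2 \<le> 10"
    proof -
      have "pi \<le> 3.15" using pi_approx by simp
      then have "pi\<^sup>2 \<le> 3.15\<^sup>2" by (intro power_mono) auto
      then show ?thesis by (simp add: power2_eq_square)
    qed
    then have "pi\<^sup>2 * (128 * c3\<^sup>2 * real d ^ 2 / n ^ 3) \<le> 10 * (128 * c3\<^sup>2 * real d ^ 2 / n ^ 3)"
      using n by (intro mult_right_mono) auto
    then show ?thesis using n by (simp add: ennreal_mult[symmetric] ennreal_leI)
  qed
  also have "\<dots> = ennreal (4/3) * ennreal (960 * c3\<^sup>2 * real d ^ 2 / n ^ 3)" using n by (intro ennreal_mult) auto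
  finally show ?thesis
    by (subst (asm) ennreal_mult_le_mult_iff) auto
qed

text \<open>
  In the remaining shell the cubic pointwise bound suffices: it is too large by a factor \<open>d\<close>, but the shell has
  probability at most \<open>5 / (2 d)\<close>.
\<close>

lemma Im_L_sq_ball:
  "(\<integral>\<^sup>+x. ennreal ((Im (L x))\<^sup>2) * (if vnorm d x < \<rho> then 1 else 0) \<partial>gauss d n) \<le> ennreal (1200 * c3\<^sup>2 * real d ^ 2 / n ^ 3)"
proof -
  let ?A = "{x \<in> Rd d. 3 * real d \<le> n * dot d x x}"
  have [measurable]: "?A \<in> sets (leb d)" unfolding space_leb[symmetric] by measurable
  let ?k = "c3\<^sup>2 / 4 * (25/4 * real d / n) ^ 3"
  have "(\<integral>\<^sup>+x. ennreal ((Im (L x))\<^sup>2) * (if vnorm d x < \<rho> then 1 else 0) \<partial>gauss d n)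
     \<le> (\<integral>\<^sup>+x. ennreal ((Im (L x))\<^sup>2) * (if n * dot d x x < 3 * real d then 1 else 0) + ennreal ?k * indicator ?A x \<partial>gauss d n)"
  proof (rule nn_integral_mono)
    fix x assume x: "x \<in> space (gauss d n)"
    have k: "(Im (L x))\<^sup>2 \<le> ?k" if v: "vnorm d x < \<rho>"
    proof -
      have "(Im (L x))\<^sup>2 \<le> (c3 * vnorm d x ^ 3 / 2)\<^sup>2" using Im_L_le[OF v] c3_nonneg by (intro abs_le_square_iff[THEN iffD1]) auto
      also have "\<dots> = c3\<^sup>2 / 4 * (vnorm d x ^ 2) ^ 3" by (simp add: power2_eq_square power3_eq_cube)
      also have "\<dots> \<le> c3\<^sup>2 / 4 * (\<rho>\<^sup>2) ^ 3" using v by (intro mult_left_mono power_mono) auto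
      also have "\<rho>\<^sup>2 = 25/4 * real d / n" using n_rho_sq n by (simp add: field_simps)
      finally show ?thesis .
    qed
    show "ennreal ((Im (L x))\<^sup>2) * (if vnorm d x < \<rho> then 1 else 0) \<le>
       ennreal ((Im (L x))\<^sup>2) * (if n * dot d x x < 3 * real d then 1 else 0) + ennreal ?k * indicator ?A x"
    proof (cases "vnorm d x < \<rho> \<and> \<not> n * dot d x x < 3 * real d")
      case True
      then have "indicator ?A x = (1::ennreal)" using x by simp
      then show ?thesis using True ennreal_leI[OF k] by simp
    next
      case False
      then have "ennreal ((Im (L x))\<^sup>2) * (if vnorm d x < \<rho> then 1 else 0)
        \<le> ennreal ((Im (L x))\<^sup>2) * (if n * dot d x x < 3 * real d then 1 else 0)" by auto
      then show ?thesis by (rule order_trans) simp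
    qed
  qed
  also have "\<dots> = (\<integral>\<^sup>+x. ennreal ((Im (L x))\<^sup>2) * (if n * dot d x x < 3 * real d then 1 else 0) \<partial>gauss d n) + ennreal ?k * emeasure (gauss d n) ?A"
    by (subst nn_integral_add) (simp_all add: nn_integral_cmult_indicator)
  also have "\<dots> \<le> ennreal (960 * c3\<^sup>2 * real d ^ 2 / n ^ 3) + ennreal ?k * ennreal (5 / (2 * real d))"
    by (intro add_mono Im_L_sq_small mult_left_mono gauss_tail_3[OF n d1]) simp
  also have "\<dots> = ennreal (960 * c3\<^sup>2 * real d ^ 2 / n ^ 3 + ?k * (5 / (2 * real d)))"
  proof -
    have "0 \<le> 960 * c3\<^sup>2 * real d ^ 2 / n ^ 3" "0 \<le> ?k" "0 \<le> 5 / (2 * real d)" "0 \<le> ?k * (5 / (2 * real d))" using n by auto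
    then show ?thesis by (simp only: ennreal_mult ennreal_plus)
  qed
  also have "\<dots> \<le> ennreal (1200 * c3\<^sup>2 * real d ^ 2 / n ^ 3)"
  proof (rule ennreal_leI)
    have "?k * (5 / (2 * real d)) = 78125/512 * (c3\<^sup>2 * real d ^ 2 / n ^ 3)"
      using d1 n by (simp add: power3_eq_cube power2_eq_square field_simps)
    also have "\<dots> \<le> 240 * (c3\<^sup>2 * real d ^ 2 / n ^ 3)" using n by (intro mult_right_mono) auto
    finally show "960 * c3\<^sup>2 * real d ^ 2 / n ^ 3 + ?k * (5 / (2 * real d)) \<le> 1200 * c3\<^sup>2 * real d ^ 2 / n ^ 3" by simp
  qed
  finally show ?thesis .
qed

end

section \<open>Gaussian approximation of the inversion integral\<close>

lemma exp_cos_bound: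
  fixes a b :: real
  shows "\<bar>exp a * cos b - 1\<bar> \<le> exp \<bar>a\<bar> * (\<bar>a\<bar> + b\<^sup>2 / 2)"
proof -
  have "\<bar>exp a - 1\<bar> \<le> \<bar>a\<bar> * exp \<bar>a\<bar>"
  proof (cases "0 \<le> a")
    case True
    have "1 - a \<le> exp (- a)" using exp_ge_add_one_self[of "- a"] by simp
    then have "exp a * (1 - a) \<le> exp a * exp (- a)" by (intro mult_left_mono) auto
    then show ?thesis using True by (simp add: exp_minus algebra_simps)
  next
    case False
    have "1 + a \<le> exp a" by (rule exp_ge_add_one_self)
    moreover have "exp a \<le> 1" using False by simp
    moreover have "- a * 1 \<le> - a * exp (- a)" using False by (intro mult_left_mono) auto
    ultimately have "1 - exp a \<le> - (a * exp (- a))" by linarith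
    then show ?thesis using False \<open>exp a \<le> 1\<close> by (simp add: abs_if)
  qed
  moreover have "exp a * \<bar>cos b - 1\<bar> \<le> exp \<bar>a\<bar> * (b\<^sup>2 / 2)"
  proof (intro mult_mono)
    have "1 - cos b = 2 * (sin (b / 2))\<^sup>2" using cos_double_sin[of "b / 2"] by simp
    also have "\<dots> \<le> 2 * (b / 2)\<^sup>2"
      by (intro mult_left_mono abs_le_square_iff[THEN iffD1] abs_sin_x_le_abs_x) simp
    finally show "\<bar>cos b - 1\<bar> \<le> b\<^sup>2 / 2" by (simp add: power2_eq_square)
  qed auto
  moreover have "\<bar>exp a * cos b - 1\<bar> \<le> exp a * \<bar>cos b - 1\<bar> + \<bar>exp a - 1\<bar>"
  proof -
    have "exp a * cos b - 1 = exp a * (cos b - 1) + (exp a - 1)" by (simp add: algebra_simps)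
    then show ?thesis by (metis abs_exp_cancel abs_mult abs_triangle_ineq)
  qed
  ultimately show ?thesis by (simp add: algebra_simps)
qed

context charlog_n
begin

definition eps :: real where "eps = real d ^ 2 / n"

text \<open>
  The exponent \<open>n Re L\<close> without its Gaussian part.
\<close>

definition rem :: "(nat \<Rightarrow> real) \<Rightarrow> real" where "rem x = n * (Re (L x) + dot d x x / 2)"

lemma rem_le:
  assumes v: "vnorm d x < \<rho>"
  shows "\<bar>rem x\<bar> \<le> c4 / (24 * n) * (n * dot d x x)\<^sup>2" and "\<bar>rem x\<bar> \<le> 40 * c4 * eps"
proof -
  have "\<bar>rem x\<bar> = n * \<bar>Re (L x) + dot d x x / 2\<bar>" using n by (simp add: rem_def abs_mult)
  also have "\<dots> \<le> n * (c4 * vnorm d x ^ 4 / 24)"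
    using Re_L_taylor[OF v] n unfolding vnorm_sq by (intro mult_left_mono) auto
  also have "vnorm d x ^ 4 = (dot d x x)\<^sup>2" using vnorm_sq[of x d] by (metis mult_2 numeral_Bit0 power2_eq_square power_add)
  also have "n * (c4 * (dot d x x)\<^sup>2 / 24) = c4 / (24 * n) * (n * dot d x x)\<^sup>2"
    using n by (simp add: power2_eq_square)
  finally show 1: "\<bar>rem x\<bar> \<le> c4 / (24 * n) * (n * dot d x x)\<^sup>2" .
  have "dot d x x \<le> \<rho>\<^sup>2" unfolding vnorm_sq[symmetric] using v by (intro power_mono) auto
  then have "n * dot d x x \<le> 25/4 * real d" unfolding n_rho_sq[symmetric] using n by (intro mult_left_mono) auto
  moreover have "0 \<le> n * dot d x x" unfolding vnorm_sq[symmetric] using n by simp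
  ultimately have "(n * dot d x x)\<^sup>2 \<le> (25/4 * real d)\<^sup>2" by (intro power_mono)
  then have "c4 / (24 * n) * (n * dot d x x)\<^sup>2 \<le> c4 / (24 * n) * (25/4 * real d)\<^sup>2"
    using c4_nonneg n by (intro mult_left_mono) auto
  also have "\<dots> = 625/384 * (c4 * eps)" using n by (simp add: eps_def power2_eq_square)
  also have "\<dots> \<le> 40 * (c4 * eps)" using c4_nonneg n by (intro mult_right_mono) (auto simp: eps_def)
  finally show "\<bar>rem x\<bar> \<le> 40 * c4 * eps" using 1 by simp
qed

lemma inner_bound:
  "(\<integral>\<^sup>+x. ennreal \<bar>exp (rem x) * cos (n * Im (L x)) - 1\<bar> * (if vnorm d x < \<rho> then 1 else 0) \<partial>gauss d n)
    \<le> ennreal (600 * (exp (40 * c4 * eps) * (c3\<^sup>2 + c4) * eps))"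
proof -
  let ?E = "exp (40 * c4 * eps)"
  let ?a = "?E * (c4 / (24 * n))" let ?b = "?E * (n\<^sup>2 / 2)"
  have eps: "0 \<le> eps" using n by (simp add: eps_def)
  have "(\<integral>\<^sup>+x. ennreal \<bar>exp (rem x) * cos (n * Im (L x)) - 1\<bar> * (if vnorm d x < \<rho> then 1 else 0) \<partial>gauss d n)
     \<le> (\<integral>\<^sup>+x. ennreal ?a * ennreal ((n * dot d x x)\<^sup>2) + ennreal ?b * (ennreal ((Im (L x))\<^sup>2) * (if vnorm d x < \<rho> then 1 else 0)) \<partial>gauss d n)"
  proof (rule nn_integral_mono)
    fix x
    show "ennreal \<bar>exp (rem x) * cos (n * Im (L x)) - 1\<bar> * (if vnorm d x < \<rho> then 1 else 0)
      \<le> ennreal ?a * ennreal ((n * dot d x x)\<^sup>2) + ennreal ?b * (ennreal ((Im (L x))\<^sup>2) * (if vnorm d x < \<rho> then 1 else 0))"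
    proof (cases "vnorm d x < \<rho>")
      case True
      have "\<bar>exp (rem x) * cos (n * Im (L x)) - 1\<bar> \<le> exp \<bar>rem x\<bar> * (\<bar>rem x\<bar> + (n * Im (L x))\<^sup>2 / 2)" by (rule exp_cos_bound)
      also have "\<dots> \<le> ?E * (c4 / (24 * n) * (n * dot d x x)\<^sup>2 + (n * Im (L x))\<^sup>2 / 2)"
        using rem_le[OF True] by (intro mult_mono add_mono) auto
      also have "\<dots> = ?a * (n * dot d x x)\<^sup>2 + ?b * (Im (L x))\<^sup>2" by (simp add: algebra_simps power_mult_distrib)
      finally have le: "\<bar>exp (rem x) * cos (n * Im (L x)) - 1\<bar> \<le> ?a * (n * dot d x x)\<^sup>2 + ?b * (Im (L x))\<^sup>2" .
      have "ennreal (?a * (n * dot d x x)\<^sup>2 + ?b * (Im (L x))\<^sup>2) = ennreal ?a * ennreal ((n * dot d x x)\<^sup>2) + ennreal ?b * ennreal ((Im (L x))\<^sup>2)"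
      proof -
        have a: "0 \<le> ?a" using n c4_nonneg by simp
        have b: "0 \<le> ?b" by simp
        show ?thesis by (subst ennreal_plus) (use a b in \<open>auto intro!: mult_nonneg_nonneg simp only: ennreal_mult[OF a] ennreal_mult[OF b] zero_le_power2\<close>)
      qed
      then show ?thesis using ennreal_leI[OF le] True by simp
    qed simp
  qed
  also have "\<dots> = ennreal ?a * (\<integral>\<^sup>+x. ennreal ((n * dot d x x)\<^sup>2) \<partial>gauss d n)
     + ennreal ?b * (\<integral>\<^sup>+x. ennreal ((Im (L x))\<^sup>2) * (if vnorm d x < \<rho> then 1 else 0) \<partial>gauss d n)"
    by (subst nn_integral_add, measurable, subst nn_integral_cmult, measurable, subst nn_integral_cmult, measurable)
  also have "\<dots> \<le> ennreal ?a * ennreal (64 * real d ^ 2) + ennreal ?b * ennreal (1200 * c3\<^sup>2 * real d ^ 2 / n ^ 3)"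
    by (intro add_mono mult_left_mono gauss_fourth_moment[OF n d1] Im_L_sq_ball) auto
  also have "\<dots> = ennreal (?a * (64 * real d ^ 2) + ?b * (1200 * c3\<^sup>2 * real d ^ 2 / n ^ 3))"
  proof -
    have a: "0 \<le> ?a" using n c4_nonneg by simp
    have b: "0 \<le> ?b" by simp
    have c: "0 \<le> 64 * real d ^ 2" "0 \<le> 1200 * c3\<^sup>2 * real d ^ 2 / n ^ 3" using n by auto
    show ?thesis
      unfolding ennreal_mult[OF a c(1), symmetric] ennreal_mult[OF b c(2), symmetric]
      by (rule ennreal_plus[symmetric]) (rule mult_nonneg_nonneg[OF a c(1)], rule mult_nonneg_nonneg[OF b c(2)])
  qed
  also have "\<dots> \<le> ennreal (600 * (exp (40 * c4 * eps) * (c3\<^sup>2 + c4) * eps))"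
  proof (rule ennreal_leI)
    have "?a * (64 * real d ^ 2) + ?b * (1200 * c3\<^sup>2 * real d ^ 2 / n ^ 3) = ?E * ((8/3 * c4 + 600 * c3\<^sup>2) * eps)"
      using n by (simp add: eps_def field_simps power2_eq_square power3_eq_cube)
    also have "\<dots> \<le> ?E * ((600 * c4 + 600 * c3\<^sup>2) * eps)"
      using c4_nonneg eps by (intro mult_left_mono mult_right_mono) auto
    finally show "?a * (64 * real d ^ 2) + ?b * (1200 * c3\<^sup>2 * real d ^ 2 / n ^ 3) \<le> 600 * (?E * (c3\<^sup>2 + c4) * eps)"
      by (simp add: algebra_simps)
  qed
  finally show ?thesis .
qed

text \<open>
  The reflection \<open>x \<mapsto> - x\<close> turns \<open>\<chi>\<close> into its conjugate, so the integral over the ball is that of the real part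
  \<open>exp (n Re L) cos (n Im L)\<close>, to be compared with the Gaussian density. The hypothesis on the outer part also
  provides the integrability of \<open>\<chi>\<^sup>n\<close>, without which the integral would be zero by convention.
\<close>

lemma core_bound:
  fixes N :: nat
  assumes N: "n = real N" and \<eta>: "0 \<le> \<eta>"
    and out: "ennreal (sqrt (n / (2 * pi)) ^ d) * (\<integral>\<^sup>+x. ennreal (cmod (chi x) ^ N) * indicator {x \<in> Rd d. \<rho> \<le> vnorm d x} x \<partial>leb d) \<le> ennreal \<eta>"
  shows "cmod (of_real (sqrt (n / (2 * pi)) ^ d) * (\<integral>x. chi x ^ N \<partial>leb d) - 1)
     \<le> 600 * (exp (40 * c4 * eps) * (c3\<^sup>2 + c4) * eps) + exp (- real d) + \<eta>"
proof -
  define k where "k = sqrt (n / (2 * pi)) ^ d"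
  have k: "0 < k" using n by (simp add: k_def)
  interpret g: prob_space "gauss d n" by (rule prob_space_gauss[OF n])
  define B where "B = {x \<in> Rd d. vnorm d x < \<rho>}"
  define B' where "B' = {x \<in> Rd d. \<rho> \<le> vnorm d x}"
  have [measurable]: "B \<in> sets (leb d)" "B' \<in> sets (leb d)"
    unfolding B_def B'_def space_leb[symmetric] by measurable
  define u where "u = (\<lambda>x. indicator B x *\<^sub>R chi x ^ N)"
  define w where "w = (\<lambda>x. indicator B' x *\<^sub>R chi x ^ N)"
  have [measurable]: "u \<in> borel_measurable (leb d)" "w \<in> borel_measurable (leb d)"
    unfolding u_def w_def by measurable
  have Bfin: "emeasure (leb d) B < \<infinity>"
  proof -
    have [measurable]: "{x \<in> Rd d. vnorm d x \<le> \<rho>} \<in> sets (leb d)" unfolding space_leb[symmetric] by measurable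
    have "ennreal k * emeasure (leb d) {x \<in> Rd d. vnorm d x \<le> \<rho>} < \<infinity>"
      using emeasure_ball_le[OF n d1 rho] by (simp add: k_def le_less_trans[OF _ ennreal_less_top])
    then have "emeasure (leb d) {x \<in> Rd d. vnorm d x \<le> \<rho>} < \<infinity>" using k by (auto simp: ennreal_mult_less_top)
    moreover have "emeasure (leb d) B \<le> emeasure (leb d) {x \<in> Rd d. vnorm d x \<le> \<rho>}"
    proof (rule emeasure_mono)
      show "B \<subseteq> {x \<in> Rd d. vnorm d x \<le> \<rho>}" unfolding B_def by (blast intro: less_imp_le)
    qed measurable
    ultimately show ?thesis by (meson le_less_trans)
  qed
  have ui: "integrable (leb d) u"
  proof (rule Bochner_Integration.integrable_bound[of _ "indicator B :: _ \<Rightarrow> real"])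
    show "integrable (leb d) (indicator B :: _ \<Rightarrow> real)" using Bfin by (simp add: integrable_indicator_iff)
    show "AE x in leb d. norm (u x) \<le> norm (indicator B x :: real)"
      using chi_le_1 by (intro AE_I2) (auto simp: u_def indicator_def norm_power power_le_one)
  qed measurable
  have wn: "ennreal k * (\<integral>\<^sup>+x. ennreal (norm (w x)) \<partial>leb d) \<le> ennreal \<eta>"
  proof -
    have "(\<lambda>x. ennreal (norm (w x))) = (\<lambda>x. ennreal (cmod (chi x) ^ N) * indicator B' x)"
      by (auto simp: w_def indicator_def norm_power)
    then show ?thesis using out by (simp add: k_def B'_def)
  qed
  have wi: "integrable (leb d) w"
  proof (rule integrableI_bounded)
    have "ennreal k * (\<integral>\<^sup>+x. ennreal (norm (w x)) \<partial>leb d) < \<infinity>" using wn by (simp add: le_less_trans[OF _ ennreal_less_top])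
    then show "(\<integral>\<^sup>+x. ennreal (norm (w x)) \<partial>leb d) < \<infinity>" using k by (auto simp: ennreal_mult_less_top)
  qed measurable
  have "(\<integral>x. chi x ^ N \<partial>leb d) = (\<integral>x. u x + w x \<partial>leb d)"
    by (rule Bochner_Integration.integral_cong) (auto simp: u_def w_def B_def B'_def indicator_def space_leb)
  also have "\<dots> = (\<integral>x. u x \<partial>leb d) + (\<integral>x. w x \<partial>leb d)" by (rule Bochner_Integration.integral_add[OF ui wi])
  finally have split: "(\<integral>x. chi x ^ N \<partial>leb d) = (\<integral>x. u x \<partial>leb d) + (\<integral>x. w x \<partial>leb d)" .
  have w_le: "cmod (of_real k * (\<integral>x. w x \<partial>leb d)) \<le> \<eta>"
  proof -
    have "ennreal (cmod (of_real k * (\<integral>x. w x \<partial>leb d))) = ennreal k * ennreal (cmod (\<integral>x. w x \<partial>leb d))"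
      using k by (simp add: norm_mult ennreal_mult)
    also have "\<dots> \<le> ennreal k * (\<integral>\<^sup>+x. ennreal (norm (w x)) \<partial>leb d)"
      by (intro mult_left_mono integral_norm_bound_ennreal wi) simp
    also note wn
    finally show ?thesis using \<eta> by simp
  qed
  have real: "(\<integral>x. u x \<partial>leb d) = of_real (\<integral>x. Re (u x) \<partial>leb d)"
  proof -
    let ?T = "\<lambda>x. \<lambda>i\<in>{..<d}. - x i :: real"
    have Tm: "?T \<in> leb d \<rightarrow>\<^sub>M leb d" by measurable
    have "distr (leb d) (leb d) ?T = leb d" using leb_affine[of "- 1" d "\<lambda>_. 0"] by simp
    then have "(\<integral>x. u x \<partial>leb d) = (\<integral>x. u x \<partial>distr (leb d) (leb d) ?T)" by simp
    also have "\<dots> = (\<integral>x. u (?T x) \<partial>leb d)" by (rule integral_distr[OF Tm]) measurable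
    also have "\<dots> = (\<integral>x. cnj (u x) \<partial>leb d)"
    proof (rule Bochner_Integration.integral_cong[OF refl])
      fix x assume "x \<in> space (leb d)"
      then have "?T x \<in> B \<longleftrightarrow> x \<in> B" by (auto simp: B_def space_leb L2_set_def)
      moreover have "chi (?T x) = cnj (chi x)" using chi_cong[of "?T x" "\<lambda>i. - x i"] chi_uminus[of x] by simp
      ultimately show "u (?T x) = cnj (u x)" by (simp add: u_def indicator_def)
    qed
    also have "\<dots> = cnj (\<integral>x. u x \<partial>leb d)" by simp
    finally have "Im (\<integral>x. u x \<partial>leb d) = 0" by (metis Reals_cnj_iff complex_is_Real_iff)
    then show ?thesis using ui by (simp add: complex_eq_iff)
  qed
  define v where "v = (\<lambda>x. indicator B x * (exp (rem x) * cos (n * Im (L x))))"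
  have [measurable]: "rem \<in> borel_measurable (leb d)" unfolding rem_def[abs_def] by measurable
  have [measurable]: "v \<in> borel_measurable (leb d)" unfolding v_def by measurable
  have ku: "k * Re (u x) = gdens d n x * v x" if "x \<in> space (leb d)" for x
  proof (cases "vnorm d x < \<rho>")
    case True
    have "chi x ^ N = exp (of_nat N * L x)" by (simp add: exp_L[OF True, symmetric] exp_of_nat_mult)
    then have "Re (chi x ^ N) = exp (n * Re (L x)) * cos (n * Im (L x))" by (simp add: Re_exp N)
    moreover have "gdens d n x * exp (rem x) = k * exp (n * Re (L x))"
      by (simp add: gdens_def k_def rem_def exp_add[symmetric] algebra_simps)
    ultimately show ?thesis by (simp add: u_def v_def indicator_def mult.assoc[symmetric])
  qed (simp add: u_def v_def B_def)
  have vi: "integrable (gauss d n) v" and vint: "(\<integral>x. v x \<partial>gauss d n) = k * (\<integral>x. Re (u x) \<partial>leb d)"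
  proof -
    have i: "integrable (leb d) (\<lambda>x. k * Re (u x))" using ui by simp
    then have "integrable (leb d) (\<lambda>x. gdens d n x *\<^sub>R v x)"
      by (simp only: real_scaleR_def ku cong: Bochner_Integration.integrable_cong)
    then show "integrable (gauss d n) v" unfolding gauss_def using n by (subst integrable_density) auto
    have "(\<integral>x. v x \<partial>gauss d n) = (\<integral>x. gdens d n x *\<^sub>R v x \<partial>leb d)"
      unfolding gauss_def using n by (subst integral_density) auto
    also have "\<dots> = (\<integral>x. k * Re (u x) \<partial>leb d)" by (rule Bochner_Integration.integral_cong) (auto simp: ku)
    finally show "(\<integral>x. v x \<partial>gauss d n) = k * (\<integral>x. Re (u x) \<partial>leb d)" by simp
  qed
  have one: "(\<integral>x. 1 \<partial>gauss d n) = (1::real)" using g.prob_space by simp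
  have u_le: "\<bar>k * (\<integral>x. Re (u x) \<partial>leb d) - 1\<bar> \<le> 600 * (exp (40 * c4 * eps) * (c3\<^sup>2 + c4) * eps) + exp (- real d)" (is "_ \<le> ?rhs")
  proof -
    have "k * (\<integral>x. Re (u x) \<partial>leb d) - 1 = (\<integral>x. v x - 1 \<partial>gauss d n)"
      using vi one by (subst Bochner_Integration.integral_diff) (auto simp: vint)
    moreover have "integrable (gauss d n) (\<lambda>x. v x - 1)" using vi by simp
    ultimately have "ennreal \<bar>k * (\<integral>x. Re (u x) \<partial>leb d) - 1\<bar> \<le> (\<integral>\<^sup>+x. ennreal \<bar>v x - 1\<bar> \<partial>gauss d n)"
      using integral_norm_bound_ennreal[of "gauss d n" "\<lambda>x. v x - 1"] by simp
    also have "\<dots> = (\<integral>\<^sup>+x. ennreal \<bar>exp (rem x) * cos (n * Im (L x)) - 1\<bar> * (if vnorm d x < \<rho> then 1 else 0) + indicator B' x \<partial>gauss d n)"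
      by (rule nn_integral_cong) (auto simp: v_def B_def B'_def indicator_def)
    also have "\<dots> = (\<integral>\<^sup>+x. ennreal \<bar>exp (rem x) * cos (n * Im (L x)) - 1\<bar> * (if vnorm d x < \<rho> then 1 else 0) \<partial>gauss d n) + emeasure (gauss d n) B'"
      by (subst nn_integral_add) simp_all
    also have "\<dots> \<le> ennreal (600 * (exp (40 * c4 * eps) * (c3\<^sup>2 + c4) * eps)) + ennreal (exp (- real d))"
    proof (intro add_mono inner_bound)
      have "B' \<subseteq> {x \<in> Rd d. 25/4 * real d \<le> n * dot d x x}"
      proof
        fix x assume "x \<in> B'"
        then have x: "x \<in> Rd d" "\<rho> \<le> vnorm d x" by (auto simp: B'_def)
        have "\<rho>\<^sup>2 \<le> (vnorm d x)\<^sup>2" using x rho by (intro power_mono) auto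
        then have "n * \<rho>\<^sup>2 \<le> n * dot d x x" unfolding vnorm_sq using n by (intro mult_left_mono) auto
        then show "x \<in> {x \<in> Rd d. 25/4 * real d \<le> n * dot d x x}" using x unfolding n_rho_sq by simp
      qed
      moreover have "{x \<in> Rd d. 25/4 * real d \<le> n * dot d x x} \<in> sets (leb d)" unfolding space_leb[symmetric] by measurable
      ultimately have "emeasure (gauss d n) B' \<le> emeasure (gauss d n) {x \<in> Rd d. 25/4 * real d \<le> n * dot d x x}"
        by (intro emeasure_mono) auto
      also note gauss_tail_25_4[OF n]
      finally show "emeasure (gauss d n) B' \<le> ennreal (exp (- real d))" .
    qed
    also have "\<dots> = ennreal ?rhs"
      using c4_nonneg n by (intro ennreal_plus[symmetric]) (auto simp: eps_def)
    finally show ?thesis using c4_nonneg n by (subst (asm) ennreal_le_iff) (auto simp: eps_def)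
  qed
  have "of_real k * (\<integral>x. chi x ^ N \<partial>leb d) - 1 = of_real (k * (\<integral>x. Re (u x) \<partial>leb d) - 1) + of_real k * (\<integral>x. w x \<partial>leb d)"
    unfolding split real by (simp add: algebra_simps)
  then have "cmod (of_real k * (\<integral>x. chi x ^ N \<partial>leb d) - 1) \<le> \<bar>k * (\<integral>x. Re (u x) \<partial>leb d) - 1\<bar> + cmod (of_real k * (\<integral>x. w x \<partial>leb d))"
    by (metis norm_of_real norm_triangle_ineq)
  also have "\<dots> \<le> ?rhs + \<eta>" by (intro add_mono u_le w_le)
  finally show ?thesis by (simp add: k_def)
qed

end

section \<open>Derivatives of the cumulant generating function\<close>

text \<open>
  Iterated partial derivatives are only known on an open set, and the outer derivative needs the inner one on a
  whole piece of the coordinate line.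
\<close>

lemma partial_deriv_eq:
  assumes open_line: "open {h. x(k := h) \<in> A}" and x: "x \<in> A"
    and eq: "\<And>y. y \<in> A \<Longrightarrow> f y = g y"
    and g: "((\<lambda>h. g (x(k := h))) has_real_derivative D) (at (x k))"
  shows "partial_deriv k f x = D"
  unfolding partial_deriv_def
proof (rule DERIV_imp_deriv)
  show "((\<lambda>h. f (x(k := h))) has_real_derivative D) (at (x k))"
    by (rule has_field_derivative_transform_within_open[OF g open_line]) (use x in \<open>auto simp: eq\<close>)
qed

locale law =
  fixes d :: nat and \<mu> :: "(nat \<Rightarrow> real) measure" and V :: "(nat \<Rightarrow> real) set"
  assumes d1: "1 \<le> d" and is_law: "is_law d \<mu>" and A1: "A1 d \<mu> V"
begin

sublocale prob_space \<mu> using is_law by (simp add: is_law_def)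

lemma sets_mu [measurable_cong, simp]: "sets \<mu> = sets (Pi\<^sub>M {..<d} (\<lambda>_. borel))"
  using is_law by (simp add: is_law_def)

lemma comp_meas [measurable (raw)]: "i < d \<Longrightarrow> (\<lambda>x. x i) \<in> borel_measurable \<mu>"
  by measurable

definition W :: "(nat \<Rightarrow> real) \<Rightarrow> real" where "W x = 1 + (\<Sum>i<d. \<bar>x i\<bar>)"

lemma W_ge_1: "1 \<le> W x" by (simp add: W_def sum_nonneg)

lemma comp_le_W: "i < d \<Longrightarrow> \<bar>x i\<bar> \<le> W x"
  using member_le_sum[of i "{..<d}" "\<lambda>i. \<bar>x i\<bar>"] by (simp add: W_def)

lemma W_meas [measurable]: "W \<in> borel_measurable \<mu>" unfolding W_def by measurable

lemma comp_le_vnorm: "i < d \<Longrightarrow> \<bar>x i\<bar> \<le> vnorm d x"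
  using member_le_sum[of i "{..<d}" "\<lambda>i. (x i)\<^sup>2"] unfolding L2_set_def by (intro real_le_rsqrt) simp

definition vnorm4 :: "(nat \<Rightarrow> real) \<Rightarrow> real" where "vnorm4 x = vnorm d x ^ 4"

lemma vnorm_meas_mu [measurable]: "vnorm d \<in> borel_measurable \<mu>" unfolding L2_set_def by measurable

lemma vnorm4_meas [measurable]: "vnorm4 \<in> borel_measurable \<mu>" unfolding vnorm4_def by measurable

lemma vnorm4_bound: "\<exists>K\<ge>0. \<forall>\<tau>\<in>V. integrable \<mu> (\<lambda>x. vnorm4 x * exp (dot d \<tau> x)) \<and> (\<integral>x. vnorm4 x * exp (dot d \<tau> x) \<partial>\<mu>) \<le> K"
proof -
  define s where "s = (SUP \<tau>\<in>V. \<integral>\<^sup>+x. ennreal (vnorm d x ^ 4 * exp (dot d \<tau> x)) \<partial>\<mu>)"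
  have s: "s < \<infinity>" using A1 by (simp add: A1_def s_def)
  show ?thesis
  proof (intro exI[of _ "enn2real s"] conjI ballI)
    fix \<tau> assume "\<tau> \<in> V"
    then have le: "(\<integral>\<^sup>+x. ennreal (vnorm4 x * exp (dot d \<tau> x)) \<partial>\<mu>) \<le> s"
      unfolding s_def vnorm4_def by (rule SUP_upper)
    have nn: "0 \<le> vnorm4 x" for x by (simp add: vnorm4_def)
    show i: "integrable \<mu> (\<lambda>x. vnorm4 x * exp (dot d \<tau> x))"
    proof (rule integrableI_bounded)
      have "(\<integral>\<^sup>+x. ennreal (norm (vnorm4 x * exp (dot d \<tau> x))) \<partial>\<mu>) = (\<integral>\<^sup>+x. ennreal (vnorm4 x * exp (dot d \<tau> x)) \<partial>\<mu>)"
        by (simp add: nn)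
      then show "(\<integral>\<^sup>+x. ennreal (norm (vnorm4 x * exp (dot d \<tau> x))) \<partial>\<mu>) < \<infinity>" using le s by simp
    qed measurable
    have "ennreal (\<integral>x. vnorm4 x * exp (dot d \<tau> x) \<partial>\<mu>) \<le> s"
      using le nn_integral_eq_integral[OF i] nn by simp
    then show "(\<integral>x. vnorm4 x * exp (dot d \<tau> x) \<partial>\<mu>) \<le> enn2real s"
      using s by (subst ennreal_le_iff[symmetric]) (simp_all add: ennreal_enn2real)
  qed simp
qed

lemma W4_le: "W x ^ 4 \<le> (real d + 1) ^ 4 * (1 + vnorm4 x)"
proof -
  have "W x \<le> 1 + (\<Sum>i<d. vnorm d x)" unfolding W_def by (intro add_left_mono sum_mono comp_le_vnorm) simp
  also have "\<dots> \<le> (real d + 1) * max 1 (vnorm d x)"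
  proof -
    have "1 + real d * vnorm d x \<le> max 1 (vnorm d x) + real d * max 1 (vnorm d x)" by (intro add_mono mult_left_mono) auto
    then show ?thesis by (simp add: algebra_simps)
  qed
  finally have "W x ^ 4 \<le> ((real d + 1) * max 1 (vnorm d x)) ^ 4" using W_ge_1[of x] by (intro power_mono) auto
  also have "\<dots> = (real d + 1) ^ 4 * (max 1 (vnorm d x)) ^ 4" by (rule power_mult_distrib)
  also have "\<dots> \<le> (real d + 1) ^ 4 * (1 + vnorm4 x)"
    by (intro mult_left_mono) (auto simp: vnorm4_def max_def)
  finally show ?thesis .
qed

text \<open>
  The fourth moment controls the exponential where \<open>\<parallel>x\<parallel> \<ge> 1\<close>; elsewhere the exponential is bounded.
\<close>

lemma exp_integrable:
  assumes "\<tau> \<in> V"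
  shows "integrable \<mu> (\<lambda>x. exp (dot d \<tau> x))"
proof -
  obtain K where "integrable \<mu> (\<lambda>x. vnorm4 x * exp (dot d \<tau> x))" using vnorm4_bound assms by blast
  then have i: "integrable \<mu> (\<lambda>x. exp (\<Sum>i<d. \<bar>\<tau> i\<bar>) + vnorm4 x * exp (dot d \<tau> x))" by simp
  show ?thesis
  proof (rule Bochner_Integration.integrable_bound[OF i])
    show "AE x in \<mu>. norm (exp (dot d \<tau> x)) \<le> norm (exp (\<Sum>i<d. \<bar>\<tau> i\<bar>) + vnorm4 x * exp (dot d \<tau> x))"
    proof (rule AE_I2)
      fix x
      have nn: "0 \<le> vnorm4 x" by (simp add: vnorm4_def)
      have "exp (dot d \<tau> x) \<le> exp (\<Sum>i<d. \<bar>\<tau> i\<bar>) + vnorm4 x * exp (dot d \<tau> x)"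
      proof (cases "vnorm d x \<le> 1")
        case True
        have "dot d \<tau> x \<le> (\<Sum>i<d. \<bar>\<tau> i\<bar>)"
        proof (rule sum_mono)
          fix i assume "i \<in> {..<d}"
          then have "\<bar>x i\<bar> \<le> 1" using comp_le_vnorm[of i x] True by simp
          then have "\<bar>\<tau> i\<bar> * \<bar>x i\<bar> \<le> \<bar>\<tau> i\<bar> * 1" by (intro mult_left_mono) auto
          then show "\<tau> i * x i \<le> \<bar>\<tau> i\<bar>" using abs_ge_self[of "\<tau> i * x i"] by (simp add: abs_mult)
        qed
        then have "exp (dot d \<tau> x) \<le> exp (\<Sum>i<d. \<bar>\<tau> i\<bar>)" by simp
        then show ?thesis using nn by (simp add: add_increasing2)
      next
        case False
        then have "1 \<le> vnorm4 x" unfolding vnorm4_def by (intro one_le_power) simp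
        then have "1 * exp (dot d \<tau> x) \<le> vnorm4 x * exp (dot d \<tau> x)" by (intro mult_right_mono) auto
        then show ?thesis by (simp add: add_increasing)
      qed
      then show "norm (exp (dot d \<tau> x)) \<le> norm (exp (\<Sum>i<d. \<bar>\<tau> i\<bar>) + vnorm4 x * exp (dot d \<tau> x))" by simp
    qed
  qed measurable
qed

lemma W4_integrable:
  assumes "\<tau> \<in> V"
  shows "integrable \<mu> (\<lambda>x. W x ^ 4 * exp (dot d \<tau> x))"
proof -
  have i: "integrable \<mu> (\<lambda>x. (real d + 1) ^ 4 * (exp (dot d \<tau> x) + vnorm4 x * exp (dot d \<tau> x)))"
    using vnorm4_bound exp_integrable assms by (intro integrable_mult_right Bochner_Integration.integrable_add) blast+
  show ?thesis
  proof (rule Bochner_Integration.integrable_bound[OF i])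
    show "AE x in \<mu>. norm (W x ^ 4 * exp (dot d \<tau> x)) \<le> norm ((real d + 1) ^ 4 * (exp (dot d \<tau> x) + vnorm4 x * exp (dot d \<tau> x)))"
    proof (rule AE_I2)
      fix x
      have "W x ^ 4 * exp (dot d \<tau> x) \<le> ((real d + 1) ^ 4 * (1 + vnorm4 x)) * exp (dot d \<tau> x)" by (intro mult_right_mono W4_le) simp
      also have "\<dots> = (real d + 1) ^ 4 * (exp (dot d \<tau> x) + vnorm4 x * exp (dot d \<tau> x))" by (simp add: algebra_simps)
      finally show "norm (W x ^ 4 * exp (dot d \<tau> x)) \<le> norm ((real d + 1) ^ 4 * (exp (dot d \<tau> x) + vnorm4 x * exp (dot d \<tau> x)))"
        using W_ge_1[of x] by simp
    qed
  qed measurable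
qed

lemma integrable_W4:
  fixes g :: "(nat \<Rightarrow> real) \<Rightarrow> 'b::{banach, second_countable_topology}"
  assumes \<tau>: "\<tau> \<in> V" and [measurable]: "g \<in> borel_measurable \<mu>" and le: "\<And>x. norm (g x) \<le> C * W x ^ 4"
  shows "integrable \<mu> (\<lambda>x. exp (dot d \<tau> x) *\<^sub>R g x)"
proof (rule Bochner_Integration.integrable_bound[of \<mu> "\<lambda>x. C * (W x ^ 4 * exp (dot d \<tau> x))"])
  show "integrable \<mu> (\<lambda>x. C * (W x ^ 4 * exp (dot d \<tau> x)))" using W4_integrable[OF \<tau>] by simp
  show "AE x in \<mu>. norm (exp (dot d \<tau> x) *\<^sub>R g x) \<le> norm (C * (W x ^ 4 * exp (dot d \<tau> x)))"
  proof (rule AE_I2)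
    fix x
    have "exp (dot d \<tau> x) * norm (g x) \<le> exp (dot d \<tau> x) * (C * W x ^ 4)" by (intro mult_left_mono le) simp
    also have "\<dots> \<le> norm (C * (W x ^ 4 * exp (dot d \<tau> x)))" by (simp add: mult_ac)
    finally show "norm (exp (dot d \<tau> x) *\<^sub>R g x) \<le> norm (C * (W x ^ 4 * exp (dot d \<tau> x)))" by simp
  qed
qed measurable

lemma V_sub: "V \<subseteq> Rd d"
  using A1 openin_subset[of "powertop_real {..<d}" V] by (auto simp: A1_def)

lemma open_line:
  assumes "\<tau> \<in> V" "i < d"
  shows "open {h. \<tau>(i := h) \<in> V}"
proof -
  have ext: "\<tau> \<in> Rd d" using assms V_sub by auto
  have "continuous_map euclideanreal (powertop_real {..<d}) (\<lambda>h. \<tau>(i := h))"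
    unfolding continuous_map_componentwise
  proof (intro conjI ballI)
    show "(\<lambda>h. \<tau>(i := h)) ` topspace euclideanreal \<subseteq> extensional {..<d}"
      using ext assms by (auto simp: extensional_def PiE_iff)
    fix k assume "k \<in> {..<d}"
    show "continuous_map euclideanreal euclideanreal (\<lambda>h. (\<tau>(i := h)) k)"
      by (cases "k = i") auto
  qed
  then have "openin euclideanreal {h \<in> topspace euclideanreal. \<tau>(i := h) \<in> V}"
    using A1 by (intro openin_continuous_map_preimage) (auto simp: A1_def)
  then show ?thesis by simp
qed

lemma exp_quotient_le:
  fixes h z \<eta> :: real
  assumes h: "h \<noteq> 0" "\<bar>h\<bar> \<le> \<eta>"
  shows "\<bar>(exp (h * z) - 1) / h\<bar> \<le> \<bar>z\<bar> * (exp (\<eta> * z) + exp (- (\<eta> * z)))"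
proof -
  have "\<bar>exp a - 1\<bar> \<le> \<bar>a\<bar> * exp \<bar>a\<bar>" for a :: real
    using exp_cos_bound[of a 0] by (simp add: mult.commute)
  from this[of "h * z"] have "\<bar>exp (h * z) - 1\<bar> / \<bar>h\<bar> \<le> \<bar>h * z\<bar> * exp \<bar>h * z\<bar> / \<bar>h\<bar>" by (rule divide_right_mono) simp
  also have "\<dots> = \<bar>z\<bar> * exp \<bar>h * z\<bar>" using h by (simp add: abs_mult)
  also have "\<dots> \<le> \<bar>z\<bar> * exp (\<eta> * \<bar>z\<bar>)" using h by (intro mult_left_mono) (auto simp: abs_mult mult_right_mono)
  also have "exp (\<eta> * \<bar>z\<bar>) \<le> exp (\<eta> * z) + exp (- (\<eta> * z))" by (cases "0 \<le> z") auto
  finally show ?thesis by (simp add: abs_divide mult_left_mono)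
qed

text \<open>
  On a coordinate segment inside the open domain, the exponential is dominated by the sum of its values at the two
  ends, which are integrable against fourth powers.
\<close>

lemma tilted_integral_deriv:
  assumes \<tau>: "\<tau> \<in> V" and i: "i < d" and g[measurable]: "g \<in> borel_measurable \<mu>" and le: "\<And>x. \<bar>g x\<bar> \<le> C * W x ^ 3"
  shows "((\<lambda>h. \<integral>x. exp (dot d (\<tau>(i := h)) x) * g x \<partial>\<mu>) has_real_derivative (\<integral>x. exp (dot d \<tau> x) * (x i * g x) \<partial>\<mu>)) (at (\<tau> i))"
proof -
  obtain \<eta>0 where \<eta>0: "0 < \<eta>0" "ball (\<tau> i) \<eta>0 \<subseteq> {h. \<tau>(i := h) \<in> V}"
    using openE[OF open_line[OF \<tau> i], of "\<tau> i"] \<tau> by (auto simp del: subset_iff)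
  define \<eta> where "\<eta> = \<eta>0 / 2"
  have \<eta>: "0 < \<eta>" "\<eta> < \<eta>0" using \<eta>0 by (auto simp: \<eta>_def)
  have inV: "\<tau>(i := h) \<in> V" if "\<bar>h - \<tau> i\<bar> \<le> \<eta>" for h
  proof -
    have "h \<in> ball (\<tau> i) \<eta>0" using that \<eta> by (simp add: dist_real_def abs_minus_commute)
    then show ?thesis using \<eta>0(2) by blast
  qed
  have dot_upd: "dot d (\<tau>(i := h)) x = dot d \<tau> x + (h - \<tau> i) * x i" for h x
  proof -
    have "dot d (\<tau>(i := h)) x = (\<Sum>j<d. \<tau> j * x j + (if j = i then (h - \<tau> i) * x i else 0))"
      by (intro sum.cong refl) (auto simp: algebra_simps)
    then show ?thesis using i by (simp add: sum.distrib)
  qed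
  let ?S = "ball (\<tau> i) \<eta>"
  have C0: "\<bar>x i * g x\<bar> \<le> C * W x ^ 4" for x
  proof -
    have "\<bar>x i\<bar> * \<bar>g x\<bar> \<le> W x * (C * W x ^ 3)" using W_ge_1[of x] by (intro mult_mono le comp_le_W i) auto
    then show ?thesis by (simp add: abs_mult power_numeral_reduce mult_ac)
  qed
  have g4: "\<bar>g x\<bar> \<le> \<bar>C\<bar> * W x ^ 4" for x
  proof -
    have "\<bar>g x\<bar> \<le> C * W x ^ 3" by (rule le)
    also have "\<dots> \<le> \<bar>C\<bar> * W x ^ 4" using W_ge_1[of x] by (intro mult_mono power_increasing) auto
    finally show ?thesis .
  qed
  have gi: "integrable \<mu> (\<lambda>x. exp (dot d (\<tau>(i := h)) x) * g x)" if "\<bar>h - \<tau> i\<bar> \<le> \<eta>" for h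
    using integrable_W4[OF inV[OF that] g, of "\<bar>C\<bar>"] g4 by simp
  have xg[measurable]: "(\<lambda>x. x i * g x) \<in> borel_measurable \<mu>" using i by measurable
  have xgi: "integrable \<mu> (\<lambda>x. exp (dot d (\<tau>(i := h)) x) * \<bar>x i * g x\<bar>)" if "\<bar>h - \<tau> i\<bar> \<le> \<eta>" for h
    using integrable_W4[OF inV[OF that], of "\<lambda>x. \<bar>x i * g x\<bar>" C] C0 by simp
  have "((\<lambda>y. ((\<integral>x. exp (dot d (\<tau>(i := y)) x) * g x \<partial>\<mu>) - (\<integral>x. exp (dot d (\<tau>(i := \<tau> i)) x) * g x \<partial>\<mu>)) /\<^sub>R (y - \<tau> i))
      \<longlongrightarrow> (\<integral>x. exp (dot d \<tau> x) * (x i * g x) \<partial>\<mu>)) (at (\<tau> i) within ?S)"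
    unfolding tendsto_at_iff_sequentially
  proof (intro allI impI, unfold comp_def)
    fix X :: "nat \<Rightarrow> real" assume X: "\<forall>k. X k \<in> ?S - {\<tau> i}" "X \<longlonglongrightarrow> \<tau> i"
    have Xk: "X k - \<tau> i \<noteq> 0" "\<bar>X k - \<tau> i\<bar> \<le> \<eta>" for k using X(1)[rule_format, of k] by (auto simp: ball_def dist_real_def abs_minus_commute)
    define q where "q = (\<lambda>k x. exp (dot d \<tau> x) * (((exp ((X k - \<tau> i) * x i) - 1) / (X k - \<tau> i)) * g x))"
    have "(\<lambda>k. \<integral>x. q k x \<partial>\<mu>) \<longlonglongrightarrow> (\<integral>x. exp (dot d \<tau> x) * (x i * g x) \<partial>\<mu>)"
    proof (rule integral_dominated_convergence[where w = "\<lambda>x. exp (dot d (\<tau>(i := \<tau> i + \<eta>)) x) * \<bar>x i * g x\<bar> + exp (dot d (\<tau>(i := \<tau> i - \<eta>)) x) * \<bar>x i * g x\<bar>"])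
      show "(\<lambda>x. exp (dot d \<tau> x) * (x i * g x)) \<in> borel_measurable \<mu>" by measurable
      show "q k \<in> borel_measurable \<mu>" for k unfolding q_def using i by measurable
      show "integrable \<mu> (\<lambda>x. exp (dot d (\<tau>(i := \<tau> i + \<eta>)) x) * \<bar>x i * g x\<bar> + exp (dot d (\<tau>(i := \<tau> i - \<eta>)) x) * \<bar>x i * g x\<bar>)"
        using \<eta> by (intro Bochner_Integration.integrable_add xgi) auto
      show "AE x in \<mu>. (\<lambda>k. q k x) \<longlonglongrightarrow> exp (dot d \<tau> x) * (x i * g x)"
      proof (rule AE_I2)
        fix x
        have "((\<lambda>h. exp ((h - \<tau> i) * x i)) has_real_derivative x i) (at (\<tau> i))"
          by (auto intro!: derivative_eq_intros)
        then have "((\<lambda>h. (exp ((h - \<tau> i) * x i) - 1) / (h - \<tau> i)) \<longlongrightarrow> x i) (at (\<tau> i))"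
          by (simp add: has_field_derivative_iff)
        then have "(\<lambda>k. (exp ((X k - \<tau> i) * x i) - 1) / (X k - \<tau> i)) \<longlonglongrightarrow> x i"
          using X unfolding tendsto_at_iff_sequentially comp_def by auto
        then show "(\<lambda>k. q k x) \<longlonglongrightarrow> exp (dot d \<tau> x) * (x i * g x)"
          unfolding q_def by (intro tendsto_mult tendsto_const)
      qed
      show "AE x in \<mu>. norm (q k x) \<le> exp (dot d (\<tau>(i := \<tau> i + \<eta>)) x) * \<bar>x i * g x\<bar> + exp (dot d (\<tau>(i := \<tau> i - \<eta>)) x) * \<bar>x i * g x\<bar>" for k
      proof (rule AE_I2)
        fix x
        have "norm (q k x) = exp (dot d \<tau> x) * (\<bar>(exp ((X k - \<tau> i) * x i) - 1) / (X k - \<tau> i)\<bar> * \<bar>g x\<bar>)"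
          by (simp add: q_def abs_mult)
        also have "\<dots> \<le> exp (dot d \<tau> x) * ((\<bar>x i\<bar> * (exp (\<eta> * x i) + exp (- (\<eta> * x i)))) * \<bar>g x\<bar>)"
          by (intro mult_left_mono mult_right_mono exp_quotient_le Xk) auto
        also have "\<dots> = (exp (dot d \<tau> x) * exp (\<eta> * x i)) * \<bar>x i * g x\<bar> + (exp (dot d \<tau> x) * exp (- (\<eta> * x i))) * \<bar>x i * g x\<bar>"
          by (simp add: algebra_simps abs_mult)
        also have "exp (dot d \<tau> x) * exp (\<eta> * x i) = exp (dot d (\<tau>(i := \<tau> i + \<eta>)) x)" unfolding dot_upd by (simp add: exp_add)
        also have "exp (dot d \<tau> x) * exp (- (\<eta> * x i)) = exp (dot d (\<tau>(i := \<tau> i - \<eta>)) x)" unfolding dot_upd by (simp add: mult_exp_exp)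
        finally show "norm (q k x) \<le> exp (dot d (\<tau>(i := \<tau> i + \<eta>)) x) * \<bar>x i * g x\<bar> + exp (dot d (\<tau>(i := \<tau> i - \<eta>)) x) * \<bar>x i * g x\<bar>" .
      qed
    qed
    moreover have "(\<integral>x. q k x \<partial>\<mu>) = ((\<integral>x. exp (dot d (\<tau>(i := X k)) x) * g x \<partial>\<mu>) - (\<integral>x. exp (dot d (\<tau>(i := \<tau> i)) x) * g x \<partial>\<mu>)) /\<^sub>R (X k - \<tau> i)" for k
    proof -
      have "q k x = (exp (dot d (\<tau>(i := X k)) x) * g x - exp (dot d (\<tau>(i := \<tau> i)) x) * g x) /\<^sub>R (X k - \<tau> i)" for x
      proof -
        have "E * (((e - 1) / h) * z) = (E * e * z - E * z) /\<^sub>R h" for E e h z :: real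
          by (simp add: divide_inverse algebra_simps)
        then show ?thesis unfolding q_def dot_upd exp_add by simp
      qed
      then have "(\<integral>x. q k x \<partial>\<mu>) = (\<integral>x. (exp (dot d (\<tau>(i := X k)) x) * g x - exp (dot d (\<tau>(i := \<tau> i)) x) * g x) /\<^sub>R (X k - \<tau> i) \<partial>\<mu>)" by simp
      also have "\<dots> = (\<integral>x. exp (dot d (\<tau>(i := X k)) x) * g x - exp (dot d (\<tau>(i := \<tau> i)) x) * g x \<partial>\<mu>) /\<^sub>R (X k - \<tau> i)"
        by (rule integral_scaleR_right)
      also have "(\<integral>x. exp (dot d (\<tau>(i := X k)) x) * g x - exp (dot d (\<tau>(i := \<tau> i)) x) * g x \<partial>\<mu>)
        = (\<integral>x. exp (dot d (\<tau>(i := X k)) x) * g x \<partial>\<mu>) - (\<integral>x. exp (dot d (\<tau>(i := \<tau> i)) x) * g x \<partial>\<mu>)"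
        using \<eta> Xk by (intro Bochner_Integration.integral_diff gi) auto
      finally show ?thesis .
    qed
    ultimately show "(\<lambda>k. ((\<integral>x. exp (dot d (\<tau>(i := X k)) x) * g x \<partial>\<mu>) - (\<integral>x. exp (dot d (\<tau>(i := \<tau> i)) x) * g x \<partial>\<mu>)) /\<^sub>R (X k - \<tau> i))
      \<longlonglongrightarrow> (\<integral>x. exp (dot d \<tau> x) * (x i * g x) \<partial>\<mu>)" by simp
  qed
  then have "((\<lambda>h. \<integral>x. exp (dot d (\<tau>(i := h)) x) * g x \<partial>\<mu>) has_vector_derivative (\<integral>x. exp (dot d \<tau> x) * (x i * g x) \<partial>\<mu>)) (at (\<tau> i))"
    unfolding has_vector_derivative_iff_quotient using \<eta> by (subst (asm) at_within_open) auto
  then show ?thesis by (simp add: has_real_derivative_iff_has_vector_derivative)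
qed

text \<open>
  Expectation under the tilted law.
\<close>

definition tmean :: "(nat \<Rightarrow> real) \<Rightarrow> ((nat \<Rightarrow> real) \<Rightarrow> real) \<Rightarrow> real" where
  "tmean \<tau> g = (\<integral>x. exp (dot d \<tau> x) * g x \<partial>\<mu>) / mgf d \<mu> \<tau>"

lemma mgf_pos: "\<tau> \<in> V \<Longrightarrow> 0 < mgf d \<mu> \<tau>"
proof -
  assume \<tau>: "\<tau> \<in> V"
  have "0 < (\<integral>x. exp (dot d \<tau> x) \<partial>\<mu>)"
    using exp_integrable[OF \<tau>] by (subst integral_less_AE_space[of "\<lambda>_. 0", simplified]) (auto simp: emeasure_space_1)
  then show ?thesis by (simp add: mgf_def)
qed

lemma grad_cgf_eq:
  assumes \<tau>: "\<tau> \<in> V" and i: "i < d"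
  shows "partial_deriv i (cgf d \<mu>) \<tau> = tmean \<tau> (\<lambda>x. x i)" "grad_cgf d \<mu> \<tau> i = tmean \<tau> (\<lambda>x. x i)"
proof -
  have 1: "((\<lambda>h. mgf d \<mu> (\<tau>(i := h))) has_real_derivative (\<integral>x. exp (dot d \<tau> x) * x i \<partial>\<mu>)) (at (\<tau> i))"
    using tilted_integral_deriv[OF \<tau> i, of "\<lambda>_. 1" 1] W_ge_1 by (simp add: mgf_def)
  have "((\<lambda>h. ln (mgf d \<mu> (\<tau>(i := h)))) has_real_derivative tmean \<tau> (\<lambda>x. x i)) (at (\<tau> i))"
    using DERIV_chain2[OF DERIV_ln 1] mgf_pos[OF \<tau>] by (simp add: tmean_def divide_inverse mult.commute)
  then show "partial_deriv i (cgf d \<mu>) \<tau> = tmean \<tau> (\<lambda>x. x i)"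
    unfolding cgf_def[abs_def] partial_deriv_def by (rule DERIV_imp_deriv)
  then show "grad_cgf d \<mu> \<tau> i = tmean \<tau> (\<lambda>x. x i)" using i by (simp add: grad_cgf_def nabla_def)
qed

lemma hess_cgf_eq:
  assumes \<tau>: "\<tau> \<in> V" and ij: "i < d" "j < d"
  shows "hess_cgf d \<mu> \<tau> $$ (i, j) = tmean \<tau> (\<lambda>x. x i * x j) - tmean \<tau> (\<lambda>x. x i) * tmean \<tau> (\<lambda>x. x j)"
proof -
  have "partial_deriv i (partial_deriv j (cgf d \<mu>)) \<tau> = tmean \<tau> (\<lambda>x. x i * x j) - tmean \<tau> (\<lambda>x. x i) * tmean \<tau> (\<lambda>x. x j)"
  proof (rule partial_deriv_eq[where A = V])
    show "open {h. \<tau>(i := h) \<in> V}" by (rule open_line[OF \<tau> ij(1)])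
    show "partial_deriv j (cgf d \<mu>) y = tmean y (\<lambda>x. x j)" if "y \<in> V" for y by (rule grad_cgf_eq(1)[OF that ij(2)])
    have 1: "((\<lambda>h. mgf d \<mu> (\<tau>(i := h))) has_real_derivative (\<integral>x. exp (dot d \<tau> x) * x i \<partial>\<mu>)) (at (\<tau> i))"
      using tilted_integral_deriv[OF \<tau> ij(1), of "\<lambda>_. 1" 1] W_ge_1 by (simp add: mgf_def)
    have 2: "((\<lambda>h. \<integral>x. exp (dot d (\<tau>(i := h)) x) * x j \<partial>\<mu>) has_real_derivative (\<integral>x. exp (dot d \<tau> x) * (x i * x j) \<partial>\<mu>)) (at (\<tau> i))"
    proof (rule tilted_integral_deriv[OF \<tau> ij(1), of _ 1])
      show "\<bar>x j\<bar> \<le> 1 * W x ^ 3" for x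
        using comp_le_W[OF ij(2), of x] power_increasing[OF _ W_ge_1, of 1 3 x] by simp
    qed (use ij in measurable)
    show "((\<lambda>h. tmean (\<tau>(i := h)) (\<lambda>x. x j)) has_real_derivative tmean \<tau> (\<lambda>x. x i * x j) - tmean \<tau> (\<lambda>x. x i) * tmean \<tau> (\<lambda>x. x j)) (at (\<tau> i))"
      unfolding tmean_def by (rule DERIV_cong[OF DERIV_divide[OF 2 1]]) (use mgf_pos[OF \<tau>] in \<open>simp_all add: field_simps\<close>)
  qed (rule \<tau>)
  then show ?thesis using ij by (simp add: hess_cgf_def nabla_def)
qed

end

section \<open>The tilted and whitened law\<close>

locale law_point = law d \<mu> V for d \<mu> V +
  fixes \<tau> :: "nat \<Rightarrow> real"
  assumes \<tau>: "\<tau> \<in> V" and pd: "pos_def_mat d (hess_cgf d \<mu> \<tau>)"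
begin

definition phi :: real where "phi = mgf d \<mu> \<tau>"
definition R :: "nat \<Rightarrow> nat \<Rightarrow> real" where "R = (\<lambda>i j. mat_inv_sqrt d (hess_cgf d \<mu> \<tau>) $$ (i, j))"
definition a :: "nat \<Rightarrow> real" where "a i = tmean \<tau> (\<lambda>x. x i)"
definition M :: "(nat \<Rightarrow> real) measure" where "M = density \<mu> (\<lambda>x. ennreal (exp (dot d \<tau> x) / phi))"
text \<open>
  The whitened vector \<open>H\<^sup>-\<^sup>1\<^sup>/\<^sup>2 (x - a)\<close>.
\<close>

definition Y :: "nat \<Rightarrow> (nat \<Rightarrow> real) \<Rightarrow> real" where "Y i x = (\<Sum>j<d. R i j * (x j - a j))"

lemma phi: "0 < phi" using mgf_pos[OF \<tau>] by (simp add: phi_def)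

lemma sets_M [measurable_cong, simp]: "sets M = sets (Pi\<^sub>M {..<d} (\<lambda>_. borel))" by (simp add: M_def)

lemma R_sym: "i < d \<Longrightarrow> j < d \<Longrightarrow> R i j = R j i"
  using mat_inv_sqrt_entries(1)[OF pd _ _ R_def] .

lemma integral_M:
  fixes f :: "(nat \<Rightarrow> real) \<Rightarrow> 'b::{banach, second_countable_topology}"
  assumes f[measurable]: "f \<in> borel_measurable \<mu>"
  shows "(\<integral>x. f x \<partial>M) = (\<integral>x. exp (dot d \<tau> x) *\<^sub>R f x \<partial>\<mu>) /\<^sub>R phi"
    and "integrable M f \<longleftrightarrow> integrable \<mu> (\<lambda>x. exp (dot d \<tau> x) *\<^sub>R f x)"
proof -
  have "(\<integral>x. f x \<partial>M) = (\<integral>x. (exp (dot d \<tau> x) / phi) *\<^sub>R f x \<partial>\<mu>)"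
    unfolding M_def using phi by (intro integral_density) auto
  also have "\<dots> = (\<integral>x. (exp (dot d \<tau> x) *\<^sub>R f x) /\<^sub>R phi \<partial>\<mu>)" by (simp add: divide_inverse mult.commute)
  also have "\<dots> = (\<integral>x. exp (dot d \<tau> x) *\<^sub>R f x \<partial>\<mu>) /\<^sub>R phi" by (rule integral_scaleR_right)
  finally show "(\<integral>x. f x \<partial>M) = (\<integral>x. exp (dot d \<tau> x) *\<^sub>R f x \<partial>\<mu>) /\<^sub>R phi" .
  have "integrable M f \<longleftrightarrow> integrable \<mu> (\<lambda>x. (exp (dot d \<tau> x) / phi) *\<^sub>R f x)"
    unfolding M_def using phi by (intro integrable_density) auto
  also have "\<dots> \<longleftrightarrow> integrable \<mu> (\<lambda>x. inverse phi *\<^sub>R (exp (dot d \<tau> x) *\<^sub>R f x))" by (simp add: divide_inverse mult.commute)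
  also have "\<dots> \<longleftrightarrow> integrable \<mu> (\<lambda>x. exp (dot d \<tau> x) *\<^sub>R f x)"
  proof
    assume "integrable \<mu> (\<lambda>x. inverse phi *\<^sub>R (exp (dot d \<tau> x) *\<^sub>R f x))"
    then have "integrable \<mu> (\<lambda>x. phi *\<^sub>R (inverse phi *\<^sub>R (exp (dot d \<tau> x) *\<^sub>R f x)))"
      by - (rule integrable_scaleR_right, assumption)
    then show "integrable \<mu> (\<lambda>x. exp (dot d \<tau> x) *\<^sub>R f x)" using phi by (simp add: mult.assoc[symmetric])
  qed (intro integrable_scaleR_right)
  finally show "integrable M f \<longleftrightarrow> integrable \<mu> (\<lambda>x. exp (dot d \<tau> x) *\<^sub>R f x)" .
qed

lemma integral_M_real: "f \<in> borel_measurable \<mu> \<Longrightarrow> (\<integral>x. f x \<partial>M) = tmean \<tau> f"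
  by (subst integral_M(1)) (simp_all add: tmean_def phi_def divide_inverse mult.commute)

lemma integrable_M_W4:
  fixes g :: "(nat \<Rightarrow> real) \<Rightarrow> 'b::{banach, second_countable_topology}"
  assumes "g \<in> borel_measurable \<mu>" "\<And>x. norm (g x) \<le> C * W x ^ 4"
  shows "integrable M g"
  using integrable_W4[OF \<tau> assms] integral_M(2)[OF assms(1)] by simp

lemma prob_M: "prob_space M"
proof (rule prob_spaceI)
  have sp: "space M = space \<mu>" by (simp add: M_def)
  have "(\<integral>\<^sup>+x. ennreal (exp (dot d \<tau> x) / phi) \<partial>\<mu>) = ennreal (\<integral>x. exp (dot d \<tau> x) / phi \<partial>\<mu>)"
    using phi exp_integrable[OF \<tau>] by (intro nn_integral_eq_integral) auto
  also have "(\<integral>x. exp (dot d \<tau> x) / phi \<partial>\<mu>) = 1" using phi by (simp add: phi_def mgf_def)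
  finally have "(\<integral>\<^sup>+x. ennreal (exp (dot d \<tau> x) / phi) \<partial>\<mu>) = 1" by simp
  moreover have "emeasure M (space \<mu>) = (\<integral>\<^sup>+x. ennreal (exp (dot d \<tau> x) / phi) * indicator (space \<mu>) x \<partial>\<mu>)"
    unfolding M_def by (intro emeasure_density sets.top) measurable
  moreover have "\<dots> = (\<integral>\<^sup>+x. ennreal (exp (dot d \<tau> x) / phi) \<partial>\<mu>)" by (rule nn_integral_cong) simp
  ultimately show "emeasure M (space M) = 1" unfolding sp by simp
qed

definition Y_scale :: real where "Y_scale = 1 + (\<Sum>i<d. \<Sum>j<d. \<bar>R i j\<bar> * (1 + \<bar>a j\<bar>))"

lemma S_le: "1 + (\<Sum>i<d. \<bar>Y i x\<bar>) \<le> Y_scale * W x"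
proof -
  have "\<bar>Y i x\<bar> \<le> (\<Sum>j<d. \<bar>R i j\<bar> * (1 + \<bar>a j\<bar>)) * W x" if "i < d" for i
  proof -
    have "\<bar>Y i x\<bar> \<le> (\<Sum>j<d. \<bar>R i j * (x j - a j)\<bar>)" unfolding Y_def by (rule sum_abs)
    also have "\<dots> \<le> (\<Sum>j<d. \<bar>R i j\<bar> * (1 + \<bar>a j\<bar>) * W x)"
    proof (rule sum_mono)
      fix j assume "j \<in> {..<d}"
      then have "\<bar>x j - a j\<bar> \<le> W x + \<bar>a j\<bar> * 1" using comp_le_W[of j x] abs_triangle_ineq4[of "x j" "a j"] by simp
      also have "\<dots> \<le> W x + \<bar>a j\<bar> * W x" using W_ge_1[of x] by (intro add_left_mono mult_left_mono) auto
      finally have "\<bar>x j - a j\<bar> \<le> (1 + \<bar>a j\<bar>) * W x" by (simp add: distrib_right)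
      then have "\<bar>R i j\<bar> * \<bar>x j - a j\<bar> \<le> \<bar>R i j\<bar> * ((1 + \<bar>a j\<bar>) * W x)" by (rule mult_left_mono) simp
      then show "\<bar>R i j * (x j - a j)\<bar> \<le> \<bar>R i j\<bar> * (1 + \<bar>a j\<bar>) * W x" by (simp add: abs_mult mult.assoc)
    qed
    finally show ?thesis by (simp add: sum_distrib_right)
  qed
  then have "(\<Sum>i<d. \<bar>Y i x\<bar>) \<le> (\<Sum>i<d. (\<Sum>j<d. \<bar>R i j\<bar> * (1 + \<bar>a j\<bar>)) * W x)" by (intro sum_mono) auto
  then show ?thesis using W_ge_1[of x] by (simp add: Y_scale_def distrib_right sum_distrib_right)
qed

lemma S_pow4_le: "(1 + (\<Sum>i<d. \<bar>Y i x\<bar>)) ^ 4 \<le> Y_scale ^ 4 * W x ^ 4"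
  using power_mono[OF S_le, of x 4] by (simp add: power_mult_distrib sum_nonneg)

lemma Y_meas_mu [measurable]: "Y i \<in> borel_measurable \<mu>" unfolding Y_def by measurable

sublocale cf: charfun M d Y
proof -
  interpret p: prob_space M by (rule prob_M)
  show "charfun M d Y"
  proof
    show "Y i \<in> borel_measurable M" if "i < d" for i unfolding Y_def by measurable
    show "integrable M (\<lambda>x. (1 + (\<Sum>i<d. \<bar>Y i x\<bar>)) ^ 4)"
    proof (rule integrable_M_W4)
      show "norm ((1 + (\<Sum>i<d. \<bar>Y i x\<bar>)) ^ 4) \<le> Y_scale ^ 4 * W x ^ 4" for x using S_pow4_le[of x] by (simp add: sum_nonneg)
    qed measurable
  qed
qed

lemma W_pow_le: "k \<le> 4 \<Longrightarrow> W x ^ k \<le> W x ^ 4"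
  by (rule power_increasing[OF _ W_ge_1])

lemma int_comp: "i < d \<Longrightarrow> integrable M (\<lambda>x. x i)"
  by (rule integrable_M_W4[of _ 1]) (use order_trans[OF comp_le_W W_pow_le[of 1, simplified]] in auto)

lemma int_comp2: "i < d \<Longrightarrow> j < d \<Longrightarrow> integrable M (\<lambda>x. x i * x j)"
proof (rule integrable_M_W4[of _ 1])
  assume ij: "i < d" "j < d"
  show "norm (x i * x j) \<le> 1 * W x ^ 4" for x
  proof -
    have "\<bar>x i\<bar> * \<bar>x j\<bar> \<le> W x * W x" using W_ge_1[of x] by (intro mult_mono comp_le_W ij) auto
    also have "\<dots> = W x ^ 2" by (simp add: power2_eq_square)
    also have "\<dots> \<le> W x ^ 4" by (rule W_pow_le) simp
    finally show ?thesis by (simp add: abs_mult)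
  qed
qed measurable

lemma mean_x: "i < d \<Longrightarrow> (\<integral>x. x i \<partial>M) = a i"
  by (simp add: integral_M_real a_def)

lemma mean_Y: "i < d \<Longrightarrow> (\<integral>x. Y i x \<partial>M) = 0"
  unfolding Y_def by (subst Bochner_Integration.integral_sum) (auto simp: int_comp mean_x cf.prob_space)

lemma cov_x: 
  assumes "k < d" "l < d"
  shows "(\<integral>x. (x k - a k) * (x l - a l) \<partial>M) = hess_cgf d \<mu> \<tau> $$ (k, l)"
    and "integrable M (\<lambda>x. (x k - a k) * (x l - a l))"
proof -
  have e: "(\<lambda>x. (x k - a k) * (x l - a l)) = (\<lambda>x::nat \<Rightarrow> real. x k * x l - (a l * x k + a k * x l - a k * a l))"
    by (auto simp: algebra_simps)
  show "integrable M (\<lambda>x. (x k - a k) * (x l - a l))" unfolding e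
    using assms by (intro Bochner_Integration.integrable_diff Bochner_Integration.integrable_add integrable_mult_right int_comp int_comp2) auto
  have "(\<integral>x. (x k - a k) * (x l - a l) \<partial>M) = (\<integral>x. x k * x l \<partial>M) - (a l * (\<integral>x. x k \<partial>M) + a k * (\<integral>x. x l \<partial>M) - a k * a l)"
    unfolding e using assms int_comp int_comp2 cf.prob_space by simp
  also have "\<dots> = hess_cgf d \<mu> \<tau> $$ (k, l)"
    using assms by (simp add: mean_x hess_cgf_eq[OF \<tau>] integral_M_real a_def[symmetric])
  finally show "(\<integral>x. (x k - a k) * (x l - a l) \<partial>M) = hess_cgf d \<mu> \<tau> $$ (k, l)" .
qed

lemma cov_Y:
  assumes "i < d" "j < d"
  shows "(\<integral>x. Y i x * Y j x \<partial>M) = (if i = j then 1 else 0)"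
proof -
  have "(\<integral>x. Y i x * Y j x \<partial>M) = (\<integral>x. (\<Sum>k<d. \<Sum>l<d. (R i k * R j l) * ((x k - a k) * (x l - a l))) \<partial>M)"
    unfolding Y_def by (simp add: sum_product mult_ac)
  also have "\<dots> = (\<Sum>k<d. \<integral>x. (\<Sum>l<d. (R i k * R j l) * ((x k - a k) * (x l - a l))) \<partial>M)"
    by (intro Bochner_Integration.integral_sum Bochner_Integration.integrable_sum integrable_mult_right cov_x) auto
  also have "\<dots> = (\<Sum>k<d. \<Sum>l<d. (R i k * R j l) * hess_cgf d \<mu> \<tau> $$ (k, l))"
  proof (rule sum.cong[OF refl])
    fix k assume k: "k \<in> {..<d}"
    have "(\<integral>x. (\<Sum>l<d. (R i k * R j l) * ((x k - a k) * (x l - a l))) \<partial>M) = (\<Sum>l<d. \<integral>x. (R i k * R j l) * ((x k - a k) * (x l - a l)) \<partial>M)"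
      using k by (intro Bochner_Integration.integral_sum integrable_mult_right cov_x) auto
    also have "\<dots> = (\<Sum>l<d. (R i k * R j l) * hess_cgf d \<mu> \<tau> $$ (k, l))"
      using k by (intro sum.cong refl) (simp add: cov_x)
    finally show "(\<integral>x. (\<Sum>l<d. (R i k * R j l) * ((x k - a k) * (x l - a l))) \<partial>M) = (\<Sum>l<d. (R i k * R j l) * hess_cgf d \<mu> \<tau> $$ (k, l))" .
  qed
  also have "\<dots> = (if i = j then 1 else 0)" by (rule mat_inv_sqrt_entries(2)[OF pd assms R_def])
  finally show ?thesis .
qed

definition ell :: "(nat \<Rightarrow> real) \<Rightarrow> real" where "ell t = dot d (whiten d \<mu> \<tau> t) a"

definition Phi :: "(nat \<Rightarrow> real) \<Rightarrow> complex" where "Phi t = cmgf d \<mu> (cpoint d \<mu> \<tau> t)"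

lemma whiten_dot:
  "dot d (whiten d \<mu> \<tau> t) x = (\<Sum>j<d. t j * (\<Sum>i<d. R j i * x i))"
proof -
  have "dot d (whiten d \<mu> \<tau> t) x = (\<Sum>i<d. \<Sum>j<d. R i j * t j * x i)"
    by (simp add: whiten_def R_def sum_distrib_right)
  also have "\<dots> = (\<Sum>j<d. \<Sum>i<d. R i j * t j * x i)" by (rule sum.swap)
  also have "\<dots> = (\<Sum>j<d. \<Sum>i<d. t j * (R j i * x i))" by (intro sum.cong refl) (simp add: R_sym)
  finally show ?thesis by (simp add: sum_distrib_left)
qed

lemma whiten_ip: "dot d (whiten d \<mu> \<tau> t) x = cf.ip t x + ell t"
  unfolding ell_def whiten_dot cf.ip_def Y_def
  by (simp add: right_diff_distrib sum_subtractf)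

text \<open>
  Whitening turns the continued moment generating function into the characteristic function of the whitened
  vector, up to its value at the base point and a phase linear in \<open>t\<close>.
\<close>

lemma Phi_eq: "Phi t = of_real phi * cf.chi t * cis (ell t)"
proof -
  have "exp (\<Sum>i<d. cpoint d \<mu> \<tau> t i * of_real (x i)) = exp (dot d \<tau> x) *\<^sub>R (cis (cf.ip t x) * cis (ell t))" for x
  proof -
    have "(\<Sum>i<d. cpoint d \<mu> \<tau> t i * of_real (x i)) = of_real (dot d \<tau> x) + \<i> * of_real (dot d (whiten d \<mu> \<tau> t) x)"
      by (simp add: cpoint_def distrib_right sum.distrib sum_distrib_left mult.assoc)
    moreover have "exp (of_real u + \<i> * of_real (v + w)) = exp u *\<^sub>R (cis v * cis w)" for u v w :: real
      by (simp add: exp_add cis_conv_exp distrib_left scaleR_conv_of_real exp_of_real)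
    ultimately show ?thesis unfolding whiten_ip by (simp only:)
  qed
  then have "Phi t = (\<integral>x. (exp (dot d \<tau> x) *\<^sub>R cis (cf.ip t x)) * cis (ell t) \<partial>\<mu>)"
    by (simp add: Phi_def cmgf_def)
  also have "\<dots> = (\<integral>x. exp (dot d \<tau> x) *\<^sub>R cis (cf.ip t x) \<partial>\<mu>) * cis (ell t)" by (rule integral_mult_left_zero)
  also have "(\<integral>x. exp (dot d \<tau> x) *\<^sub>R cis (cf.ip t x) \<partial>\<mu>) = of_real phi * cf.chi t"
  proof -
    have "(\<lambda>x. cis (cf.ip t x)) \<in> borel_measurable \<mu>"
      unfolding cf.ip_def cis_conv_exp by measurable
    from integral_M(1)[OF this] show ?thesis using phi
      by (simp add: cf.chi_def cf.G_def scaleR_conv_of_real)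
  qed
  finally show ?thesis .
qed

lemma ell_linear: "ell (\<lambda>i. s * t i) = s * ell t" "ell t = (\<Sum>j<d. t j * (\<Sum>i<d. R j i * a i))"
  by (simp_all add: ell_def whiten_dot sum_distrib_left mult.assoc)

lemma ell_cong: "(\<And>i. i < d \<Longrightarrow> t i = t' i) \<Longrightarrow> ell t = ell t'"
  by (simp add: ell_linear(2)[of t] ell_linear(2)[of t'])

lemma Phi_cong: "(\<And>i. i < d \<Longrightarrow> t i = t' i) \<Longrightarrow> Phi t = Phi t'"
  unfolding Phi_eq using ell_cong[of t t'] cf.chi_cong[of t t'] by simp

lemma ell_deriv:
  assumes "\<And>i. i < d \<Longrightarrow> ((\<lambda>s. p s i) has_real_derivative p' i) (at s)"
  shows "((\<lambda>s. ell (p s)) has_real_derivative ell p') (at s)"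
  unfolding ell_linear(2) using assms by (auto intro!: derivative_eq_intros)

text \<open>
  The linear phase is subtracted so that \<open>L\<close> is a logarithm of the characteristic function of the centred vector.
  It has no effect on derivatives beyond the first.
\<close>

definition L :: "(nat \<Rightarrow> real) \<Rightarrow> complex" where
  "L t = ccgf d \<mu> (cpoint d \<mu> \<tau> t) - of_real (ln phi) - \<i> * of_real (ell t)"

lemma ccgf_Ln: "ccgf d \<mu> (cpoint d \<mu> \<tau> t) = (if Phi t = 0 then 0 else Ln (Phi t))"
  by (intro complex_eqI) (simp_all add: ccgf_def Phi_def[symmetric] Arg_def)

lemma L_Ln: "L t = (if Phi t = 0 then 0 else Ln (Phi t)) - of_real (ln phi) - \<i> * of_real (ell t)"
  by (simp add: L_def ccgf_Ln)

lemma ell_meas [measurable]: "ell \<in> borel_measurable (leb d)"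
  unfolding ell_linear(2)[abs_def] by measurable

lemma Phi_meas [measurable]: "Phi \<in> borel_measurable (leb d)"
  unfolding Phi_eq[abs_def] cis_conv_exp by measurable



lemma L_meas: "L \<in> borel_measurable (leb d)"
  unfolding L_Ln[abs_def] by measurable

end

section \<open>The logarithm and its derivative tensors\<close>

lemma open_vnorm_line: "open {h. x(k := h) \<in> {t. vnorm d t < \<rho>}}"
proof -
  have "continuous_on UNIV (\<lambda>h. vnorm d (x(k := h)))"
    unfolding L2_set_def
  proof (intro continuous_intros)
    show "continuous_on UNIV (\<lambda>h. (x(k := h)) i)" for i by (cases "i = k") auto
  qed
  then show ?thesis by (simp add: open_Collect_less continuous_on_const)
qed

lemma fun_upd_deriv: "((\<lambda>h. (t(k := h)) i) has_real_derivative unitv k i) (at (t k))"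
  by (cases "i = k") (auto simp: unitv_def)

lemma vnorm_restrict: "vnorm d (restrict t {..<d}) = vnorm d t" by (simp add: L2_set_def)

locale law_log = law_point d \<mu> V \<tau> for d \<mu> V \<tau> +
  fixes \<delta> \<rho> :: real
  assumes \<delta>: "0 < \<delta>" and rho: "0 < \<rho>"
    and A4: "\<And>t. t \<in> Rd d \<Longrightarrow> vnorm d t \<le> \<rho> \<Longrightarrow>
      \<bar>Arg (cmgf d \<mu> (cpoint d \<mu> \<tau> t))\<bar> \<le> pi - \<delta> \<and> \<delta> \<le> cmod (cmgf d \<mu> (cpoint d \<mu> \<tau> t))"
begin

lemma A4': "vnorm d t < \<rho> \<Longrightarrow> \<bar>Arg (Phi t)\<bar> < pi \<and> \<delta> \<le> cmod (Phi t)"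
proof -
  assume "vnorm d t < \<rho>"
  then have "vnorm d (restrict t {..<d}) \<le> \<rho>" by (simp add: vnorm_restrict)
  from A4[OF _ this] show ?thesis using \<delta> Phi_cong[of "restrict t {..<d}" t] by (auto simp: Phi_def)
qed

text \<open>
  The bound on the argument keeps the values off the branch cut, so the principal logarithm is differentiable
  there.
\<close>

lemma Phi_nonpos: "vnorm d t < \<rho> \<Longrightarrow> Phi t \<notin> \<real>\<^sub>\<le>\<^sub>0"
proof
  assume t: "vnorm d t < \<rho>" and n: "Phi t \<in> \<real>\<^sub>\<le>\<^sub>0"
  have nz: "Phi t \<noteq> 0" using A4'[OF t] \<delta> by auto
  moreover have "Re (Phi t) \<le> 0" "Im (Phi t) = 0" using n by (auto simp: complex_nonpos_Reals_iff)
  ultimately have "Re (Phi t) < 0 \<and> Im (Phi t) = 0" by (auto simp: complex_eq_iff less_le)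
  then have "Arg (Phi t) = pi" by (simp add: Arg_eq_pi)
  then show False using A4'[OF t] by simp
qed

lemma Phi_nz: "vnorm d t < \<rho> \<Longrightarrow> Phi t \<noteq> 0" using A4' \<delta> by force

lemma chi_nz: "vnorm d t < \<rho> \<Longrightarrow> cf.chi t \<noteq> 0" using Phi_nz[of t] by (auto simp: Phi_eq)

lemma Ln_Phi_deriv:
  assumes p: "\<And>i. i < d \<Longrightarrow> ((\<lambda>s. p s i) has_real_derivative p' i) (at s)" and b: "vnorm d (p s) < \<rho>"
  shows "((\<lambda>s. Ln (Phi (p s))) has_vector_derivative (cf.m1 p' (p s) + \<i> * of_real (ell p'))) (at s)"
proof -
  have 1: "((\<lambda>s. cf.chi (p s)) has_vector_derivative cf.G (cf.iu p') (p s)) (at s)"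
    using cf.G_deriv[OF cf.ord_mono[OF cf.ord_const, of 3 1] p] by (simp add: cf.chi_def)
  have "((\<lambda>s. \<i> * of_real (ell (p s))) has_vector_derivative (\<i> * of_real (ell p'))) (at s)"
    by (intro has_vector_derivative_mult_right has_vector_derivative_of_real ell_deriv p)
  from field_vector_diff_chain_at[OF this DERIV_exp]
  have 2: "((\<lambda>s. cis (ell (p s))) has_vector_derivative (\<i> * of_real (ell p') * cis (ell (p s)))) (at s)"
    by (simp add: cis_conv_exp comp_def mult_ac)
  have "((\<lambda>s. of_real phi * cf.chi (p s) * cis (ell (p s))) has_vector_derivative
     (of_real phi * cf.chi (p s) * (\<i> * of_real (ell p') * cis (ell (p s))) + of_real phi * cf.G (cf.iu p') (p s) * cis (ell (p s)))) (at s)"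
    by (intro has_vector_derivative_mult has_vector_derivative_mult_right 1 2)
  moreover have "of_real phi * cf.chi (p s) * (\<i> * of_real (ell p') * cis (ell (p s))) + of_real phi * cf.G (cf.iu p') (p s) * cis (ell (p s))
    = Phi (p s) * (cf.m1 p' (p s) + \<i> * of_real (ell p'))"
    using chi_nz[OF b] by (simp add: Phi_eq cf.T_def algebra_simps)
  ultimately have 3: "((\<lambda>s. Phi (p s)) has_vector_derivative (Phi (p s) * (cf.m1 p' (p s) + \<i> * of_real (ell p')))) (at s)"
    by (simp add: Phi_eq)
  have "((Ln \<circ> (\<lambda>s. Phi (p s))) has_vector_derivative (Phi (p s) * (cf.m1 p' (p s) + \<i> * of_real (ell p')) * inverse (Phi (p s)))) (at s)"
    by (rule field_vector_diff_chain_at[OF 3]) (rule has_field_derivative_Ln[OF Phi_nonpos[OF b]])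
  moreover have "Phi (p s) * (cf.m1 p' (p s) + \<i> * of_real (ell p')) * inverse (Phi (p s)) = cf.m1 p' (p s) + \<i> * of_real (ell p')"
  proof -
    have "z * c * inverse z = c" if "z \<noteq> 0" for z c :: complex using that by (simp add: field_simps)
    from this[OF Phi_nz[OF b]] show ?thesis .
  qed
  ultimately show ?thesis by (simp only: comp_def)
qed

lemma open_ball_line:
  assumes p: "\<And>i. i < d \<Longrightarrow> ((\<lambda>s. p s i) has_real_derivative p' i) (at s)" and b: "vnorm d (p s) < \<rho>"
  shows "\<forall>\<^sub>F s in nhds s. vnorm d (p s) < \<rho>"
proof -
  have "isCont (\<lambda>s. vnorm d (p s)) s"
    unfolding L2_set_def using p by (intro continuous_intros isCont_sum) (auto intro: DERIV_isCont)
  then have "((\<lambda>s. vnorm d (p s)) \<longlongrightarrow> vnorm d (p s)) (nhds s)"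
    using tendsto_at_iff_tendsto_nhds[of "\<lambda>s. vnorm d (p s)" s] by (simp add: isCont_def)
  from order_tendstoD(2)[OF this b] show ?thesis .
qed

lemma ccgf_deriv:
  assumes p: "\<And>i. i < d \<Longrightarrow> ((\<lambda>s. p s i) has_real_derivative p' i) (at s)" and b: "vnorm d (p s) < \<rho>"
  shows "((\<lambda>s. ccgf d \<mu> (cpoint d \<mu> \<tau> (p s))) has_vector_derivative (cf.m1 p' (p s) + \<i> * of_real (ell p'))) (at s)"
proof -
  have ev: "\<forall>\<^sub>F s in nhds s. Ln (Phi (p s)) = ccgf d \<mu> (cpoint d \<mu> \<tau> (p s))"
  proof -
    have "\<forall>\<^sub>F s in nhds s. vnorm d (p s) < \<rho>" by (rule open_ball_line[where p' = p']) (use p b in auto)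
    then show ?thesis by eventually_elim (use Phi_nz in \<open>simp add: ccgf_Ln\<close>)
  qed
  then obtain A where A: "open A" "s \<in> A" "\<And>s. s \<in> A \<Longrightarrow> Ln (Phi (p s)) = ccgf d \<mu> (cpoint d \<mu> \<tau> (p s))"
    unfolding eventually_nhds by auto
  have "((\<lambda>s. Ln (Phi (p s))) has_vector_derivative (cf.m1 p' (p s) + \<i> * of_real (ell p'))) (at s)"
    by (rule Ln_Phi_deriv) (use p b in auto)
  then show ?thesis by (rule has_vector_derivative_transform_within_open[OF _ A(1,2)]) (rule A(3))
qed

lemma L_deriv:
  assumes p: "\<And>i. i < d \<Longrightarrow> ((\<lambda>s. p s i) has_real_derivative p' i) (at s)" and b: "vnorm d (p s) < \<rho>"
  shows "((\<lambda>s. L (p s)) has_vector_derivative cf.m1 p' (p s)) (at s)"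
proof -
  have "((\<lambda>s. \<i> * of_real (ell (p s))) has_vector_derivative (\<i> * of_real (ell p'))) (at s)"
    by (intro has_vector_derivative_mult_right has_vector_derivative_of_real ell_deriv p)
  moreover have "((\<lambda>s. ccgf d \<mu> (cpoint d \<mu> \<tau> (p s))) has_vector_derivative (cf.m1 p' (p s) + \<i> * of_real (ell p'))) (at s)"
    by (rule ccgf_deriv) (use p b in auto)
  note has_vector_derivative_diff[OF has_vector_derivative_diff[OF this has_vector_derivative_const[of "of_real (ln phi)"]] calculation]
  then
  show ?thesis unfolding L_def by simp
qed

lemma exp_L:
  assumes b: "vnorm d t < \<rho>" shows "exp (L t) = cf.chi t"
proof -
  have "exp (L t) = exp (Ln (Phi t)) / exp (of_real (ln phi)) / exp (\<i> * of_real (ell t))"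
    using Phi_nz[OF b] by (simp add: L_Ln exp_diff)
  also have "exp (of_real (ln phi)) = complex_of_real phi" using phi by (simp add: exp_of_real)
  also have "exp (Ln (Phi t)) = Phi t" using Phi_nz[OF b] by simp
  also have "Phi t / of_real phi / exp (\<i> * of_real (ell t)) = cf.chi t"
    using phi by (simp add: Phi_eq cis_conv_exp)
  finally show ?thesis .
qed

lemma Phi_uminus: "Phi (\<lambda>i\<in>{..<d}. - t i) = cnj (Phi t)"
proof -
  have "Phi (\<lambda>i\<in>{..<d}. - t i) = Phi (\<lambda>i. - t i)" by (rule Phi_cong) simp
  also have "\<dots> = cnj (Phi t)"
    using ell_linear(1)[of "- 1" t] by (simp add: Phi_eq cf.chi_uminus cis_cnj)
  finally show ?thesis .
qed

lemma L_odd: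
  assumes b: "vnorm d t < \<rho>" shows "Im (L (\<lambda>i\<in>{..<d}. - t i)) = - Im (L t)"
proof -
  have e: "ell (\<lambda>i\<in>{..<d}. - t i) = - ell t"
    using ell_cong[of "\<lambda>i\<in>{..<d}. - t i" "\<lambda>i. (- 1) * t i"] ell_linear(1)[of "- 1" t] by simp
  have "Im (Ln (cnj (Phi t))) = - Im (Ln (Phi t))"
    using arg_cong[OF cnj_Ln[OF Phi_nonpos[OF b]], of Im] by simp
  then show ?thesis using Phi_nz[OF b] by (simp add: L_Ln e Phi_uminus)
qed

lemma L_0: "L (\<lambda>i. 0) = 0"
  using phi by (simp add: L_Ln Phi_eq cf.chi_0 ell_linear(2) Ln_of_real)

definition Re_log :: "(nat \<Rightarrow> real) \<Rightarrow> real" where "Re_log = (\<lambda>t. Re (ccgf d \<mu> (cpoint d \<mu> \<tau> t)))"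
definition Im_log :: "(nat \<Rightarrow> real) \<Rightarrow> real" where "Im_log = (\<lambda>t. Im (ccgf d \<mu> (cpoint d \<mu> \<tau> t)))"

text \<open>
  Each further coordinate derivative of \<open>log \<phi>\<close> adds one argument to the cumulant. The two parts are treated
  together, as only the real linearity of \<open>Re\<close> and \<open>Im\<close> is used.
\<close>

lemma partial_deriv_chain:
  assumes h: "h = Re \<or> h = Im" and t: "vnorm d t < \<rho>"
  shows "partial_deriv k (\<lambda>t. h (ccgf d \<mu> (cpoint d \<mu> \<tau> t))) t = h (cf.m1 (unitv k) t + \<i> * of_real (ell (unitv k)))" (is ?A)
    and "partial_deriv j (partial_deriv k (\<lambda>t. h (ccgf d \<mu> (cpoint d \<mu> \<tau> t)))) t = h (cf.K2 (unitv j) (unitv k) t)" (is ?B)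
    and "partial_deriv i (partial_deriv j (partial_deriv k (\<lambda>t. h (ccgf d \<mu> (cpoint d \<mu> \<tau> t))))) t = h (cf.K3 (unitv i) (unitv j) (unitv k) t)" (is ?C)
    and "partial_deriv l (partial_deriv i (partial_deriv j (partial_deriv k (\<lambda>t. h (ccgf d \<mu> (cpoint d \<mu> \<tau> t)))))) t = h (cf.K4 (unitv l) (unitv i) (unitv j) (unitv k) t)" (is ?D)
proof -
  let ?f = "\<lambda>t. h (ccgf d \<mu> (cpoint d \<mu> \<tau> t))"
  let ?U = "{t. vnorm d t < \<rho>}"
  have hd: "((\<lambda>s. h (f s)) has_real_derivative h c) (at s)" if "(f has_vector_derivative c) (at s)" for f c s
    using h Re_deriv[OF that] Im_deriv[OF that] by auto
  have line: "open {h. t(k := h) \<in> ?U}" for t k by (rule open_vnorm_line)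
  have 1: "partial_deriv k ?f t = h (cf.m1 (unitv k) t + \<i> * of_real (ell (unitv k)))" if "t \<in> ?U" for t k
  proof (rule partial_deriv_eq[OF line that refl])
    show "((\<lambda>s. ?f (t(k := s))) has_real_derivative h (cf.m1 (unitv k) t + \<i> * of_real (ell (unitv k)))) (at (t k))"
      using hd[OF ccgf_deriv[of "\<lambda>s. t(k := s)" "unitv k" "t k", OF fun_upd_deriv]] that by simp
  qed
  have 2: "partial_deriv j (partial_deriv k ?f) t = h (cf.K2 (unitv j) (unitv k) t)" if "t \<in> ?U" for t j k
  proof (rule partial_deriv_eq[OF line that 1])
    have "((\<lambda>s. cf.m1 (unitv k) (t(j := s)) + \<i> * of_real (ell (unitv k))) has_vector_derivative cf.K2 (unitv j) (unitv k) t + 0) (at (t j))"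
      using cf.K1_deriv[of "\<lambda>s. t(j := s)" "unitv j" "t j", OF fun_upd_deriv] chi_nz[of t] that
      by (intro has_vector_derivative_add has_vector_derivative_const) simp
    then show "((\<lambda>s. h (cf.m1 (unitv k) (t(j := s)) + \<i> * of_real (ell (unitv k)))) has_real_derivative h (cf.K2 (unitv j) (unitv k) t)) (at (t j))"
      using hd by fastforce
  qed simp
  have 3: "partial_deriv i (partial_deriv j (partial_deriv k ?f)) t = h (cf.K3 (unitv i) (unitv j) (unitv k) t)" if "t \<in> ?U" for t i j k
  proof (rule partial_deriv_eq[OF line that 2])
    show "((\<lambda>s. h (cf.K2 (unitv j) (unitv k) (t(i := s)))) has_real_derivative h (cf.K3 (unitv i) (unitv j) (unitv k) t)) (at (t i))"
      using hd[OF cf.K2_deriv[of "\<lambda>s. t(i := s)" "unitv i" "t i", OF fun_upd_deriv]] chi_nz[of t] that by simp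
  qed simp
  have 4: "partial_deriv l (partial_deriv i (partial_deriv j (partial_deriv k ?f))) t = h (cf.K4 (unitv l) (unitv i) (unitv j) (unitv k) t)" if "t \<in> ?U" for t l i j k
  proof (rule partial_deriv_eq[OF line that 3])
    show "((\<lambda>s. h (cf.K3 (unitv i) (unitv j) (unitv k) (t(l := s)))) has_real_derivative h (cf.K4 (unitv l) (unitv i) (unitv j) (unitv k) t)) (at (t l))"
      using hd[OF cf.K3_deriv[of "\<lambda>s. t(l := s)" "unitv l" "t l", OF fun_upd_deriv]] chi_nz[of t] that by simp
  qed simp
  show ?A ?B ?C ?D using t by (auto intro: 1 2 3 4)
qed

lemma nabla3:
  assumes t: "vnorm d t < \<rho>"
  shows "nabla Im_log t [i, j, k] = Im (cf.K3 (unitv i) (unitv j) (unitv k) t)"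
  using partial_deriv_chain(3)[OF _ t, of Im] by (simp add: nabla_def Im_log_def)

lemma nabla4:
  assumes t: "vnorm d t < \<rho>"
  shows "nabla Re_log t [l, i, j, k] = Re (cf.K4 (unitv l) (unitv i) (unitv j) (unitv k) t)"
  using partial_deriv_chain(4)[OF _ t, of Re] by (simp add: nabla_def Re_log_def)

lemma tensor3: "vnorm d t < \<rho> \<Longrightarrow> tensor_apply d 3 (nabla Im_log t) u = Im (cf.K3 (u 0) (u 1) (u 2) t)"
  using cf.mlin_K3 by (intro tensor_apply_multilinear_3[where f = "\<lambda>u v w. Im (cf.K3 u v w t)"] nabla3 mlin_Re_Im) auto

lemma tensor4: "vnorm d t < \<rho> \<Longrightarrow> tensor_apply d 4 (nabla Re_log t) u = Re (cf.K4 (u 0) (u 1) (u 2) (u 3) t)"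
  using cf.mlin_K4 by (intro tensor_apply_multilinear_4[where f = "\<lambda>z u v w. Re (cf.K4 z u v w t)"] nabla4 mlin_Re_Im) auto

end

section \<open>Finiteness of the derivative bounds\<close>

lemma tensor_apply_le:
  assumes N: "\<And>is. set is \<subseteq> {..<d} \<Longrightarrow> length is = k \<Longrightarrow> \<bar>N is\<bar> \<le> c"
    and u: "\<forall>l<k. u l \<in> Rd d \<and> vnorm d (u l) = 1"
  shows "tensor_apply d k N u \<le> real (d ^ k) * c"
proof -
  let ?A = "{is. set is \<subseteq> {..<d} \<and> length is = k}"
  have "tensor_apply d k N u \<le> (\<Sum>is\<in>?A. c)"
    unfolding tensor_apply_def
  proof (rule sum_mono)
    fix "is" assume isA: "is \<in> ?A"
    have ul: "\<bar>u l (is ! l)\<bar> \<le> 1" if "l < k" for l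
    proof -
      have "is ! l \<in> set is" using isA that by (intro nth_mem) simp
      then have "is ! l < d" using isA by blast
      then have "(u l (is ! l))\<^sup>2 \<le> (\<Sum>i<d. (u l i)\<^sup>2)" by (intro member_le_sum) auto
      also have "\<dots> = 1" using u that by (simp add: L2_set_def)
      finally show ?thesis by (simp add: abs_square_le_1)
    qed
    have "\<bar>\<Prod>l<k. u l (is ! l)\<bar> \<le> 1"
      unfolding abs_prod by (intro prod_le_1) (use ul in auto)
    then have "\<bar>N is\<bar> * \<bar>\<Prod>l<k. u l (is ! l)\<bar> \<le> \<bar>N is\<bar> * 1" by (intro mult_left_mono) auto
    also have "\<dots> \<le> c" using N[of "is"] isA by simp
    finally have "\<bar>N is * (\<Prod>l<k. u l (is ! l))\<bar> \<le> c" by (simp only: abs_mult)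
    then show "N is * (\<Prod>l<k. u l (is ! l)) \<le> c" by linarith
  qed
  also have "\<dots> = real (d ^ k) * c" using card_lists_length_eq[of "{..<d}" k] by simp
  finally show ?thesis .
qed

lemma unit_vectors_exist:
  assumes "i < d"
  shows "restrict (unitv i) {..<d} \<in> Rd d \<and> vnorm d (restrict (unitv i) {..<d}) = 1"
  using assms by (simp add: L2_set_def unitv_def if_distrib[of "\<lambda>x. x\<^sup>2"] cong: if_cong)

lemma op_norm_bounds:
  assumes d: "1 \<le> d" and N: "\<And>is. set is \<subseteq> {..<d} \<Longrightarrow> length is = k \<Longrightarrow> \<bar>N is\<bar> \<le> c"
  shows op_norm_le: "op_norm d k N \<le> real (d ^ k) * c"
    and op_norm_upper: "\<forall>l<k. u l \<in> Rd d \<and> vnorm d (u l) = 1 \<Longrightarrow> tensor_apply d k N u \<le> op_norm d k N"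
proof -
  let ?U = "{u. \<forall>l<k. u l \<in> Rd d \<and> vnorm d (u l) = 1}"
  have "0 < d" using d by simp
  from unit_vectors_exist[OF this]
  have mem: "(\<lambda>_. restrict (unitv 0) {..<d}) \<in> ?U" unfolding mem_Collect_eq by (intro allI impI)
  have ne: "?U \<noteq> {}"
  proof
    assume "?U = {}"
    with mem show False by (simp only: empty_iff)
  qed
  have le: "tensor_apply d k N v \<le> real (d ^ k) * c" if "v \<in> ?U" for v
    by (rule tensor_apply_le[OF N that[unfolded mem_Collect_eq]])
  show "op_norm d k N \<le> real (d ^ k) * c"
    unfolding op_norm_def by (rule cSUP_least[OF ne le])
  have "bdd_above (tensor_apply d k N ` ?U)" by (rule bdd_aboveI2[OF le])
  then show "tensor_apply d k N u \<le> op_norm d k N" if "\<forall>l<k. u l \<in> Rd d \<and> vnorm d (u l) = 1"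
    unfolding op_norm_def using that by (intro cSUP_upper) (simp only: mem_Collect_eq)
qed

lemma op_norm_2_diag:
  assumes d: "1 \<le> d" and i: "i < d"
  shows "N [i, i] \<le> op_norm d 2 N"
proof -
  let ?A = "{is. set is \<subseteq> {..<d} \<and> length is = (2::nat)}"
  have fin: "finite ?A" by (rule finite_lists_length_eq) simp
  let ?u = "\<lambda>_::nat. restrict (unitv i) {..<d}"
  have "tensor_apply d 2 N ?u = (\<Sum>is\<in>?A. if is = [i, i] then N [i, i] else 0)"
    unfolding tensor_apply_def
  proof (rule sum.cong[OF refl])
    fix "is" assume "is \<in> ?A"
    then obtain a b where ab: "is = [a, b]" "a < d" "b < d" by (auto simp: length_Suc_conv numeral_2_eq_2)
    then show "N is * (\<Prod>l<2. ?u l (is ! l)) = (if is = [i, i] then N [i, i] else 0)"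
      by (auto simp: unitv_def numeral_2_eq_2 lessThan_Suc)
  qed
  also have "\<dots> = N [i, i]" using i fin by (simp add: sum.delta)
  finally have "N [i, i] = tensor_apply d 2 N ?u" ..
  also have "\<dots> \<le> op_norm d 2 N"
  proof (rule op_norm_upper[OF d, where c = "Max ((\<lambda>is. \<bar>N is\<bar>) ` ?A)"])
    show "\<bar>N is\<bar> \<le> Max ((\<lambda>is. \<bar>N is\<bar>) ` ?A)" if "set is \<subseteq> {..<d}" "length is = 2" for "is"
      using that fin by (intro Max_ge) auto
  qed (use unit_vectors_exist[OF i] in simp)
  finally show ?thesis .
qed

lemma (in law_point) hess_entry_le:
  assumes k: "k < d" and l: "l < d"
  shows "\<bar>hess_cgf d \<mu> \<tau> $$ (k, l)\<bar> \<le> tmean \<tau> (\<lambda>x. (vnorm d x)\<^sup>2)"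
proof -
  let ?H = "\<lambda>k l. hess_cgf d \<mu> \<tau> $$ (k, l)"
  have vi: "integrable M (\<lambda>x. (vnorm d x)\<^sup>2)"
    unfolding vnorm_sq by (intro Bochner_Integration.integrable_sum int_comp2) auto
  have diag: "?H k k \<le> tmean \<tau> (\<lambda>x. (vnorm d x)\<^sup>2)" if k: "k < d" for k
  proof -
    have "?H k k = (\<integral>x. x k * x k \<partial>M) - (a k)\<^sup>2"
      using hess_cgf_eq[OF \<tau> k k] k by (simp add: integral_M_real a_def power2_eq_square)
    also have "\<dots> \<le> (\<integral>x. x k * x k \<partial>M)" by simp
    also have "\<dots> \<le> (\<integral>x. (vnorm d x)\<^sup>2 \<partial>M)"
    proof (rule integral_mono)
      show "integrable M (\<lambda>x. x k * x k)" by (rule int_comp2[OF k k])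
      show "x k * x k \<le> (vnorm d x)\<^sup>2" for x :: "nat \<Rightarrow> real"
        unfolding vnorm_sq using k by (intro member_le_sum[of k "{..<d}" "\<lambda>i. x i * x i"]) simp_all
    qed (rule vi)
    also have "\<dots> = tmean \<tau> (\<lambda>x. (vnorm d x)\<^sup>2)" by (rule integral_M_real) measurable
    finally show ?thesis .
  qed
  have "\<bar>?H k l\<bar> \<le> (\<integral>x. \<bar>(x k - a k) * (x l - a l)\<bar> \<partial>M)"
    unfolding cov_x(1)[OF k l, symmetric] using integral_norm_bound[of M "\<lambda>x. (x k - a k) * (x l - a l)"] by simp
  also have "\<dots> \<le> (\<integral>x. ((x k - a k) * (x k - a k) + (x l - a l) * (x l - a l)) / 2 \<partial>M)"
  proof (rule integral_mono)
    show "integrable M (\<lambda>x. \<bar>(x k - a k) * (x l - a l)\<bar>)" using cov_x(2)[OF k l] by simp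
    show "integrable M (\<lambda>x. ((x k - a k) * (x k - a k) + (x l - a l) * (x l - a l)) / 2)"
      using cov_x(2)[OF k k] cov_x(2)[OF l l] by simp
    have "\<bar>p * q\<bar> \<le> (p * p + q * q) / 2" for p q :: real
    proof -
      have "0 \<le> (\<bar>p\<bar> - \<bar>q\<bar>) * (\<bar>p\<bar> - \<bar>q\<bar>)" by simp
      then show ?thesis by (simp add: algebra_simps abs_mult)
    qed
    then show "\<bar>(x k - a k) * (x l - a l)\<bar> \<le> ((x k - a k) * (x k - a k) + (x l - a l) * (x l - a l)) / 2" for x .
  qed
  also have "\<dots> = (?H k k + ?H l l) / 2"
    using cov_x(2)[OF k k] cov_x(2)[OF l l] cov_x(1)[OF k k] cov_x(1)[OF l l] by simp
  also have "\<dots> \<le> tmean \<tau> (\<lambda>x. (vnorm d x)\<^sup>2)" using diag[OF k] diag[OF l] by simp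
  finally show ?thesis .
qed

text \<open>
  The moment generating function is bounded on the domain although the domain may be unbounded: \<open>R H R = 1\<close> and a
  bound on \<open>R\<close> force some entry of \<open>H\<close> to be large, hence \<open>\<phi>\<close> is at most a constant times the integral of
  \<open>\<parallel>x\<parallel>\<^sup>2 exp (\<tau> \<bullet> x)\<close>, and this in turn is at most \<open>\<phi> / 2\<close> plus a multiple of the fourth moment.
\<close>

lemma (in law_point) phi_le:
  assumes r: "\<And>i j. i < d \<Longrightarrow> j < d \<Longrightarrow> \<bar>R i j\<bar> \<le> r"
    and K: "(\<integral>x. vnorm4 x * exp (dot d \<tau> x) \<partial>\<mu>) \<le> K"
  shows "phi \<le> ((real d)\<^sup>2 * r\<^sup>2)\<^sup>2 * K"
proof -
  (* With p = d^2 r^2, the entry (0, 0) of R H R = 1 gives 1 at most p times the tilted second moment. *)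
  define p where "p = (real d)\<^sup>2 * r\<^sup>2"
  define Q where "Q = tmean \<tau> (\<lambda>x. (vnorm d x)\<^sup>2)"
  have d0: "0 < d" using d1 by simp
  have vi: "integrable M (\<lambda>x. (vnorm d x)\<^sup>2)"
    unfolding vnorm_sq by (intro Bochner_Integration.integrable_sum int_comp2) auto
  then have vi': "integrable \<mu> (\<lambda>x. exp (dot d \<tau> x) * (vnorm d x)\<^sup>2)" by (subst (asm) integral_M(2)) auto
  have mi: "integrable \<mu> (\<lambda>x. vnorm4 x * exp (dot d \<tau> x))" using vnorm4_bound \<tau> by blast
  (* The entry (0, 0) of the identity R H R = 1. *)
  have "1 = (\<Sum>k<d. \<Sum>l<d. R 0 k * R 0 l * hess_cgf d \<mu> \<tau> $$ (k, l))"
    using mat_inv_sqrt_entries(2)[OF pd d0 d0 R_def] by simp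
  also have "\<dots> \<le> (\<Sum>k<d. \<Sum>l<d. r * r * Q)"
  proof (intro sum_mono)
    fix k l assume kl: "k \<in> {..<d}" "l \<in> {..<d}"
    have "\<bar>R 0 k\<bar> * \<bar>R 0 l\<bar> * \<bar>hess_cgf d \<mu> \<tau> $$ (k, l)\<bar> \<le> r * r * Q"
      using kl r[of 0 k] r[of 0 l] d0 hess_entry_le[of k l] order_trans[OF abs_ge_zero r[of 0 k]] unfolding Q_def by (intro mult_mono) auto
    then have "\<bar>R 0 k * R 0 l * hess_cgf d \<mu> \<tau> $$ (k, l)\<bar> \<le> r * r * Q" by (simp only: abs_mult)
    then show "R 0 k * R 0 l * hess_cgf d \<mu> \<tau> $$ (k, l) \<le> r * r * Q" by linarith
  qed
  also have "\<dots> = p * Q" by (simp add: p_def power2_eq_square)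
  finally have "phi * 1 \<le> phi * (p * Q)" using phi by (intro mult_left_mono) auto
  also have "phi * (p * Q) = (\<integral>x. p * (exp (dot d \<tau> x) * (vnorm d x)\<^sup>2) \<partial>\<mu>)"
    using phi by (simp add: Q_def tmean_def phi_def)
  also have "\<dots> \<le> (\<integral>x. (exp (dot d \<tau> x) + p\<^sup>2 * (vnorm4 x * exp (dot d \<tau> x))) / 2 \<partial>\<mu>)"
  proof (rule integral_mono)
    show "integrable \<mu> (\<lambda>x. p * (exp (dot d \<tau> x) * (vnorm d x)\<^sup>2))" using vi' by simp
    show "integrable \<mu> (\<lambda>x. (exp (dot d \<tau> x) + p\<^sup>2 * (vnorm4 x * exp (dot d \<tau> x))) / 2)" using mi exp_integrable[OF \<tau>] by simp
    fix x
    have "0 \<le> (1 - p * (vnorm d x)\<^sup>2)\<^sup>2" by simp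
    then have "p * (vnorm d x)\<^sup>2 \<le> (1 + p\<^sup>2 * vnorm4 x) / 2"
      by (simp add: vnorm4_def power2_eq_square algebra_simps power4_eq_xxxx)
    then have "exp (dot d \<tau> x) * (p * (vnorm d x)\<^sup>2) \<le> exp (dot d \<tau> x) * ((1 + p\<^sup>2 * vnorm4 x) / 2)" by (rule mult_left_mono) simp
    then show "p * (exp (dot d \<tau> x) * (vnorm d x)\<^sup>2) \<le> (exp (dot d \<tau> x) + p\<^sup>2 * (vnorm4 x * exp (dot d \<tau> x))) / 2"
      by (simp add: algebra_simps)
  qed
  also have "\<dots> = (phi + p\<^sup>2 * (\<integral>x. vnorm4 x * exp (dot d \<tau> x) \<partial>\<mu>)) / 2"
    using mi exp_integrable[OF \<tau>] by (simp add: phi_def mgf_def)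
  also have "\<dots> \<le> (phi + p\<^sup>2 * K) / 2" by (intro divide_right_mono add_left_mono mult_left_mono K) auto
  finally show ?thesis by (simp add: p_def)
qed

text \<open>
  The lower bound \<open>\<delta>\<close> on the continued moment generating function enters twice: at \<open>t = 0\<close> it bounds the means
  \<open>a\<^sub>j\<close>, and at \<open>t\<close> it keeps the normalization of the complex tilt away from zero.
\<close>

lemma (in law_log) b_le:
  assumes r: "\<And>i j. i < d \<Longrightarrow> j < d \<Longrightarrow> \<bar>R i j\<bar> \<le> r"
    and K: "(\<integral>x. vnorm4 x * exp (dot d \<tau> x) \<partial>\<mu>) \<le> K"
    and t: "vnorm d t < \<rho>"
  defines "w \<equiv> (real d + 1) ^ 4 * (((real d)\<^sup>2 * r\<^sup>2)\<^sup>2 * K + K)"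
  shows "1 + cf.S4 / cmod (cf.chi t) \<le> 1 + (1 + real d * (real d * (r * (1 + w / \<delta>)))) ^ 4 * w / \<delta>"
proof -
  have mi: "integrable \<mu> (\<lambda>x. vnorm4 x * exp (dot d \<tau> x))" using vnorm4_bound \<tau> by blast
  have d0: "0 < d" using d1 by simp
  have r0: "0 \<le> r" using r[OF d0 d0] by linarith
  have W4: "(\<integral>x. W x ^ 4 * exp (dot d \<tau> x) \<partial>\<mu>) \<le> w"
  proof -
    have "(\<integral>x. W x ^ 4 * exp (dot d \<tau> x) \<partial>\<mu>) \<le> (\<integral>x. (real d + 1) ^ 4 * (exp (dot d \<tau> x) + vnorm4 x * exp (dot d \<tau> x)) \<partial>\<mu>)"
    proof (rule integral_mono)
      show "integrable \<mu> (\<lambda>x. W x ^ 4 * exp (dot d \<tau> x))" by (rule W4_integrable[OF \<tau>])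
      show "integrable \<mu> (\<lambda>x. (real d + 1) ^ 4 * (exp (dot d \<tau> x) + vnorm4 x * exp (dot d \<tau> x)))"
        using mi exp_integrable[OF \<tau>] by (intro integrable_mult_right Bochner_Integration.integrable_add)
      fix x
      have "W x ^ 4 * exp (dot d \<tau> x) \<le> ((real d + 1) ^ 4 * (1 + vnorm4 x)) * exp (dot d \<tau> x)" by (intro mult_right_mono W4_le) simp
      then show "W x ^ 4 * exp (dot d \<tau> x) \<le> (real d + 1) ^ 4 * (exp (dot d \<tau> x) + vnorm4 x * exp (dot d \<tau> x))" by (simp add: algebra_simps)
    qed
    also have "\<dots> = (real d + 1) ^ 4 * (phi + (\<integral>x. vnorm4 x * exp (dot d \<tau> x) \<partial>\<mu>))"
      using mi exp_integrable[OF \<tau>] by (simp add: phi_def mgf_def)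
    also have "\<dots> \<le> w" unfolding w_def by (intro mult_left_mono add_mono phi_le[OF r K] K) auto
    finally show ?thesis .
  qed
  have "0 \<le> (\<integral>x. W x ^ 4 * exp (dot d \<tau> x) \<partial>\<mu>)" by (rule integral_nonneg_AE) simp
  then have w0: "0 \<le> w" using W4 by linarith
  have W4M: "(\<integral>x. W x ^ 4 \<partial>M) \<le> w / phi"
  proof -
    have "(\<integral>x. W x ^ 4 \<partial>M) = (\<integral>x. W x ^ 4 * exp (dot d \<tau> x) \<partial>\<mu>) / phi"
      by (subst integral_M_real) (simp_all add: tmean_def phi_def mult.commute)
    then show ?thesis using W4 phi by (simp add: divide_right_mono)
  qed
  have W4i: "integrable M (\<lambda>x. W x ^ 4)" by (rule integrable_M_W4[of _ 1]) auto
  have phi_ge: "\<delta> \<le> phi"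
    using A4'[of "\<lambda>i. 0"] rho phi by (simp add: Phi_eq cf.chi_0 norm_mult L2_set_def)
  have aj: "\<bar>a j\<bar> \<le> w / \<delta>" if j: "j < d" for j
  proof -
    have "\<bar>a j\<bar> \<le> (\<integral>x. \<bar>x j\<bar> \<partial>M)" unfolding mean_x[OF j, symmetric] using integral_norm_bound[of M "\<lambda>x. x j"] by simp
    also have "\<dots> \<le> (\<integral>x. W x ^ 4 \<partial>M)"
    proof (rule integral_mono)
      show "integrable M (\<lambda>x. \<bar>x j\<bar>)" using int_comp[OF j] by simp
      show "\<bar>x j\<bar> \<le> W x ^ 4" for x using comp_le_W[OF j, of x] W_pow_le[of 1 x] by simp
    qed (rule W4i)
    also note W4M
    also have "w / phi \<le> w / \<delta>" using w0 \<delta> phi_ge by (intro divide_left_mono) auto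
    finally show ?thesis .
  qed
  have cb: "Y_scale \<le> 1 + real d * (real d * (r * (1 + w / \<delta>)))"
  proof -
    have "(\<Sum>i<d. \<Sum>j<d. \<bar>R i j\<bar> * (1 + \<bar>a j\<bar>)) \<le> (\<Sum>i<d. \<Sum>j<d. r * (1 + w / \<delta>))"
      using aj r r0 by (intro sum_mono mult_mono) auto
    then show ?thesis by (simp add: Y_scale_def)
  qed
  have cb0: "0 \<le> Y_scale" by (simp add: Y_scale_def sum_nonneg)
  have "cf.S4 \<le> (\<integral>x. Y_scale ^ 4 * W x ^ 4 \<partial>M)"
    unfolding cf.S4_def
  proof (rule integral_mono)
    show "integrable M (\<lambda>x. cf.S x ^ 4)" using cf.Y4 by (simp add: cf.S_def)
    show "cf.S x ^ 4 \<le> Y_scale ^ 4 * W x ^ 4" for x using S_pow4_le by (simp add: cf.S_def)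
  qed (use W4i in simp)
  also have "\<dots> = Y_scale ^ 4 * (\<integral>x. W x ^ 4 \<partial>M)" by simp
  also have "\<dots> \<le> (1 + real d * (real d * (r * (1 + w / \<delta>)))) ^ 4 * (w / phi)"
    using cb cb0 W4M by (intro mult_mono power_mono) (auto intro!: integral_nonneg_AE)
  finally have S4: "cf.S4 \<le> (1 + real d * (real d * (r * (1 + w / \<delta>)))) ^ 4 * (w / phi)" .
  have chi: "\<delta> / phi \<le> cmod (cf.chi t)"
    using A4'[OF t] phi by (simp add: Phi_eq norm_mult divide_le_eq mult.commute)
  have "cf.S4 / cmod (cf.chi t) \<le> (1 + real d * (real d * (r * (1 + w / \<delta>)))) ^ 4 * (w / phi) / (\<delta> / phi)"
    using S4 chi \<delta> phi w0 by (intro frac_le) auto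
  also have "\<dots> = (1 + real d * (real d * (r * (1 + w / \<delta>)))) ^ 4 * w / \<delta>" using phi by simp
  finally show ?thesis by simp
qed

lemma (in law_log) nabla_entries_le:
  assumes b: "1 + cf.S4 / cmod (cf.chi t) \<le> \<beta>" and t: "vnorm d t < \<rho>"
  shows "set is \<subseteq> {..<d} \<Longrightarrow> length is = 3 \<Longrightarrow> \<bar>nabla Im_log t is\<bar> \<le> 6 * \<beta> ^ 3"
    and "set is \<subseteq> {..<d} \<Longrightarrow> length is = 4 \<Longrightarrow> \<bar>nabla Re_log t is\<bar> \<le> 26 * \<beta> ^ 4"
proof -
  let ?b = "1 + cf.S4 / cmod (cf.chi t)"
  have S4: "0 \<le> cf.S4" unfolding cf.S4_def
    by (intro integral_nonneg_AE AE_I2 zero_le_power) (use cf.S_ge_1 in \<open>auto intro: order_trans[of 0 1]\<close>)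
  have d0: "0 < d" using d1 by simp
  show "\<bar>nabla Im_log t is\<bar> \<le> 6 * \<beta> ^ 3" if i: "set is \<subseteq> {..<d}" "length is = 3"
  proof -
    obtain i j k where ijk: "is = [i, j, k]" "i < d" "j < d" "k < d" using i by (auto simp: length_Suc_conv numeral_3_eq_3)
    have "\<bar>nabla Im_log t is\<bar> \<le> cmod (cf.K3 (unitv i) (unitv j) (unitv k) t)" unfolding ijk(1) nabla3[OF t] by (rule abs_Im_le_cmod)
    also have "\<dots> \<le> 6 * ?b ^ 3" by (rule cf.K_unitv_le(1)[OF d0 ijk(2-4)])
    also have "\<dots> \<le> 6 * \<beta> ^ 3" using b S4 by (intro mult_left_mono power_mono) auto
    finally show ?thesis .
  qed
  show "\<bar>nabla Re_log t is\<bar> \<le> 26 * \<beta> ^ 4" if i: "set is \<subseteq> {..<d}" "length is = 4"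
  proof -
    obtain l i j k where ijk: "is = [l, i, j, k]" "l < d" "i < d" "j < d" "k < d" using i by (auto simp: length_Suc_conv eval_nat_numeral)
    have "\<bar>nabla Re_log t is\<bar> \<le> cmod (cf.K4 (unitv l) (unitv i) (unitv j) (unitv k) t)" unfolding ijk(1) nabla4[OF t] by (rule abs_Re_le_cmod)
    also have "\<dots> \<le> 26 * ?b ^ 4" by (rule cf.K_unitv_le(2)[OF ijk(2-5)])
    also have "\<dots> \<le> 26 * \<beta> ^ 4" using b S4 by (intro mult_left_mono power_mono) auto
    finally show ?thesis .
  qed
qed

lemma mlin_abs_le:
  fixes f :: "(nat \<Rightarrow> real) \<Rightarrow> real"
  assumes f: "mlin d f" and le: "\<And>u. u \<in> Rd d \<Longrightarrow> vnorm d u = 1 \<Longrightarrow> f u \<le> c" and u: "u \<in> Rd d" "vnorm d u = 1"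
  shows "\<bar>f u\<bar> \<le> c"
proof -
  have "f (\<lambda>i\<in>{..<d}. - u i) \<le> c" by (intro le) (use u in \<open>auto simp: L2_set_def\<close>)
  moreover have "f (\<lambda>i\<in>{..<d}. - u i) = - f u"
    using mlin_cong[OF f, of "\<lambda>i\<in>{..<d}. - u i" "\<lambda>i. (- 1) * u i"] mlin_scale[OF f, of "- 1" u] by simp
  ultimately show ?thesis using le[OF u] by simp
qed

section \<open>The saddlepoint integral\<close>

locale law_uniform = law d \<mu> V for d \<mu> V +
  fixes \<delta> \<kappa> :: real and n :: nat
  assumes n1: "1 \<le> n" and \<delta>: "0 < \<delta>" and \<kappa>: "0 < \<kappa>"
    and A2: "A2 d \<mu> V" and A3: "A3 \<kappa> n d \<mu> V" and A4: "A4 \<delta> n d \<mu> V"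
begin

lemma radius_pos: "0 < radius n d" using n1 d1 by (simp add: radius_def)

lemma law_log: "\<tau> \<in> V \<Longrightarrow> law_log d \<mu> V \<tau> \<delta> (radius n d)"
proof -
  assume \<tau>: "\<tau> \<in> V"
  interpret p: law_point d \<mu> V \<tau> by unfold_locales (use \<tau> A2 in \<open>auto simp: A2_def\<close>)
  show ?thesis
    by unfold_locales (use \<delta> radius_pos A4 \<tau> in \<open>simp_all add: A4_def\<close>)
qed

lemma uniform_entries: "\<exists>\<beta>. \<forall>\<tau>\<in>V. \<forall>t. vnorm d t < radius n d \<longrightarrow>
   (\<forall>is. set is \<subseteq> {..<d} \<longrightarrow> length is = 3 \<longrightarrow> \<bar>nabla (\<lambda>t. Im (ccgf d \<mu> (cpoint d \<mu> \<tau> t))) t is\<bar> \<le> 6 * \<beta> ^ 3) \<and>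
   (\<forall>is. set is \<subseteq> {..<d} \<longrightarrow> length is = 4 \<longrightarrow> \<bar>nabla (\<lambda>t. Re (ccgf d \<mu> (cpoint d \<mu> \<tau> t))) t is\<bar> \<le> 26 * \<beta> ^ 4)"
proof -
  obtain K where K: "\<forall>\<tau>\<in>V. (\<integral>x. vnorm4 x * exp (dot d \<tau> x) \<partial>\<mu>) \<le> K" using vnorm4_bound by blast
  obtain \<beta>0 where \<beta>0: "\<And>\<tau>. \<tau> \<in> V \<Longrightarrow> op_norm d 2 (\<lambda>is. mat_inv (hess_cgf d \<mu> \<tau>) $$ (is ! 0, is ! 1)) \<le> \<beta>0"
    using A2 unfolding A2_def bdd_above_def by blast
  define r where "r = sqrt \<beta>0"
  define w where "w = (real d + 1) ^ 4 * (((real d)\<^sup>2 * r\<^sup>2)\<^sup>2 * K + K)"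
  define \<beta> where "\<beta> = 1 + (1 + real d * (real d * (r * (1 + w / \<delta>)))) ^ 4 * w / \<delta>"
  show ?thesis
  proof (intro exI[of _ \<beta>] ballI allI impI)
    fix \<tau> t assume \<tau>: "\<tau> \<in> V" and t: "vnorm d t < radius n d"
    interpret l: law_log d \<mu> V \<tau> \<delta> "radius n d" by (rule law_log[OF \<tau>])
    have r: "\<bar>l.R i j\<bar> \<le> r" if "i < d" "j < d" for i j
    proof -
      have "\<bar>l.R i j\<bar> \<le> sqrt (mat_inv (hess_cgf d \<mu> \<tau>) $$ (i, i))" by (rule mat_inv_sqrt_entries(3)[OF l.pd that l.R_def])
      also have "\<dots> \<le> r" unfolding r_def
        using op_norm_2_diag[OF d1 that(1), of "\<lambda>is. mat_inv (hess_cgf d \<mu> \<tau>) $$ (is ! 0, is ! 1)"] \<beta>0[OF \<tau>]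
        by (intro real_sqrt_le_mono) simp
      finally show ?thesis .
    qed
    have b: "1 + l.cf.S4 / cmod (l.cf.chi t) \<le> \<beta>"
      unfolding \<beta>_def w_def by (rule l.b_le[OF r]) (use K \<tau> t in auto)
    from l.nabla_entries_le[OF b t]
    show "(\<forall>is. set is \<subseteq> {..<d} \<longrightarrow> length is = 3 \<longrightarrow> \<bar>nabla (\<lambda>t. Im (ccgf d \<mu> (cpoint d \<mu> \<tau> t))) t is\<bar> \<le> 6 * \<beta> ^ 3) \<and>
      (\<forall>is. set is \<subseteq> {..<d} \<longrightarrow> length is = 4 \<longrightarrow> \<bar>nabla (\<lambda>t. Re (ccgf d \<mu> (cpoint d \<mu> \<tau> t))) t is\<bar> \<le> 26 * \<beta> ^ 4)"
      unfolding l.Im_log_def l.Re_log_def by blast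
  qed
qed

text \<open>
  The supremum bounds its members because the tensors are uniformly bounded on the domain.
\<close>

lemma tensor_le_c3:
  assumes \<tau>: "\<tau> \<in> V" and t: "t \<in> Rd d" "vnorm d t < radius n d" and u: "\<forall>l<3. u l \<in> Rd d \<and> vnorm d (u l) = 1"
  shows "tensor_apply d 3 (nabla (\<lambda>t. Im (ccgf d \<mu> (cpoint d \<mu> \<tau> t))) t) u \<le> c3 n d \<mu> V"
proof -
  let ?N = "\<lambda>\<tau> t. nabla (\<lambda>t. Im (ccgf d \<mu> (cpoint d \<mu> \<tau> t))) t"
  let ?X = "V \<times> {t \<in> Rd d. vnorm d t < radius n d}"
  obtain \<beta> where \<beta>: "\<And>\<tau> t is. \<tau> \<in> V \<Longrightarrow> vnorm d t < radius n d \<Longrightarrow> set is \<subseteq> {..<d} \<Longrightarrow> length is = 3 \<Longrightarrow> \<bar>?N \<tau> t is\<bar> \<le> 6 * \<beta> ^ 3"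
    using uniform_entries by blast
  have bdd: "bdd_above ((\<lambda>(\<tau>, t). op_norm d 3 (?N \<tau> t)) ` ?X)"
  proof (rule bdd_aboveI2)
    fix z assume "z \<in> ?X"
    then obtain \<tau> t where z: "z = (\<tau>, t)" "\<tau> \<in> V" "vnorm d t < radius n d" by blast
    show "(case z of (\<tau>, t) \<Rightarrow> op_norm d 3 (?N \<tau> t)) \<le> real (d ^ 3) * (6 * \<beta> ^ 3)"
      unfolding z(1) prod.case by (rule op_norm_le[OF d1 \<beta>[OF z(2,3)]])
  qed
  have "tensor_apply d 3 (?N \<tau> t) u \<le> op_norm d 3 (?N \<tau> t)"
    by (rule op_norm_upper[OF d1 \<beta>[OF \<tau> t(2)] u])
  also have "\<dots> \<le> c3 n d \<mu> V"
    using cSUP_upper[OF _ bdd, of "(\<tau>, t)"] \<tau> t unfolding c3_def by simp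
  finally show ?thesis .
qed

lemma tensor_le_c4:
  assumes \<tau>: "\<tau> \<in> V" and t: "t \<in> Rd d" "vnorm d t < radius n d" and u: "\<forall>l<4. u l \<in> Rd d \<and> vnorm d (u l) = 1"
  shows "tensor_apply d 4 (nabla (\<lambda>t. Re (ccgf d \<mu> (cpoint d \<mu> \<tau> t))) t) u \<le> c4 n d \<mu> V"
proof -
  let ?N = "\<lambda>\<tau> t. nabla (\<lambda>t. Re (ccgf d \<mu> (cpoint d \<mu> \<tau> t))) t"
  let ?X = "V \<times> {t \<in> Rd d. vnorm d t < radius n d}"
  obtain \<beta> where \<beta>: "\<And>\<tau> t is. \<tau> \<in> V \<Longrightarrow> vnorm d t < radius n d \<Longrightarrow> set is \<subseteq> {..<d} \<Longrightarrow> length is = 4 \<Longrightarrow> \<bar>?N \<tau> t is\<bar> \<le> 26 * \<beta> ^ 4"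
    using uniform_entries by blast
  have bdd: "bdd_above ((\<lambda>(\<tau>, t). op_norm d 4 (?N \<tau> t)) ` ?X)"
  proof (rule bdd_aboveI2)
    fix z assume "z \<in> ?X"
    then obtain \<tau> t where z: "z = (\<tau>, t)" "\<tau> \<in> V" "vnorm d t < radius n d" by blast
    show "(case z of (\<tau>, t) \<Rightarrow> op_norm d 4 (?N \<tau> t)) \<le> real (d ^ 4) * (26 * \<beta> ^ 4)"
      unfolding z(1) prod.case by (rule op_norm_le[OF d1 \<beta>[OF z(2,3)]])
  qed
  have "tensor_apply d 4 (?N \<tau> t) u \<le> op_norm d 4 (?N \<tau> t)"
    by (rule op_norm_upper[OF d1 \<beta>[OF \<tau> t(2)] u])
  also have "\<dots> \<le> c4 n d \<mu> V"
    using cSUP_upper[OF _ bdd, of "(\<tau>, t)"] \<tau> t unfolding c4_def by simp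
  finally show ?thesis .
qed

end

locale law_saddle = law_uniform d \<mu> V \<delta> \<kappa> n for d \<mu> V \<delta> \<kappa> n +
  fixes \<tau> :: "nat \<Rightarrow> real"
  assumes \<tau>V: "\<tau> \<in> V"
begin

sublocale l: law_log d \<mu> V \<tau> \<delta> "radius n d" by (rule law_log[OF \<tau>V])

lemma K3_cong: "(\<And>i. i < d \<Longrightarrow> t i = t' i) \<Longrightarrow> l.cf.K3 w u v t = l.cf.K3 w u v t'"
  unfolding l.cf.K3_def using l.cf.T_cong[of t t'] by simp

lemma K4_cong: "(\<And>i. i < d \<Longrightarrow> t i = t' i) \<Longrightarrow> l.cf.K4 z w u v t = l.cf.K4 z w u v t'"
  unfolding l.cf.K4_def l.cf.D_def using l.cf.T_cong[of t t'] by simp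

lemma K3_unit_le:
  assumes t: "vnorm d t < radius n d" and w: "w \<in> Rd d" "vnorm d w = 1" and u: "u \<in> Rd d" "vnorm d u = 1" and v: "v \<in> Rd d" "vnorm d v = 1"
  shows "\<bar>Im (l.cf.K3 w u v t)\<bar> \<le> c3 n d \<mu> V"
proof (rule mlin_abs_le[OF mlin_Re_Im(2)[OF l.cf.mlin_K3(1)] _ w])
  fix w assume w: "w \<in> Rd d" "vnorm d w = 1"
  let ?u = "\<lambda>l::nat. if l = 0 then w else if l = 1 then u else v"
  let ?t = "restrict t {..<d}"
  have t': "vnorm d ?t < radius n d" using t by (simp only: vnorm_restrict)
  have "Im (l.cf.K3 w u v t) = Im (l.cf.K3 w u v ?t)" using K3_cong[of t ?t] by simp
  also have "\<dots> = tensor_apply d 3 (nabla l.Im_log ?t) ?u" using l.tensor3[OF t', of ?u] by simp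
  also have "\<dots> \<le> c3 n d \<mu> V" unfolding l.Im_log_def
    by (rule tensor_le_c3[OF \<tau>V _ t']) (use w u v in simp_all)
  finally show "Im (l.cf.K3 w u v t) \<le> c3 n d \<mu> V" .
qed

lemma K4_unit_le:
  assumes t: "vnorm d t < radius n d" and z: "z \<in> Rd d" "vnorm d z = 1" and w: "w \<in> Rd d" "vnorm d w = 1" and u: "u \<in> Rd d" "vnorm d u = 1" and v: "v \<in> Rd d" "vnorm d v = 1"
  shows "\<bar>Re (l.cf.K4 z w u v t)\<bar> \<le> c4 n d \<mu> V"
proof (rule mlin_abs_le[OF mlin_Re_Im(1)[OF l.cf.mlin_K4(1)] _ z])
  fix z assume z: "z \<in> Rd d" "vnorm d z = 1"
  let ?u = "\<lambda>l::nat. if l = 0 then z else if l = 1 then w else if l = 2 then u else v"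
  let ?t = "restrict t {..<d}"
  have t': "vnorm d ?t < radius n d" using t by (simp only: vnorm_restrict)
  have "Re (l.cf.K4 z w u v t) = Re (l.cf.K4 z w u v ?t)" using K4_cong[of t ?t] by simp
  also have "\<dots> = tensor_apply d 4 (nabla l.Re_log ?t) ?u" using l.tensor4[OF t', of ?u] by simp
  also have "\<dots> \<le> c4 n d \<mu> V" unfolding l.Re_log_def
    by (rule tensor_le_c4[OF \<tau>V _ t']) (use z w u v in simp_all)
  finally show "Re (l.cf.K4 z w u v t) \<le> c4 n d \<mu> V" .
qed

lemma K3_le:
  assumes t: "vnorm d t < radius n d"
  shows "\<bar>Im (l.cf.K3 w u v t)\<bar> \<le> c3 n d \<mu> V * vnorm d w * vnorm d u * vnorm d v"
proof -
  have 1: "\<bar>Im (l.cf.K3 w u v t)\<bar> \<le> c3 n d \<mu> V * vnorm d w" if "u \<in> Rd d" "vnorm d u = 1" "v \<in> Rd d" "vnorm d v = 1" for w u v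
    by (rule mlin_bound[OF mlin_Re_Im(2)[OF l.cf.mlin_K3(1)]]) (rule K3_unit_le[OF t _ _ that])
  have 2: "\<bar>Im (l.cf.K3 w u v t)\<bar> \<le> c3 n d \<mu> V * vnorm d w * vnorm d u" if "v \<in> Rd d" "vnorm d v = 1" for w u v
    by (rule mlin_bound[OF mlin_Re_Im(2)[OF l.cf.mlin_K3(2)]]) (rule 1[OF _ _ that])
  show ?thesis
    by (rule mlin_bound[OF mlin_Re_Im(2)[OF l.cf.mlin_K3(3)]]) (rule 2)
qed

lemma K4_le:
  assumes t: "vnorm d t < radius n d"
  shows "\<bar>Re (l.cf.K4 z w u v t)\<bar> \<le> c4 n d \<mu> V * vnorm d z * vnorm d w * vnorm d u * vnorm d v"
proof -
  have 1: "\<bar>Re (l.cf.K4 z w u v t)\<bar> \<le> c4 n d \<mu> V * vnorm d z"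
    if "w \<in> Rd d" "vnorm d w = 1" "u \<in> Rd d" "vnorm d u = 1" "v \<in> Rd d" "vnorm d v = 1" for z w u v
    by (rule mlin_bound[OF mlin_Re_Im(1)[OF l.cf.mlin_K4(1)]]) (rule K4_unit_le[OF t _ _ that])
  have 2: "\<bar>Re (l.cf.K4 z w u v t)\<bar> \<le> c4 n d \<mu> V * vnorm d z * vnorm d w"
    if "u \<in> Rd d" "vnorm d u = 1" "v \<in> Rd d" "vnorm d v = 1" for z w u v
    by (rule mlin_bound[OF mlin_Re_Im(1)[OF l.cf.mlin_K4(2)]]) (rule 1[OF _ _ that])
  have 3: "\<bar>Re (l.cf.K4 z w u v t)\<bar> \<le> c4 n d \<mu> V * vnorm d z * vnorm d w * vnorm d u"
    if "v \<in> Rd d" "vnorm d v = 1" for z w u v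
    by (rule mlin_bound[OF mlin_Re_Im(1)[OF l.cf.mlin_K4(3)]]) (rule 2[OF _ _ that])
  show ?thesis
    by (rule mlin_bound[OF mlin_Re_Im(1)[OF l.cf.mlin_K4(4)]]) (rule 3)
qed

lemma c_nonneg: "0 \<le> c3 n d \<mu> V" "0 \<le> c4 n d \<mu> V"
proof -
  have "0 < d" using d1 by simp
  note e = unit_vectors_exist[OF this, THEN conjunct1] unit_vectors_exist[OF this, THEN conjunct2]
  have z: "vnorm d (\<lambda>i. 0) < radius n d" using radius_pos by (simp add: L2_set_def)
  show "0 \<le> c3 n d \<mu> V" by (rule order_trans[OF abs_ge_zero K3_unit_le[OF z e e e]])
  show "0 \<le> c4 n d \<mu> V" by (rule order_trans[OF abs_ge_zero K4_unit_le[OF z e e e e]])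
qed

sublocale core: charlog_n l.M d l.Y l.L "radius n d" "c3 n d \<mu> V" "c4 n d \<mu> V" "real n"
proof (intro charlog_n.intro charlog.intro charlog_axioms.intro charlog_n_axioms.intro)
  show "charfun l.M d l.Y" by (rule l.cf.charfun_axioms)
  show "1 \<le> d" by (rule d1)
  show "0 < radius n d" by (rule radius_pos)
  show "0 \<le> c3 n d \<mu> V" "0 \<le> c4 n d \<mu> V" by (rule c_nonneg)+
  show "(\<integral>x. l.Y i x \<partial>l.M) = 0" if "i < d" for i by (rule l.mean_Y[OF that])
  show "(\<integral>x. l.Y i x * l.Y j x \<partial>l.M) = (if i = j then 1 else 0)" if "i < d" "j < d" for i j by (rule l.cov_Y[OF that])
  show "exp (l.L t) = l.cf.chi t" if "vnorm d t < radius n d" for t by (rule l.exp_L[OF that])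
  show "((\<lambda>s. l.L (p s)) has_vector_derivative l.cf.m1 p' (p s)) (at s)"
    if "\<And>i. i < d \<Longrightarrow> ((\<lambda>s. p s i) has_real_derivative p' i) (at s)" "vnorm d (p s) < radius n d" for p p' s
    by (rule l.L_deriv[OF that])
  show "l.L (\<lambda>i. 0) = 0" by (rule l.L_0)
  show "Im (l.L (\<lambda>i\<in>{..<d}. - t i)) = - Im (l.L t)" if "vnorm d t < radius n d" for t by (rule l.L_odd[OF that])
  show "l.L \<in> borel_measurable (leb d)" by (rule l.L_meas)
  show "\<bar>Im (l.cf.K3 w u v t)\<bar> \<le> c3 n d \<mu> V * vnorm d w * vnorm d u * vnorm d v" if "vnorm d t < radius n d" for w u v t by (rule K3_le[OF that])
  show "\<bar>Re (l.cf.K4 z w u v t)\<bar> \<le> c4 n d \<mu> V * vnorm d z * vnorm d w * vnorm d u * vnorm d v" if "vnorm d t < radius n d" for z w u v t by (rule K4_le[OF that])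
  show "0 < real n" using n1 by simp
  show "radius n d = 5/2 * sqrt (real d / real n)" by (simp add: radius_def)
qed

text \<open>
  The \<open>n\<close>-th powers of the two decay functions are \<open>exp (- (n d)\<^sup>1\<^sup>/\<^sup>2 \<parallel>t\<parallel>)\<close> and \<open>(1 + \<parallel>t\<parallel>)\<close> to the power
  \<open>- m\<close> with \<open>m = \<kappa> n / d\<^sup>1\<^sup>/\<^sup>2\<close>; for this \<open>m\<close> the base \<open>e n d / m\<^sup>2\<close> is \<open>e \<epsilon> / \<kappa>\<^sup>2\<close>.
\<close>

lemma outer_bound:
  assumes m: "10 * real d \<le> \<kappa> * real n / sqrt (real d)"
  shows "ennreal (sqrt (real n / (2 * pi)) ^ d) * (\<integral>\<^sup>+x. ennreal (cmod (l.cf.chi x) ^ n) * indicator {x \<in> Rd d. radius n d \<le> vnorm d x} x \<partial>leb d)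
    \<le> ennreal (5 / 3 * exp (- real d) + 2 * (exp 1 / \<kappa>\<^sup>2 * (real d ^ 2 / real n)) powr (real d / 2))"
proof -
  define m' where "m' = \<kappa> * real n / sqrt (real d)"
  have n0: "0 < real n" using n1 by simp
  have d0: "0 < real d" using d1 by simp
  let ?k = "ennreal (sqrt (real n / (2 * pi)) ^ d)"
  let ?I = "indicator {x \<in> Rd d. radius n d \<le> vnorm d x} :: (nat \<Rightarrow> real) \<Rightarrow> ennreal"
  let ?f = "\<lambda>x. ennreal (exp (- (sqrt (real n * real d) * vnorm d x))) * ?I x"
  let ?g = "\<lambda>x. ennreal ((1 + vnorm d x) powr (- m')) * ?I x"
  have [measurable]: "{x \<in> Rd d. radius n d \<le> vnorm d x} \<in> sets (leb d)" unfolding space_leb[symmetric] by measurable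
  have pt: "cmod (l.cf.chi x) ^ n \<le> exp (- (sqrt (real n * real d) * vnorm d x)) + (1 + vnorm d x) powr (- m')"
    if x: "x \<in> Rd d" "radius n d \<le> vnorm d x" for x
  proof -
    have "cmod (l.cf.chi x) = cmod (cmgf d \<mu> (cpoint d \<mu> \<tau> x) / of_real (mgf d \<mu> \<tau>))"
      using l.phi unfolding l.Phi_def[symmetric] l.phi_def[symmetric] l.Phi_eq by (simp add: norm_mult norm_divide)
    also have "\<dots> \<le> max (exp (- (sqrt (real d / real n) * vnorm d x))) ((1 + vnorm d x) powr (- \<kappa> / sqrt (real d)))"
      using A3 \<tau>V x unfolding A3_def by blast
    finally have "cmod (l.cf.chi x) ^ n \<le> (max (exp (- (sqrt (real d / real n) * vnorm d x))) ((1 + vnorm d x) powr (- \<kappa> / sqrt (real d)))) ^ n"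
      by (rule power_mono) simp
    also have "\<dots> \<le> exp (- (sqrt (real d / real n) * vnorm d x)) ^ n + ((1 + vnorm d x) powr (- \<kappa> / sqrt (real d))) ^ n"
      by (simp add: max_def)
    also have "exp (- (sqrt (real d / real n) * vnorm d x)) ^ n = exp (- (sqrt (real n * real d) * vnorm d x))"
    proof -
      have "real n * sqrt (real d / real n) = sqrt (real n * real d)"
        using n0 real_sqrt_mult_self[of "real n"] by (simp add: real_sqrt_divide real_sqrt_mult field_simps)
      then show ?thesis by (simp add: exp_of_nat_mult[symmetric] mult.assoc[symmetric])
    qed
    also have "((1 + vnorm d x) powr (- \<kappa> / sqrt (real d))) ^ n = (1 + vnorm d x) powr (- m')"
    proof -
      have "0 < 1 + vnorm d x" using vnorm_nonneg[of x d] by linarith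
      then have "((1 + vnorm d x) powr (- \<kappa> / sqrt (real d))) ^ n = (1 + vnorm d x) powr ((- \<kappa> / sqrt (real d)) * real n)"
        by (simp add: powr_realpow[symmetric] powr_powr)
      then show ?thesis by (simp add: m'_def)
    qed
    finally show ?thesis .
  qed
  have "?k * (\<integral>\<^sup>+x. ennreal (cmod (l.cf.chi x) ^ n) * ?I x \<partial>leb d) \<le> ?k * (\<integral>\<^sup>+x. ?f x + ?g x \<partial>leb d)"
  proof (intro mult_left_mono nn_integral_mono)
    fix x
    show "ennreal (cmod (l.cf.chi x) ^ n) * ?I x \<le> ?f x + ?g x"
    proof (cases "x \<in> {x \<in> Rd d. radius n d \<le> vnorm d x}")
      case True
      then have "ennreal (cmod (l.cf.chi x) ^ n) \<le> ennreal (exp (- (sqrt (real n * real d) * vnorm d x)) + (1 + vnorm d x) powr (- m'))"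
        by (intro ennreal_leI pt) simp_all
      then show ?thesis using True by simp
    next
      case False
      then have "?I x = 0" by (rule indicator_simps(2))
      then show ?thesis by (simp only: mult_zero_right add_0 order_refl)
    qed
  qed simp
  also have "\<dots> = ?k * (\<integral>\<^sup>+x. ?f x \<partial>leb d) + ?k * (\<integral>\<^sup>+x. ?g x \<partial>leb d)"
    by (subst nn_integral_add) (simp_all add: distrib_left)
  also have "\<dots> \<le> ennreal (5 / 3 * exp (- real d)) + ennreal (2 * (exp 1 * real n * real d / m'\<^sup>2) powr (real d / 2))"
    using outer_exp_bound[OF n0 d1] outer_powr_bound[OF n0 d1 _ radius_pos, of m'] m
    by (intro add_mono) (simp_all add: radius_def m'_def)
  also have "exp 1 * real n * real d / m'\<^sup>2 = exp 1 / \<kappa>\<^sup>2 * (real d ^ 2 / real n)"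
    using n0 d0 \<kappa> by (simp add: m'_def power_divide power_mult_distrib power2_eq_square)
  also have "ennreal (5 / 3 * exp (- real d)) + ennreal (2 * (exp 1 / \<kappa>\<^sup>2 * (real d ^ 2 / real n)) powr (real d / 2))
     = ennreal (5 / 3 * exp (- real d) + 2 * (exp 1 / \<kappa>\<^sup>2 * (real d ^ 2 / real n)) powr (real d / 2))"
    by (rule ennreal_plus[symmetric]) simp_all
  finally show ?thesis .
qed

lemma saddle_integral:
  assumes \<tau>': "\<tau> = inv_into V (grad_cgf d \<mu>) b" and b: "grad_cgf d \<mu> \<tau> = b"
  shows "I_integral n d \<mu> V b = of_real (sqrt (real n / (2 * pi)) ^ d) * (\<integral>t. l.cf.chi t ^ n \<partial>leb d)"
proof -
  have n0: "0 < real n" using n1 by simp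
  have "real n powr (real d / 2) / (2 * pi) powr (real d / 2) = sqrt (real n / (2 * pi)) ^ d"
  proof -
    let ?z = "real n / (2 * pi)"
    have z: "0 < ?z" using n0 by simp
    then have "sqrt ?z ^ d = sqrt ?z powr real d" by (simp add: powr_realpow)
    also have "\<dots> = ?z powr (real d / 2)" using z by (simp add: powr_half_sqrt[symmetric] powr_powr)
    also have "\<dots> = real n powr (real d / 2) / (2 * pi) powr (real d / 2)" by (rule powr_divide)
    finally show ?thesis ..
  qed
  moreover have "(cmgf d \<mu> (cpoint d \<mu> \<tau> t) / of_real (mgf d \<mu> \<tau>)) ^ n * exp (- \<i> * of_real (real n * dot d (whiten d \<mu> \<tau> t) b)) = l.cf.chi t ^ n" for t
  proof -
    have e: "dot d (whiten d \<mu> \<tau> t) b = l.ell t"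
      unfolding l.ell_def b[symmetric] by (simp add: l.a_def grad_cgf_eq(2)[OF \<tau>V])
    have "exp (- \<i> * of_real (real n * l.ell t)) = exp (- (\<i> * of_real (l.ell t))) ^ n"
      by (simp add: exp_of_nat_mult[symmetric] mult_ac)
    then have "(cmgf d \<mu> (cpoint d \<mu> \<tau> t) / of_real (mgf d \<mu> \<tau>)) ^ n * exp (- \<i> * of_real (real n * l.ell t))
      = (l.Phi t / of_real l.phi * exp (- (\<i> * of_real (l.ell t)))) ^ n"
      by (simp only: l.Phi_def l.phi_def power_mult_distrib)
    also have "l.Phi t / of_real l.phi * exp (- (\<i> * of_real (l.ell t))) = l.cf.chi t"
      using l.phi by (simp add: l.Phi_eq cis_conv_exp exp_minus)
    finally show ?thesis unfolding e .
  qed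
  ultimately show ?thesis unfolding I_integral_def Let_def \<tau>'[symmetric] by simp
qed

lemma saddle_bound:
  assumes \<tau>': "\<tau> = inv_into V (grad_cgf d \<mu>) b" and b: "grad_cgf d \<mu> \<tau> = b"
    and m: "10 * real d \<le> \<kappa> * real n / sqrt (real d)"
  defines "\<epsilon> \<equiv> real d ^ 2 / real n"
  shows "cmod (I_integral n d \<mu> V b - 1)
     \<le> 600 * (exp (40 * c4 n d \<mu> V * \<epsilon>) * ((c3 n d \<mu> V)\<^sup>2 + c4 n d \<mu> V) * \<epsilon> + exp (- real d) + (exp 1 / \<kappa>\<^sup>2 * \<epsilon>) powr (real d / 2))"
proof -
  let ?p = "(exp 1 / \<kappa>\<^sup>2 * \<epsilon>) powr (real d / 2)" let ?q = "exp (40 * c4 n d \<mu> V * \<epsilon>) * ((c3 n d \<mu> V)\<^sup>2 + c4 n d \<mu> V) * \<epsilon>"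
  have "cmod (I_integral n d \<mu> V b - 1) \<le> 600 * ?q + exp (- real d) + (5 / 3 * exp (- real d) + 2 * ?p)"
    unfolding saddle_integral[OF \<tau>' b] \<epsilon>_def core.eps_def[symmetric]
    by (rule core.core_bound[OF refl _ outer_bound[OF m, folded core.eps_def]]) simp
  also have "\<dots> \<le> 600 * (?q + exp (- real d) + ?p)"
    using exp_ge_zero[of "- real d"] powr_ge_zero[of "exp 1 / \<kappa>\<^sup>2 * \<epsilon>" "real d / 2"] unfolding distrib_left by linarith
  finally show ?thesis .
qed

end

theorem theorem3p1:
  "\<exists>C::real. C > 0 \<and> (\<forall>\<kappa>::real. \<forall>\<delta>::real. \<kappa> > 0 \<longrightarrow> \<delta> > 0 \<longrightarrow> (\<exists>\<epsilon>\<^sub>0::real. \<epsilon>\<^sub>0 > 0 \<and>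
     (\<forall>(d :: nat \<Rightarrow> nat) (\<mu> :: nat \<Rightarrow> (nat \<Rightarrow> real) measure) (V :: nat \<Rightarrow> (nat \<Rightarrow> real) set).
        (\<forall>n\<ge>1. d n \<ge> 1 \<and> is_law (d n) (\<mu> n)) \<longrightarrow>
        filterlim d at_top sequentially \<longrightarrow>
        (\<forall>\<^sub>F n in sequentially. conditions \<kappa> \<delta> n (d n) (\<mu> n) (V n)) \<longrightarrow>
        (\<forall>n\<ge>1. conditions \<kappa> \<delta> n (d n) (\<mu> n) (V n) \<longrightarrow>
          (let \<epsilon> = real (d n) ^ 2 / real n;
               k3 = c3 n (d n) (\<mu> n) (V n);
               k4 = c4 n (d n) (\<mu> n) (V n)
           in \<epsilon> \<le> \<epsilon>\<^sub>0 \<longrightarrow>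
             (\<forall>a \<in> U (d n) (\<mu> n) (V n).
                cmod (I_integral n (d n) (\<mu> n) (V n) a - 1)
                  \<le> C * (exp (40 * k4 * \<epsilon>) * (k3 ^ 2 + k4) * \<epsilon> + exp (- real (d n))
                         + (exp 1 / \<kappa> ^ 2 * \<epsilon>) powr (real (d n) / 2))))))))"
proof (rule exI[of _ 600], intro conjI allI impI)
  fix \<kappa> \<delta> :: real assume \<kappa>: "\<kappa> > 0" and \<delta>: "\<delta> > 0"
  have main: "cmod (I_integral n d \<mu> V a - 1)
     \<le> 600 * (exp (40 * c4 n d \<mu> V * (real d ^ 2 / real n)) * ((c3 n d \<mu> V)\<^sup>2 + c4 n d \<mu> V) * (real d ^ 2 / real n)
        + exp (- real d) + (exp 1 / \<kappa>\<^sup>2 * (real d ^ 2 / real n)) powr (real d / 2))"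
    if law: "is_law d \<mu>" and d: "1 \<le> d" and n: "1 \<le> n" and c: "conditions \<kappa> \<delta> n d \<mu> V"
      and eps: "real d ^ 2 / real n \<le> \<kappa> / 10" and a: "a \<in> U d \<mu> V" for d n :: nat and \<mu> V a
  proof -
    let ?\<tau> = "inv_into V (grad_cgf d \<mu>) a"
    have a': "a \<in> grad_cgf d \<mu> ` V" using a by (simp add: U_def)
    interpret law_saddle d \<mu> V \<delta> \<kappa> n ?\<tau>
      by unfold_locales (use law d n c \<kappa> \<delta> inv_into_into[OF a'] in \<open>simp_all add: conditions_def\<close>)
    have n0: "0 < real n" and d0: "1 \<le> real d" using n d by auto
    have s1: "1 \<le> sqrt (real d)" using d0 by simp
    (* With epsilon at most kappa / 10 the polynomial decay rate m is at least ten times d. *)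
    have "10 * real d ^ 2 \<le> \<kappa> * real n" using eps n0 by (simp add: field_simps)
    then have "10 * real d * (real d / sqrt (real d)) \<le> \<kappa> * real n / sqrt (real d)"
      using s1 by (simp add: divide_right_mono power2_eq_square)
    moreover have "real d / sqrt (real d) = sqrt (real d)" by (rule real_div_sqrt) simp
    ultimately have "10 * real d * sqrt (real d) \<le> \<kappa> * real n / sqrt (real d)" by simp
    moreover have "10 * real d * 1 \<le> 10 * real d * sqrt (real d)" using s1 by (intro mult_left_mono) auto
    ultimately have "10 * real d \<le> \<kappa> * real n / sqrt (real d)" by linarith
    from saddle_bound[OF refl f_inv_into_f[OF a'] this] show ?thesis .
  qed
  show "\<exists>\<epsilon>\<^sub>0::real. \<epsilon>\<^sub>0 > 0 \<and>
     (\<forall>(d :: nat \<Rightarrow> nat) (\<mu> :: nat \<Rightarrow> (nat \<Rightarrow> real) measure) (V :: nat \<Rightarrow> (nat \<Rightarrow> real) set).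
        (\<forall>n\<ge>1. d n \<ge> 1 \<and> is_law (d n) (\<mu> n)) \<longrightarrow>
        filterlim d at_top sequentially \<longrightarrow>
        (\<forall>\<^sub>F n in sequentially. conditions \<kappa> \<delta> n (d n) (\<mu> n) (V n)) \<longrightarrow>
        (\<forall>n\<ge>1. conditions \<kappa> \<delta> n (d n) (\<mu> n) (V n) \<longrightarrow>
          (let \<epsilon> = real (d n) ^ 2 / real n;
               k3 = c3 n (d n) (\<mu> n) (V n);
               k4 = c4 n (d n) (\<mu> n) (V n)
           in \<epsilon> \<le> \<epsilon>\<^sub>0 \<longrightarrow>
             (\<forall>a \<in> U (d n) (\<mu> n) (V n).
                cmod (I_integral n (d n) (\<mu> n) (V n) a - 1)
                  \<le> 600 * (exp (40 * k4 * \<epsilon>) * (k3 ^ 2 + k4) * \<epsilon> + exp (- real (d n))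
                         + (exp 1 / \<kappa> ^ 2 * \<epsilon>) powr (real (d n) / 2))))))"
    unfolding Let_def
    by (rule exI[of _ "\<kappa> / 10"], intro conjI allI impI ballI, simp add: \<kappa>, rule main, assumption?) (simp_all add: \<kappa>)
qed simp

end
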